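(* Let $\mathbb{V}$ be a $10$-dimensional real vector space with an inner product $\langle -,-\rangle$ of euclidean or lorentzian signature, and let $F\in\Lambda^5\mathbb{V}^*$. Then $[\iota_\Xi F, F]=0$ for all $\Xi\in\Lambda^3\mathbb{V}$ if and only if $F=F_1+F_2$ for some simple $5$-forms $F_1,F_2\in\Lambda^5\mathbb{V}^*$ which are orthogonal to each other.
   Context: An inner product is a nondegenerate symmetric bilinear form; euclidean means positive-definite, and lorentzian means of signature $(1,\dim\mathbb{V}-1)$ (one timelike direction). For $\Xi\in\Lambda^{3}\mathbb{V}$, $\iota_\Xi F$ is the $2$-form obtained by contracting $F$ with $\Xi$; for $\Xi=X_1\wedge X_2\wedge X_3$ it is $F(X_1,X_2,X_3,-,-)$. A $2$-form $\omega\in\Lambda^2\mathbb{V}^*\cong\mathfrak{so}(\mathbb{V})$ acts on forms $\Omega\in\Lambda\mathbb{V}^*$ by $[\omega,\Omega]$, defined for $\omega=\alpha\wedge\beta$ with $\alpha,\beta\in\mathbb{V}^*$ by $$[\alpha\wedge\beta,\Omega]=\alpha\wedge\iota_{\beta^\sharp}\Omega-\beta\wedge\iota_{\alpha^\sharp}\Omega$$ and extended linearly in $\omega$, where $\alpha^\sharp\in\mathbb{V}$ is the vector dual to $\alpha$ under the inner product. A $p$-form is simple if it can be written as a wedge product of $p$ one-forms. A nonzero simple form determines a $p$-plane, the span of those one-forms, regarded as a subspace $\Pi\subset\mathbb{V}$ using the inner product to identify $\mathbb{V}^*$ with $\mathbb{V}$. Two nonzero simple $p$-forms are orthogonal if their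 planes satisfy $\langle X_1,X_2\rangle=0$ for all $X_1\in\Pi_1$, $X_2\in\Pi_2$; in lorentzian signature the planes may share a null direction. The zero form counts as simple and as orthogonal to every simple form (so $F$ simple is allowed as a degenerate case). *)

theory Defs
  imports "HOL-Analysis.Analysis"
begin

section \<open>Inner products\<close>

definition inner_product :: "('a::real_vector \<Rightarrow> 'a \<Rightarrow> real) \<Rightarrow> bool" where
  "inner_product g \<longleftrightarrow>
     bilinear g \<and> (\<forall>x y. g x y = g y x) \<and> (\<forall>x. (\<forall>y. g x y = 0) \<longrightarrow> x = 0)"

definition euclidean_product :: "('a::real_vector \<Rightarrow> 'a \<Rightarrow> real) \<Rightarrow> bool" where
  "euclidean_product g \<longleftrightarrow> (\<forall>x. x \<noteq> 0 \<longrightarrow> g x x > 0)"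

text \<open>
  Signature \<open>(t, s)\<close>: \<open>t\<close> timelike (negative) and \<open>s\<close> spacelike (positive) directions.
  The opposite sign convention amounts to replacing \<open>g\<close> by \<open>-g\<close>.
\<close>

definition has_signature :: "('a::real_vector \<Rightarrow> 'a \<Rightarrow> real) \<Rightarrow> nat \<Rightarrow> nat \<Rightarrow> bool" where
  "has_signature g t s \<longleftrightarrow>
     (\<exists>T S. finite T \<and> finite S \<and> T \<inter> S = {} \<and> card T = t \<and> card S = s \<and>
        independent (T \<union> S) \<and> span (T \<union> S) = UNIV \<and>
        (\<forall>x\<in>T \<union> S. \<forall>y\<in>T \<union> S. x \<noteq> y \<longrightarrow> g x y = 0) \<and>
        (\<forall>x\<in>T. g x x = -1) \<and> (\<forall>x\<in>S. g x x = 1))"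

definition lorentzian_product :: "('a::real_vector \<Rightarrow> 'a \<Rightarrow> real) \<Rightarrow> bool" where
  "lorentzian_product g \<longleftrightarrow> has_signature g 1 (dim (UNIV :: 'a set) - 1)"

definition sharp :: "('a::real_vector \<Rightarrow> 'a \<Rightarrow> real) \<Rightarrow> ('a \<Rightarrow> real) \<Rightarrow> 'a" where
  "sharp g \<alpha> = (THE v. \<forall>w. g v w = \<alpha> w)"


section \<open>Forms\<close>

text \<open>
  A form is a real-valued function on lists of vectors. A \<open>p\<close>-form is an alternating
  multilinear function on lists of length \<open>p\<close>; it vanishes on lists of any other length, so that
  equality of functions is equality of forms. One-forms are handled directly as linear
  functionals \<open>'a \<Rightarrow> real\<close>.
\<close>

definition alternating_form :: "nat \<Rightarrow> ('a::real_vector list \<Rightarrow> real) \<Rightarrow> bool" where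
  "alternating_form p \<omega> \<longleftrightarrow>
     (\<forall>vs. length vs \<noteq> p \<longrightarrow> \<omega> vs = 0) \<and>
     (\<forall>vs i. length vs = p \<and> i < p \<longrightarrow> linear (\<lambda>x. \<omega> (vs[i := x]))) \<and>
     (\<forall>vs i j. length vs = p \<and> i < j \<and> j < p \<and> vs ! i = vs ! j \<longrightarrow> \<omega> vs = 0)"

definition omit :: "nat \<Rightarrow> 'a list \<Rightarrow> 'a list" where
  "omit i vs = take i vs @ drop (Suc i) vs"

text \<open>The wedge product of a one-form with a form, and of a list of one-forms; thus
  \<open>(\<alpha>\<^sub>1 \<and> \<dots> \<and> \<alpha>\<^sub>p)(v\<^sub>1, \<dots>, v\<^sub>p) = det (\<alpha>\<^sub>i(v\<^sub>j))\<close>.\<close>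

definition wedge :: "('a \<Rightarrow> real) \<Rightarrow> ('a list \<Rightarrow> real) \<Rightarrow> 'a list \<Rightarrow> real" where
  "wedge \<alpha> \<omega> vs = (\<Sum>i<length vs. (-1) ^ i * \<alpha> (vs ! i) * \<omega> (omit i vs))"

definition unit_form :: "'a list \<Rightarrow> real" where
  "unit_form vs = (if vs = [] then 1 else 0)"

definition wedge_list :: "('a \<Rightarrow> real) list \<Rightarrow> 'a list \<Rightarrow> real" where
  "wedge_list \<alpha>s = foldr wedge \<alpha>s unit_form"

definition interior_product :: "'a \<Rightarrow> ('a list \<Rightarrow> real) \<Rightarrow> 'a list \<Rightarrow> real" where
  "interior_product X \<omega> vs = \<omega> (X # vs)"


section \<open>Multivectors and contraction\<close>

text \<open>
  \<open>vector_wedge [X\<^sub>1, \<dots>, X\<^sub>p]\<close> is \<open>X\<^sub>1 \<and> \<dots> \<and> X\<^sub>p\<close>, realised as the evaluation functional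
  \<open>\<omega> \<mapsto> \<omega>(X\<^sub>1, \<dots>, X\<^sub>p)\<close> on \<open>p\<close>-forms (canonically, \<open>\<Lambda>\<^sup>p V = (\<Lambda>\<^sup>p V\<^sup>*)\<^sup>*\<close> in finite
  dimension). Functions that are not \<open>p\<close>-forms are sent to \<open>0\<close>, so that the relations of the
  exterior power hold.
\<close>

definition vector_wedge :: "'a::real_vector list \<Rightarrow> ('a list \<Rightarrow> real) \<Rightarrow> real" where
  "vector_wedge Xs \<omega> = (if alternating_form (length Xs) \<omega> then \<omega> Xs else 0)"

definition multivectors :: "nat \<Rightarrow> (('a::real_vector list \<Rightarrow> real) \<Rightarrow> real) set" where
  "multivectors p =
     {\<Xi>. \<exists>D. (\<forall>(c, Xs)\<in>set D. length Xs = p) \<and>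
              \<Xi> = (\<lambda>\<omega>. \<Sum>(c, Xs)\<leftarrow>D. c * vector_wedge Xs \<omega>)}"

text \<open>Contraction of a form with a \<open>p\<close>-vector into its first \<open>p\<close> slots;
  see \<open>contract_vector_wedge\<close>.\<close>

definition contract ::
  "nat \<Rightarrow> (('a list \<Rightarrow> real) \<Rightarrow> real) \<Rightarrow> ('a list \<Rightarrow> real) \<Rightarrow> 'a list \<Rightarrow> real" where
  "contract p \<Xi> \<Omega> vs = \<Xi> (\<lambda>us. if length us = p then \<Omega> (us @ vs) else 0)"


section \<open>The action of two-forms on forms\<close>

definition simple_bracket ::
  "('a::real_vector \<Rightarrow> 'a \<Rightarrow> real) \<Rightarrow> ('a \<Rightarrow> real) \<Rightarrow> ('a \<Rightarrow> real) \<Rightarrow> ('a list \<Rightarrow> real) \<Rightarrow> 'a list \<Rightarrow> real"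
  where
  "simple_bracket g \<alpha> \<beta> \<Omega> vs =
     wedge \<alpha> (interior_product (sharp g \<beta>) \<Omega>) vs - wedge \<beta> (interior_product (sharp g \<alpha>) \<Omega>) vs"

definition two_form_decomp ::
  "('a::real_vector list \<Rightarrow> real) \<Rightarrow> (('a \<Rightarrow> real) \<times> ('a \<Rightarrow> real)) list \<Rightarrow> bool" where
  "two_form_decomp \<omega> D \<longleftrightarrow>
     (\<forall>(\<alpha>, \<beta>)\<in>set D. linear \<alpha> \<and> linear \<beta>) \<and>
     \<omega> = (\<lambda>vs. \<Sum>(\<alpha>, \<beta>)\<leftarrow>D. wedge_list [\<alpha>, \<beta>] vs)"

text \<open>The linear extension of \<open>simple_bracket\<close> from \<open>\<alpha> \<and> \<beta>\<close> to all two-forms. Existence of a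
  decomposition and independence of its choice are \<open>two_form_decomp_exists\<close> and
  \<open>bracket_eq\<close>.\<close>

definition bracket ::
  "('a::real_vector \<Rightarrow> 'a \<Rightarrow> real) \<Rightarrow> ('a list \<Rightarrow> real) \<Rightarrow> ('a list \<Rightarrow> real) \<Rightarrow> 'a list \<Rightarrow> real" where
  "bracket g \<omega> \<Omega> =
     (THE \<Psi>. \<exists>D. two_form_decomp \<omega> D \<and>
                   \<Psi> = (\<lambda>vs. \<Sum>(\<alpha>, \<beta>)\<leftarrow>D. simple_bracket g \<alpha> \<beta> \<Omega> vs))"


section \<open>Simple forms and orthogonality\<close>

definition simple_form :: "nat \<Rightarrow> ('a::real_vector list \<Rightarrow> real) \<Rightarrow> bool" where
  "simple_form p \<omega> \<longleftrightarrow>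
     (\<exists>\<alpha>s. length \<alpha>s = p \<and> (\<forall>\<alpha>\<in>set \<alpha>s. linear \<alpha>) \<and> \<omega> = wedge_list \<alpha>s)"

text \<open>The plane of a nonzero simple form; it does not depend on the chosen factors
  (\<open>plane_wedge_list\<close>).\<close>

definition plane ::
  "('a::real_vector \<Rightarrow> 'a \<Rightarrow> real) \<Rightarrow> nat \<Rightarrow> ('a list \<Rightarrow> real) \<Rightarrow> 'a set" where
  "plane g p \<omega> =
     (THE P. \<exists>\<alpha>s. length \<alpha>s = p \<and> (\<forall>\<alpha>\<in>set \<alpha>s. linear \<alpha>) \<and> \<omega> = wedge_list \<alpha>s \<and>
                  P = span (sharp g ` set \<alpha>s))"

definition orthogonal_simple ::
  "('a::real_vector \<Rightarrow> 'a \<Rightarrow> real) \<Rightarrow> nat \<Rightarrow> ('a list \<Rightarrow> real) \<Rightarrow> ('a list \<Rightarrow> real) \<Rightarrow> bool" where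
  "orthogonal_simple g p \<omega>\<^sub>1 \<omega>\<^sub>2 \<longleftrightarrow>
     \<omega>\<^sub>1 = (\<lambda>_. 0) \<or> \<omega>\<^sub>2 = (\<lambda>_. 0) \<or>
     (\<forall>X\<^sub>1\<in>plane g p \<omega>\<^sub>1. \<forall>X\<^sub>2\<in>plane g p \<omega>\<^sub>2. g X\<^sub>1 X\<^sub>2 = 0)"


section \<open>The definitions are unambiguous\<close>

lemma finite_basis_ex:
  assumes "dim (UNIV :: 'a::real_vector set) > 0"
  obtains B :: "'a::real_vector set" where "finite B" "independent B" "span B = UNIV"
proof -
  obtain B :: "'a set" where B: "independent B" "UNIV \<subseteq> span B" "card B = dim (UNIV :: 'a set)"
    using basis_exists[of "UNIV :: 'a set"] by auto
  then have "finite B" using assms card_ge_0_finite by force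
  with B that show thesis by auto
qed

lemma sharp_works:
  fixes g :: "'a::real_vector \<Rightarrow> 'a \<Rightarrow> real"
  assumes fd: "dim (UNIV :: 'a set) > 0" and g: "inner_product g" and \<alpha>: "linear \<alpha>"
  shows "g (sharp g \<alpha>) w = \<alpha> w"
proof -
  have bl: "bilinear g" and nd: "\<And>x. (\<And>y. g x y = 0) \<Longrightarrow> x = 0"
    using g by (auto simp: inner_product_def)
  have linr: "linear (g v)" and linl: "linear (\<lambda>v. g v w)" for v w
    using bl by (auto simp: bilinear_def)
  obtain B :: "'a set" where B: "finite B" "independent B" "span B = UNIV"
    using finite_basis_ex[OF fd] by blast
  interpret V: finite_dimensional_vector_space "scaleR :: real \<Rightarrow> 'a \<Rightarrow> 'a" B
    by unfold_locales (use B in \<open>auto simp: dependent_raw_def span_raw_def\<close>)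
  define T where "T v = (\<Sum>b\<in>B. g v b *\<^sub>R b)" for v
  have eqB: "g v = f" if "linear f" "\<And>b. b \<in> B \<Longrightarrow> g v b = f b" for v f
    using linear_eq_on_span[OF linr that(1), of B] that(2) B(3) by auto
  have coef: "h b = k b" if "(\<Sum>b\<in>B. h b *\<^sub>R b) = (\<Sum>b\<in>B. k b *\<^sub>R b)" "b \<in> B" for h k b
  proof -
    have "(\<Sum>b\<in>B. (h b - k b) *\<^sub>R b) = 0"
      using that(1) by (simp add: scaleR_diff_left sum_subtractf)
    then show ?thesis
      using independentD[OF B(2) B(1) order_refl, of "\<lambda>b. h b - k b"] that(2) by auto
  qed
  have linT: "linear T"
    by (auto intro!: linearI simp: T_def bilinear_ladd[OF bl] bilinear_lmul[OF bl]
        scaleR_add_left sum.distrib scaleR_sum_right)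
  have "inj T"
  proof (rule injI)
    fix x y assume "T x = T y"
    then have "g x b = g y b" if "b \<in> B" for b
      using coef[of "g x" "g y"] that by (simp add: T_def)
    then have "g x = g y" by (intro eqB linr)
    then have "g (x - y) z = 0" for z by (simp add: bilinear_lsub[OF bl])
    then show "x = y" using nd[of "x - y"] by simp
  qed
  then have "surj T" using V.linear_inj_imp_surj[of T] linT by (simp add: linear_def)
  then obtain v where v: "T v = (\<Sum>b\<in>B. \<alpha> b *\<^sub>R b)" by (metis surjD)
  then have "g v b = \<alpha> b" if "b \<in> B" for b using coef[of "g v" \<alpha>] that by (simp add: T_def)
  then have gv: "g v = \<alpha>" by (intro eqB \<alpha>)
  have "(\<forall>w. g v' w = \<alpha> w) \<Longrightarrow> v' = v" for v'
    using nd[of "v' - v"] gv by (auto simp: bilinear_lsub[OF bl])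
  then have "sharp g \<alpha> = v" unfolding sharp_def using gv by (intro the_equality) auto
  then show ?thesis using gv by simp
qed

lemma sharp_eqI:
  assumes "inner_product g" "\<And>w. g v w = \<alpha> w"
  shows "sharp g \<alpha> = v"
  unfolding sharp_def
proof (rule the_equality)
  have bl: "bilinear g" using assms(1) by (simp add: inner_product_def)
  fix u assume "\<forall>w. g u w = \<alpha> w"
  then have "g (u - v) w = 0" for w
    using assms(2) by (simp add: bilinear_lsub[OF bl])
  then have "u - v = 0" using assms(1) unfolding inner_product_def by blast
  then show "u = v" by simp
qed (use assms in auto)

lemma wedge_Nil [simp]: "wedge \<alpha> \<omega> [] = 0"
  by (simp add: wedge_def)

lemma wedge_Cons:
  "wedge \<alpha> \<omega> (v # vs) = \<alpha> v * \<omega> vs - wedge \<alpha> (interior_product v \<omega>) vs"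
  by (simp add: wedge_def sum.lessThan_Suc_shift omit_def interior_product_def
      sum_negf[symmetric] del: sum.lessThan_Suc)

lemma interior_product_wedge:
  "interior_product v (wedge \<alpha> \<omega>) = (\<lambda>vs. \<alpha> v * \<omega> vs - wedge \<alpha> (interior_product v \<omega>) vs)"
  by (rule ext) (simp add: interior_product_def[of v "wedge \<alpha> \<omega>"] wedge_Cons)

lemma wedge_diff: "wedge \<alpha> (\<lambda>us. \<omega> us - \<eta> us) vs = wedge \<alpha> \<omega> vs - wedge \<alpha> \<eta> vs"
  by (simp add: wedge_def algebra_simps sum_subtractf)

lemma wedge_scale: "wedge \<alpha> (\<lambda>us. c * \<omega> us) vs = c * wedge \<alpha> \<omega> vs"
  by (simp add: wedge_def sum_distrib_left algebra_simps)

lemma wedge_anticommute: "wedge \<alpha> (wedge \<beta> \<omega>) vs = - wedge \<beta> (wedge \<alpha> \<omega>) vs"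
proof (induction vs arbitrary: \<omega>)
  case (Cons v vs)
  show ?case
    using Cons[of "interior_product v \<omega>"]
    by (simp add: wedge_Cons[of _ "wedge _ _"] interior_product_wedge wedge_diff wedge_scale)
qed simp

lemma wedge_self: "wedge \<alpha> (wedge \<alpha> \<omega>) = (\<lambda>_. 0)"
  using wedge_anticommute[of \<alpha> \<alpha> \<omega>] by auto

lemma wedge_zero: "wedge \<alpha> (\<lambda>_. 0) = (\<lambda>_. 0)"
  by (auto simp: wedge_def)

lemma wedge_list_Nil [simp]: "wedge_list [] = unit_form"
  by (simp add: wedge_list_def)

lemma wedge_list_Cons [simp]: "wedge_list (\<alpha> # \<alpha>s) = wedge \<alpha> (wedge_list \<alpha>s)"
  by (simp add: wedge_list_def)

lemma wedge_wedge_list_mem: "\<alpha> \<in> set \<alpha>s \<Longrightarrow> wedge \<alpha> (wedge_list \<alpha>s) = (\<lambda>_. 0)"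
proof (induction \<alpha>s)
  case (Cons \<beta> \<alpha>s)
  show ?case
  proof (cases "\<alpha> = \<beta>")
    case False
    then have "wedge \<alpha> (wedge_list \<alpha>s) = (\<lambda>_. 0)" using Cons by simp
    then show ?thesis
      using wedge_anticommute[of \<alpha> \<beta> "wedge_list \<alpha>s"] by (auto simp: wedge_zero)
  qed (simp add: wedge_self)
qed simp

lemma wedge_list_pair:
  "wedge_list [\<alpha>, \<beta>] vs = (if length vs = 2 then \<alpha> (vs ! 0) * \<beta> (vs ! 1) - \<alpha> (vs ! 1) * \<beta> (vs ! 0) else 0)"
proof -
  have nil: "wedge \<gamma> (\<lambda>_. 0) us = 0" for \<gamma> :: "'a \<Rightarrow> real" and us
    by (simp add: wedge_zero)
  have one: "wedge \<gamma> unit_form us = (if length us = 1 then \<gamma> (us ! 0) else 0)"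
    for \<gamma> :: "'a \<Rightarrow> real" and us
    by (cases us) (auto simp: wedge_Cons unit_form_def interior_product_def[abs_def] nil)
  have two: "wedge \<alpha> (\<lambda>us. if us = [] then c else 0) us = (if length us = 1 then c * \<alpha> (us ! 0) else 0)"
    for c us
    by (cases us) (auto simp: wedge_Cons unit_form_def interior_product_def[abs_def] nil)
  have int: "interior_product v (wedge \<beta> unit_form) = (\<lambda>us. if us = [] then \<beta> v else 0)" for v
    by (rule ext) (simp add: interior_product_def one)
  show ?thesis
  proof (cases vs)
    case (Cons v us)
    then show ?thesis
      by (cases us) (auto simp: wedge_Cons[of \<alpha> "wedge \<beta> unit_form"] int one two)
  qed simp
qed

lemma alternating_form_linear_first:
  assumes "alternating_form p \<omega>"
  shows "linear (\<lambda>x. \<omega> (x # us))"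
proof (cases "Suc (length us) = p")
  case True
  then have "linear (\<lambda>x. \<omega> ((0 # us)[0 := x]))"
    using assms unfolding alternating_form_def by (metis length_Cons zero_less_Suc)
  then show ?thesis by simp
next
  case False
  then have "\<omega> (x # us) = 0" for x using assms by (auto simp: alternating_form_def)
  then show ?thesis by (auto intro: linearI)
qed

lemma contract_vector_wedge:
  assumes "alternating_form q \<Omega>"
  shows "contract (length Xs) (vector_wedge Xs) \<Omega> vs = \<Omega> (Xs @ vs)"
proof -
  let ?p = "length Xs"
  let ?\<omega> = "\<lambda>us. if length us = ?p then \<Omega> (us @ vs) else 0"
  have "alternating_form ?p ?\<omega>"
  proof (cases "?p + length vs = q")
    case True
    have lin: "linear (\<lambda>x. \<Omega> ((us @ vs)[i := x]))" if "length us = ?p" "i < ?p" for us i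
      using assms that True unfolding alternating_form_def
      by (metis length_append trans_less_add1)
    have alt: "\<Omega> (us @ vs) = 0" if "length us = ?p" "i < j" "j < ?p" "us ! i = us ! j" for us i j
    proof -
      have "(us @ vs) ! i = (us @ vs) ! j" "length (us @ vs) = q" "j < q"
        using that True by (auto simp: nth_append)
      then show ?thesis using assms that(2) unfolding alternating_form_def by blast
    qed
    show ?thesis
      unfolding alternating_form_def
      using lin alt by (auto simp: list_update_append)
  next
    case False
    then have "?\<omega> = (\<lambda>_. 0)" using assms by (auto simp: alternating_form_def)
    then show ?thesis by (auto simp: alternating_form_def intro: linearI)
  qed
  then show ?thesis by (simp add: contract_def vector_wedge_def)
qed

lemma two_form_decomp_exists:
  fixes \<omega> :: "'a::real_vector list \<Rightarrow> real"
  assumes fd: "dim (UNIV :: 'a set) > 0" and \<omega>: "alternating_form 2 \<omega>"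
  shows "\<exists>D. two_form_decomp \<omega> D"
proof -
  obtain B :: "'a set" where B: "finite B" "independent B" "span B = UNIV"
    using finite_basis_ex[OF fd] by blast
  obtain bs where bs: "set bs = B" "distinct bs" using B(1) finite_distinct_list by blast
  have l1: "linear (\<lambda>x. \<omega> [x, y])" for y
    using alternating_form_linear_first[OF \<omega>] .
  have "length [x, 0] = 2 \<and> (1::nat) < 2 \<longrightarrow> linear (\<lambda>y. \<omega> ([x, 0][1 := y]))" for x
    using \<omega> unfolding alternating_form_def by blast
  then have l2: "linear (\<lambda>y. \<omega> [x, y])" for x by simp
  have "length [x, x] = 2 \<and> (0::nat) < 1 \<and> (1::nat) < 2 \<and> [x, x] ! 0 = [x, x] ! 1 \<longrightarrow>
      \<omega> [x, x] = 0" for x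
    using \<omega> unfolding alternating_form_def by blast
  then have alt: "\<omega> [x, x] = 0" for x by simp
  have skew: "\<omega> [y, x] = - \<omega> [x, y]" for x y
    using alt[of "x + y"] alt[of x] alt[of y]
    by (simp add: linear_add[OF l1] linear_add[OF l2])
  let ?r = "\<lambda>b x. representation B x b"
  have linr: "linear (?r b)" for b
    using B by (auto intro!: linearI simp: representation_add representation_scale)
  have expand: "(\<Sum>b\<in>B. ?r b x * \<omega> [b, y]) = \<omega> [x, y]" for x y
  proof -
    have "\<omega> [x, y] = \<omega> [\<Sum>b\<in>B. ?r b x *\<^sub>R b, y]"
      using sum_representation_eq[OF B(2) _ B(1) order_refl, of x] B(3) by simp
    also have "\<dots> = (\<Sum>b\<in>B. ?r b x * \<omega> [b, y])"
      by (simp add: linear_sum[OF l1] linear_scale[OF l1])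
    finally show ?thesis by simp
  qed
  define D where "D = map (\<lambda>b. (?r b, \<lambda>y. \<omega> [b, y] / 2)) bs"
  have "two_form_decomp \<omega> D"
    unfolding two_form_decomp_def
  proof (intro conjI ext)
    show "\<forall>(\<alpha>, \<beta>)\<in>set D. linear \<alpha> \<and> linear \<beta>"
      using linr by (auto simp: D_def intro!: linearI simp: linear_add[OF l2] linear_scale[OF l2] add_divide_distrib)
    fix vs
    show "\<omega> vs = (\<Sum>(\<alpha>, \<beta>)\<leftarrow>D. wedge_list [\<alpha>, \<beta>] vs)"
    proof (cases "length vs = 2")
      case True
      then obtain x y where vs: "vs = [x, y]"
        by (metis (no_types, opaque_lifting) One_nat_def Suc_1 length_0_conv length_Suc_conv)
      have "(\<Sum>(\<alpha>, \<beta>)\<leftarrow>D. wedge_list [\<alpha>, \<beta>] vs)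
          = (\<Sum>b\<in>B. ?r b x * \<omega> [b, y] / 2 - ?r b y * \<omega> [b, x] / 2)"
        unfolding vs D_def wedge_list_pair using bs
        by (simp add: sum_list_distinct_conv_sum_set o_def)
      also have "\<dots> = \<omega> [x, y] / 2 - \<omega> [y, x] / 2"
        by (simp add: sum_subtractf sum_divide_distrib[symmetric] expand)
      finally show ?thesis using skew[of y x] by (simp add: vs)
    next
      case False
      then have "(\<Sum>(\<alpha>, \<beta>)\<leftarrow>D. wedge_list [\<alpha>, \<beta>] vs) = 0"
        by (simp add: wedge_list_pair case_prod_unfold del: wedge_list_Cons)
      with False \<omega> show ?thesis by (simp add: alternating_form_def)
    qed
  qed
  then show ?thesis by blast
qed

lemma bracket_eq:
  fixes g :: "'a::real_vector \<Rightarrow> 'a \<Rightarrow> real"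
  assumes fd: "dim (UNIV :: 'a set) > 0" and g: "inner_product g"
    and \<Omega>: "alternating_form p \<Omega>" and D: "two_form_decomp \<omega> D"
  shows "bracket g \<omega> \<Omega> = (\<lambda>vs. \<Sum>(\<alpha>, \<beta>)\<leftarrow>D. simple_bracket g \<alpha> \<beta> \<Omega> vs)"
proof -
  define der where "der A vs = (\<Sum>i<length vs. (-1) ^ i * \<Omega> (A (vs ! i) # omit i vs))" for A vs
  note lin = alternating_form_linear_first[OF \<Omega>]
  have bl: "bilinear g" using g by (simp add: inner_product_def)
  have der_add: "der (\<lambda>v. A v + A' v) vs = der A vs + der A' vs" for A A' vs
    by (simp add: der_def linear_add[OF lin] algebra_simps sum.distrib)
  have der_0: "der (\<lambda>_. 0) vs = 0" for vs
    by (simp add: der_def linear_0[OF lin])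
  have simple: "simple_bracket g \<alpha> \<beta> \<Omega> vs = der (\<lambda>v. \<alpha> v *\<^sub>R sharp g \<beta> - \<beta> v *\<^sub>R sharp g \<alpha>) vs"
    for \<alpha> \<beta> vs
    by (simp add: simple_bracket_def wedge_def interior_product_def der_def linear_diff[OF lin]
        linear_scale[OF lin] sum_subtractf algebra_simps)
  let ?A = "\<lambda>E v. \<Sum>(\<alpha>, \<beta>)\<leftarrow>E. \<alpha> v *\<^sub>R sharp g \<beta> - \<beta> v *\<^sub>R sharp g \<alpha>"
  have sum: "(\<Sum>(\<alpha>, \<beta>)\<leftarrow>E. simple_bracket g \<alpha> \<beta> \<Omega> vs) = der (?A E) vs" for E vs
    by (induction E) (auto simp: der_0 der_add simple)
  have A: "sharp g (\<lambda>w. \<omega> [v, w]) = ?A E v" if E: "two_form_decomp \<omega> E" for E v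
  proof (rule sharp_eqI[OF g])
    fix w
    have lins: "\<forall>(\<alpha>, \<beta>)\<in>set E. linear \<alpha> \<and> linear \<beta>"
      and \<omega>: "\<omega> = (\<lambda>vs. \<Sum>(\<alpha>, \<beta>)\<leftarrow>E. wedge_list [\<alpha>, \<beta>] vs)"
      using E by (auto simp: two_form_decomp_def)
    have "\<omega> [v, w] = (\<Sum>(\<alpha>, \<beta>)\<leftarrow>E. \<alpha> v * \<beta> w - \<alpha> w * \<beta> v)"
      unfolding \<omega> wedge_list_pair by simp
    also have "\<dots> = g (?A E v) w"
      using lins
      by (induction E)
        (auto simp: bilinear_lzero[OF bl] bilinear_ladd[OF bl] bilinear_lsub[OF bl]
          bilinear_lmul[OF bl] sharp_works[OF fd g])
    finally show "g (?A E v) w = \<omega> [v, w]" by simp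
  qed
  show ?thesis
    unfolding bracket_def
  proof (rule the_equality)
    fix \<Psi> assume "\<exists>E. two_form_decomp \<omega> E \<and> \<Psi> = (\<lambda>vs. \<Sum>(\<alpha>, \<beta>)\<leftarrow>E. simple_bracket g \<alpha> \<beta> \<Omega> vs)"
    then obtain E where E: "two_form_decomp \<omega> E"
      and \<Psi>: "\<Psi> = (\<lambda>vs. \<Sum>(\<alpha>, \<beta>)\<leftarrow>E. simple_bracket g \<alpha> \<beta> \<Omega> vs)" by blast
    have "?A E = ?A D" by (rule ext) (use A[OF E] A[OF D] in simp)
    then show "\<Psi> = (\<lambda>vs. \<Sum>(\<alpha>, \<beta>)\<leftarrow>D. simple_bracket g \<alpha> \<beta> \<Omega> vs)"
      unfolding \<Psi> sum by simp
  qed (use D in blast)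
qed

lemma interior_product_wedge_list_span:
  "\<exists>c. \<forall>v. wedge_list \<beta>s (v # us) = (\<Sum>j<length \<beta>s. c j * (\<beta>s ! j) v)"
proof (induction \<beta>s arbitrary: us)
  case Nil
  show ?case by (simp add: unit_form_def)
next
  case (Cons \<beta> \<beta>s)
  obtain c where c: "wedge_list \<beta>s (v # xs) = (\<Sum>j<length \<beta>s. c xs j * (\<beta>s ! j) v)" for v xs
    using Cons by metis
  define d where
    "d j = (case j of 0 \<Rightarrow> wedge_list \<beta>s us | Suc k \<Rightarrow> - wedge \<beta> (\<lambda>xs. c xs k) us)" for j
  have "wedge_list (\<beta> # \<beta>s) (v # us) = (\<Sum>j<length (\<beta> # \<beta>s). d j * ((\<beta> # \<beta>s) ! j) v)" for v
  proof -
    have "wedge \<beta> (interior_product v (wedge_list \<beta>s)) us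
        = (\<Sum>j<length \<beta>s. wedge \<beta> (\<lambda>xs. c xs j) us * (\<beta>s ! j) v)"
      unfolding wedge_def interior_product_def c sum_distrib_left sum_distrib_right
      by (subst sum.swap) (simp add: algebra_simps)
    then show ?thesis
      by (simp add: wedge_Cons sum.lessThan_Suc_shift d_def sum_negf del: sum.lessThan_Suc)
  qed
  then show ?case by blast
qed

lemma plane_wedge_list:
  fixes g :: "'a::real_vector \<Rightarrow> 'a \<Rightarrow> real"
  assumes fd: "dim (UNIV :: 'a set) > 0" and g: "inner_product g"
    and lin: "\<forall>\<alpha>\<in>set \<alpha>s. linear \<alpha>" and nz: "wedge_list \<alpha>s \<noteq> (\<lambda>_. 0)"
  shows "plane g (length \<alpha>s) (wedge_list \<alpha>s) = span (sharp g ` set \<alpha>s)"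
proof -
  have bl: "bilinear g" using g by (simp add: inner_product_def)
  have sub: "span (sharp g ` set \<gamma>s) \<subseteq> span (sharp g ` set \<beta>s)"
    if eq: "wedge_list \<gamma>s = wedge_list \<beta>s" and nz: "wedge_list \<beta>s \<noteq> (\<lambda>_. 0)"
      and lin: "\<forall>\<beta>\<in>set \<beta>s. linear \<beta>" for \<gamma>s \<beta>s
  proof (intro span_minimal subspace_span subsetI)
    fix X assume "X \<in> sharp g ` set \<gamma>s"
    then obtain \<gamma> where \<gamma>: "\<gamma> \<in> set \<gamma>s" and X: "X = sharp g \<gamma>" by blast
    let ?\<omega> = "wedge_list \<beta>s"
    obtain Xs where Xs: "?\<omega> Xs \<noteq> 0" using nz by (auto simp: fun_eq_iff)
    obtain c where c: "?\<omega> (v # xs) = (\<Sum>j<length \<beta>s. c xs j * (\<beta>s ! j) v)" for v xs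
      using interior_product_wedge_list_span by metis
    define d where "d j = wedge \<gamma> (\<lambda>xs. c xs j) Xs / ?\<omega> Xs" for j
    have \<gamma>_eq: "\<gamma> v = (\<Sum>j<length \<beta>s. d j * (\<beta>s ! j) v)" for v
    proof -
      have "\<gamma> v * ?\<omega> Xs = wedge \<gamma> (interior_product v ?\<omega>) Xs"
        using wedge_wedge_list_mem[OF \<gamma>] wedge_Cons[of \<gamma> ?\<omega> v Xs] by (simp add: eq)
      also have "\<dots> = (\<Sum>j<length \<beta>s. wedge \<gamma> (\<lambda>xs. c xs j) Xs * (\<beta>s ! j) v)"
        unfolding wedge_def interior_product_def c sum_distrib_left sum_distrib_right
        by (subst sum.swap) (simp add: algebra_simps)
      finally have "\<gamma> v = (\<Sum>j<length \<beta>s. wedge \<gamma> (\<lambda>xs. c xs j) Xs * (\<beta>s ! j) v) / ?\<omega> Xs"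
        using Xs by (simp add: field_simps)
      then show ?thesis by (simp add: d_def sum_divide_distrib)
    qed
    have X_eq: "X = (\<Sum>j<length \<beta>s. d j *\<^sub>R sharp g (\<beta>s ! j))"
      unfolding X
    proof (rule sharp_eqI[OF g])
      fix w
      have "linear (\<lambda>v. g v w)" using bl by (simp add: bilinear_def)
      then show "g (\<Sum>j<length \<beta>s. d j *\<^sub>R sharp g (\<beta>s ! j)) w = \<gamma> w"
        using lin
        by (simp add: \<gamma>_eq linear_sum[of "\<lambda>v. g v w"] bilinear_lmul[OF bl] sharp_works[OF fd g])
    qed
    have "d j *\<^sub>R sharp g (\<beta>s ! j) \<in> span (sharp g ` set \<beta>s)" if "j < length \<beta>s" for j
      using that by (intro span_scale span_base imageI nth_mem)
    then show "X \<in> span (sharp g ` set \<beta>s)"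
      unfolding X_eq by (intro span_sum) simp
  qed
  show ?thesis
    unfolding plane_def
  proof (rule the_equality)
    fix P assume "\<exists>\<beta>s. length \<beta>s = length \<alpha>s \<and> (\<forall>\<alpha>\<in>set \<beta>s. linear \<alpha>) \<and>
      wedge_list \<alpha>s = wedge_list \<beta>s \<and> P = span (sharp g ` set \<beta>s)"
    then obtain \<beta>s where "\<forall>\<alpha>\<in>set \<beta>s. linear \<alpha>" "wedge_list \<alpha>s = wedge_list \<beta>s"
      "P = span (sharp g ` set \<beta>s)" by blast
    then show "P = span (sharp g ` set \<alpha>s)"
      using sub[of \<alpha>s \<beta>s] sub[of \<beta>s \<alpha>s] lin nz by auto
  qed (use lin in blast)
qed

end

theory Submission
  imports Defs
begin

text \<open>
  The condition says that all the skew endomorphisms \<open>F(X, Y, Z, -, -)\<close> act as derivations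
  annihilating \<open>F\<close>. Choose a vector \<open>u0\<close> with positive definite orthogonal complement \<open>W\<close>
  (dimension 9) and \<open>G = F(u0, -, -, -, -) \<noteq> 0\<close>; the 4-form \<open>G\<close> on \<open>W\<close> satisfies the analogous
  condition.

  Let \<open>G\<close> attain its maximum \<open>\<mu>\<close> over unit vectors at \<open>e1, \<dots>, e4\<close>. The first variation makes
  the \<open>e\<close>'s orthonormal and kills the components \<open>G(e, e', e'', x)\<close> with \<open>x\<close> orthogonal to all
  of them. The six endomorphisms \<open>G(e, e', -, -)\<close> of the orthogonal complement then satisfy the
  commutation relations of \<open>so(4)\<close>, and tracing the second variation inequality against these
  relations forces all six to vanish: the symmetric operator they assemble to is at most \<open>\<mu>\<close> and
  has trace zero, and the trace of its cube is \<open>\<mu>\<close> times the trace of its square.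

  Hence \<open>F(u0, e, e', -, -)\<close> is, up to a scalar, the rotation in the plane of the other two \<open>e\<close>'s.
  Invariance under these rotations gives \<open>F = h \<and> e1 \<and> e2 \<and> e3 \<and> e4 + F2\<close>, where \<open>F2\<close> is a
  5-form on the 6-dimensional complement of the \<open>e\<close>'s, hence simple; and contraction with
  \<open>e1 \<and> e2 \<and> e3\<close> shows that \<open>h\<close> is orthogonal to the plane of \<open>F2\<close>.
\<close>

section \<open>Flat four-forms on a Euclidean space\<close>

lemma inner_ext: "(\<And>w. u \<bullet> w = v \<bullet> w) \<Longrightarrow> u = v" for u v :: "'a::real_inner"
  using vector_eq_rdot by blast

text \<open>A four-form with four separate arguments, so that each slot can be varied on its own.
  Vanishing on equal neighbours gives full skew symmetry by polarisation.\<close>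

locale alternating_quadrilinear =
  fixes G :: "'b::euclidean_space \<Rightarrow> 'b \<Rightarrow> 'b \<Rightarrow> 'b \<Rightarrow> real"
  assumes lin1: "linear (\<lambda>x. G x b c d)" and lin2: "linear (\<lambda>x. G a x c d)"
    and lin3: "linear (\<lambda>x. G a b x d)" and lin4: "linear (\<lambda>x. G a b c x)"
    and alt12: "G a a c d = 0" and alt23: "G a b b d = 0" and alt34: "G a b c c = 0"
begin

lemmas adds = linear_add[OF lin1] linear_add[OF lin2] linear_add[OF lin3] linear_add[OF lin4]
lemmas scales = linear_scale[OF lin1] linear_scale[OF lin2] linear_scale[OF lin3] linear_scale[OF lin4]
lemmas negs = linear_neg[OF lin1] linear_neg[OF lin2] linear_neg[OF lin3] linear_neg[OF lin4]
lemmas zeros = linear_0[OF lin1] linear_0[OF lin2] linear_0[OF lin3] linear_0[OF lin4]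

lemma swap12: "G b a c d = - G a b c d"
  using alt12[of "a + b" c d] alt12[of a c d] alt12[of b c d]
  by (simp only: adds)

lemma swap23: "G a c b d = - G a b c d"
  using alt23[of a "b + c" d] alt23[of a b d] alt23[of a c d]
  by (simp only: adds)

lemma swap34: "G a b d c = - G a b c d"
  using alt34[of a b "c + d"] alt34[of a b c] alt34[of a b d]
  by (simp only: adds)

lemma alt13: "G a b a d = 0"
  using swap23[of a a b d] alt12 by simp

lemma alt24: "G a b c b = 0"
  using swap34[of a b b c] alt23 by simp

lemma alt14: "G a b c a = 0"
  using swap34[of a b a c] alt13 by simp

lemmas alts = alt12 alt13 alt14 alt23 alt24 alt34

lemma swap13: "G c b a d = - G a b c d"
  using swap12[of c b a d] swap23[of b a c d] swap12[of b a c d] by simp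

lemma swap14: "G d b c a = - G a b c d"
  using swap13[of d b c a] swap34[of c b a d] swap13[of c b a d] by simp

lemma pair_swap: "G c d a b = G a b c d"
  using swap13[of c d a b] swap23[of a d c b] swap34[of a c d b] swap23[of a c b d] by simp

lemma cycle_134: "G d b a c = G a b c d"
  using swap13[of d b a c] swap34[of a b d c] by simp

lemma cycle_123: "G b c a d = G a b c d"
  using swap13[of b c a d] swap23[of a c b d] by simp

lemma cycle_234: "G a d b c = G a b c d"
  using swap23[of a d b c] swap34[of a b d c] by simp

lemma vanish_perms:
  assumes "G a b c x = 0"
  shows "G a b c x = 0" "G a c b x = 0" "G b a c x = 0" "G b c a x = 0" "G c a b x = 0" "G c b a x = 0"
  using assms swap12[of b a c x] swap23[of a c b x] swap13[of c b a x] cycle_123[of b c a x]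
    cycle_123[of a b c x] by auto

text \<open>The vector dual to the linear form \<open>G x y z\<close>; thus \<open>A x y\<close> is
  the skew endomorphism corresponding to the two-form \<open>G x y\<close>.\<close>

definition A :: "'b \<Rightarrow> 'b \<Rightarrow> 'b \<Rightarrow> 'b" where
  "A x y z = (\<Sum>b\<in>Basis. G x y z b *\<^sub>R b)"

lemma A_inner: "A x y z \<bullet> w = G x y z w"
proof -
  have "G x y z w = G x y z (\<Sum>b\<in>Basis. (w \<bullet> b) *\<^sub>R b)"
    by (simp add: euclidean_representation)
  also have "\<dots> = A x y z \<bullet> w"
    by (simp add: A_def linear_sum[OF lin4] scales inner_sum_left inner_commute[of w] mult.commute)
  finally show ?thesis by simp
qed

lemma A_skew: "A x y z \<bullet> w = - (z \<bullet> A x y w)"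
  using swap34[of x y w z] by (simp add: A_inner inner_commute[of z])

lemma A_swap: "A y x z = - A x y z"
  by (rule inner_ext) (simp add: A_inner swap12[of y x])

text \<open>For orthonormal \<open>B\<close> this is the squared Hilbert-Schmidt norm of
  \<open>A x y\<close> restricted to the span of \<open>B\<close>.\<close>

definition N :: "'b set \<Rightarrow> 'b \<Rightarrow> 'b \<Rightarrow> real" where
  "N B x y = (\<Sum>b\<in>B. A x y b \<bullet> A x y b)"

lemma N_swap: "N B y x = N B x y"
  unfolding N_def A_swap[of y x] by simp

lemma N_nonneg: "N B x y \<ge> 0"
  unfolding N_def by (intro sum_nonneg) simp

text \<open>A continuous function on a product of four unit spheres, which is compact, has a
  maximum; homogeneity in each slot extends the bound to all vectors. The value \<open>\<mu>\<close>
  is the comass of \<open>G\<close>.\<close>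

lemma ex_maximum:
  assumes "G a b c d \<noteq> 0"
  shows "\<exists>\<mu> e1 e2 e3 e4. \<mu> > 0 \<and> norm e1 = 1 \<and> norm e2 = 1 \<and> norm e3 = 1 \<and> norm e4 = 1 \<and>
    G e1 e2 e3 e4 = \<mu> \<and> (\<forall>a b c d. G a b c d \<le> \<mu> * (norm a * norm b * norm c * norm d))"
proof -
  define g where "g = (\<lambda>(a, b, c, d). G a b c d)"
  have G_expand: "G a b c d = (\<Sum>i\<in>Basis. \<Sum>j\<in>Basis. \<Sum>k\<in>Basis. \<Sum>l\<in>Basis.
      (a \<bullet> i) * ((b \<bullet> j) * ((c \<bullet> k) * ((d \<bullet> l) * G i j k l))))" for a b c d
  proof -
    have 1: "G a b c d = (\<Sum>i\<in>Basis. (a \<bullet> i) * G i b c d)" for a b c d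
    proof -
      have "G a b c d = G (\<Sum>i\<in>Basis. (a \<bullet> i) *\<^sub>R i) b c d"
        by (simp add: euclidean_representation)
      then show ?thesis by (simp add: linear_sum[OF lin1] scales)
    qed
    have 2: "G a b c d = (\<Sum>i\<in>Basis. (b \<bullet> i) * G a i c d)" for a b c d
      using 1[of b a c d] by (simp add: swap12[of _ a] sum_negf)
    have 3: "G a b c d = (\<Sum>i\<in>Basis. (c \<bullet> i) * G a b i d)" for a b c d
      using 2[of a c b d] by (simp add: swap23[of a _ b] sum_negf)
    have 4: "G a b c d = (\<Sum>i\<in>Basis. (d \<bullet> i) * G a b c i)" for a b c d
      using 3[of a b d c] by (simp add: swap34[of a b _ c] sum_negf)
    show ?thesis
      apply (subst 1)
      apply (subst 2)
      apply (subst 3)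
      apply (subst 4)
      apply (simp add: sum_distrib_left)
      done
  qed
  define K where "K = sphere (0::'b) 1"
  have "continuous_on UNIV g"
    unfolding g_def case_prod_unfold
    by (subst G_expand) (intro continuous_intros)
  then have "continuous_on (K \<times> K \<times> K \<times> K) g"
    using continuous_on_subset by blast
  moreover have "compact (K \<times> K \<times> K \<times> K)"
    by (simp add: K_def compact_Times)
  moreover have "K \<times> K \<times> K \<times> K \<noteq> {}"
    by (simp add: K_def)
  ultimately obtain p where p: "p \<in> K \<times> K \<times> K \<times> K"
    and max: "\<And>q. q \<in> K \<times> K \<times> K \<times> K \<Longrightarrow> g q \<le> g p"
    using continuous_attains_sup[of "K \<times> K \<times> K \<times> K" g]
    by metis
  obtain e1 e2 e3 e4 where pe: "p = (e1, e2, e3, e4)" by (cases p) auto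
  define \<mu> where "\<mu> = G e1 e2 e3 e4"
  have norms: "norm e1 = 1" "norm e2 = 1" "norm e3 = 1" "norm e4 = 1"
    using p by (auto simp: pe K_def)
  have max': "G a b c d \<le> \<mu>" if "norm a = 1" "norm b = 1" "norm c = 1" "norm d = 1" for a b c d
    using max[of "(a, b, c, d)"] that by (simp add: g_def pe \<mu>_def K_def)
  have bound: "G a b c d \<le> \<mu> * (norm a * norm b * norm c * norm d)" for a b c d
  proof (cases "a = 0 \<or> b = 0 \<or> c = 0 \<or> d = 0")
    case True
    then show ?thesis by (auto simp: zeros)
  next
    case False
    then have "G (sgn a) (sgn b) (sgn c) (sgn d) \<le> \<mu>"
      by (intro max') (auto simp: norm_sgn)
    moreover have "G a b c d = (norm a * norm b * norm c * norm d) * G (sgn a) (sgn b) (sgn c) (sgn d)"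
      using False by (simp add: sgn_div_norm scales field_simps)
    ultimately show ?thesis
      using mult_left_mono[of "G (sgn a) (sgn b) (sgn c) (sgn d)" \<mu> "norm a * norm b * norm c * norm d"]
      by (simp add: mult.commute)
  qed
  have "\<mu> > 0"
  proof -
    have "0 < \<bar>G a b c d\<bar>" using assms by simp
    \<comment> \<open>Exchanging two arguments changes the sign of \<open>G\<close> but not the
      bound, so the bound holds for the absolute value.\<close>
    also have "\<bar>G a b c d\<bar> \<le> \<mu> * (norm a * norm b * norm c * norm d)"
      using bound[of a b c d] bound[of b a c d] swap12[of b a c d]
      by (simp add: abs_le_iff mult.commute mult.left_commute)
    finally show ?thesis by (simp add: zero_less_mult_iff) (smt (verit) mult_nonneg_nonneg norm_ge_zero)
  qed
  with norms bound \<mu>_def show ?thesis by blast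
qed

end

section \<open>First and second variation at a maximum over unit vectors\<close>

locale comass_point = alternating_quadrilinear G
  for G :: "'b::euclidean_space \<Rightarrow> 'b \<Rightarrow> 'b \<Rightarrow> 'b \<Rightarrow> real" +
  fixes \<mu> :: real and e1 e2 e3 e4 :: 'b
  assumes pos: "\<mu> > 0" and norms: "norm e1 = 1" "norm e2 = 1" "norm e3 = 1" "norm e4 = 1"
    and attained: "G e1 e2 e3 e4 = \<mu>"
    and bound: "G a b c d \<le> \<mu> * (norm a * norm b * norm c * norm d)"
begin

text \<open>The equality case of Cauchy-Schwarz: the vector \<open>v\<close> representing
  \<open>f\<close> has norm at most \<open>\<mu>\<close> and inner product \<open>\<mu>\<close> with
  the unit vector \<open>e\<close>, hence equals \<open>\<mu>\<close> times
  \<open>e\<close>.\<close>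

lemma first_order:
  fixes f :: "'b \<Rightarrow> real"
  assumes f: "linear f" and le: "\<And>x. f x \<le> \<mu> * norm x" and e: "norm e = 1" "f e = \<mu>"
  shows "f x = \<mu> * (e \<bullet> x)"
proof -
  define v where "v = (\<Sum>b\<in>Basis. f b *\<^sub>R b)"
  have fv: "f x = v \<bullet> x" for x
  proof -
    have "f x = f (\<Sum>b\<in>Basis. (x \<bullet> b) *\<^sub>R b)" by (simp add: euclidean_representation)
    also have "\<dots> = v \<bullet> x"
      by (simp add: v_def linear_sum[OF f] linear_scale[OF f] inner_sum_left inner_commute[of x] mult.commute)
    finally show ?thesis .
  qed
  have "(norm v)\<^sup>2 \<le> \<mu> * norm v"
    using le[of v] by (simp add: fv power2_norm_eq_inner)
  then have nv: "norm v \<le> \<mu>"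
    using pos by (cases "norm v = 0") (auto simp: power2_eq_square)
  have "(norm (v - \<mu> *\<^sub>R e))\<^sup>2 = (norm v)\<^sup>2 - \<mu>\<^sup>2"
    using e unfolding fv power2_norm_eq_inner
    by (simp add: inner_diff_left inner_diff_right inner_commute[of e v] norm_eq_1 power2_eq_square)
  also have "\<dots> \<le> 0" using nv pos by (simp add: power_mono)
  finally have "v = \<mu> *\<^sub>R e" by simp
  then show ?thesis by (simp add: fv)
qed

lemma G1: "G x e2 e3 e4 = \<mu> * (e1 \<bullet> x)"
  by (rule first_order[OF lin1]) (use bound[of _ e2 e3 e4] in \<open>auto simp: norms attained\<close>)

lemma G2: "G e1 x e3 e4 = \<mu> * (e2 \<bullet> x)"
  by (rule first_order[OF lin2]) (use bound[of e1 _ e3 e4] in \<open>auto simp: norms attained\<close>)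

lemma G3: "G e1 e2 x e4 = \<mu> * (e3 \<bullet> x)"
  by (rule first_order[OF lin3]) (use bound[of e1 e2 _ e4] in \<open>auto simp: norms attained\<close>)

lemma G4: "G e1 e2 e3 x = \<mu> * (e4 \<bullet> x)"
  by (rule first_order[OF lin4]) (use bound[of e1 e2 e3 _] in \<open>auto simp: norms attained\<close>)

text \<open>Putting one \<open>e\<close> in the slot of another makes \<open>G\<close> vanish by
  alternation, while the first variation evaluates it as \<open>\<mu>\<close> times their inner
  product.\<close>

lemma orthonormal:
  "e1 \<bullet> e1 = 1" "e2 \<bullet> e2 = 1" "e3 \<bullet> e3 = 1" "e4 \<bullet> e4 = 1"
  "e1 \<bullet> e2 = 0" "e1 \<bullet> e3 = 0" "e1 \<bullet> e4 = 0" "e2 \<bullet> e3 = 0" "e2 \<bullet> e4 = 0" "e3 \<bullet> e4 = 0"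
  using norms G1[of e2] G1[of e3] G1[of e4] G2[of e3] G2[of e4] G3[of e4] pos
  by (auto simp: norm_eq_1 alts)

definition perp :: "'b \<Rightarrow> bool" where
  "perp x \<longleftrightarrow> e1 \<bullet> x = 0 \<and> e2 \<bullet> x = 0 \<and> e3 \<bullet> x = 0 \<and> e4 \<bullet> x = 0"

text \<open>Move each \<open>e\<close> to \<open>e + t u\<close>. The terms linear in
  \<open>t\<close> vanish by the first variation, and comparing the quadratic terms in the
  maximality bound gives the inequality.\<close>

lemma second_order:
  assumes u: "perp u1" "perp u2" "perp u3" "perp u4"
  shows "G u1 u2 e3 e4 + G u1 e2 u3 e4 + G u1 e2 e3 u4 + G e1 u2 u3 e4 + G e1 u2 e3 u4 + G e1 e2 u3 u4
    \<le> \<mu> / 2 * (u1 \<bullet> u1 + u2 \<bullet> u2 + u3 \<bullet> u3 + u4 \<bullet> u4)"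
proof -
  define Q where "Q = G u1 u2 e3 e4 + G u1 e2 u3 e4 + G u1 e2 e3 u4 + G e1 u2 u3 e4 + G e1 u2 e3 u4 + G e1 e2 u3 u4"
  define R where "R = G e1 u2 u3 u4 + G u1 e2 u3 u4 + G u1 u2 e3 u4 + G u1 u2 u3 e4"
  define S where "S = G u1 u2 u3 u4"
  define N where "N = u1 \<bullet> u1 + u2 \<bullet> u2 + u3 \<bullet> u3 + u4 \<bullet> u4"
  have key: "Q - \<mu> / 2 * N + R * t + (S - \<mu> * N\<^sup>2 / 16) * t\<^sup>2 \<le> 0" if t: "t > 0" for t :: real
  proof -
    define a where "a = norm (e1 + t *\<^sub>R u1)"
    define b where "b = norm (e2 + t *\<^sub>R u2)"
    define c where "c = norm (e3 + t *\<^sub>R u3)"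
    define d where "d = norm (e4 + t *\<^sub>R u4)"
    have nrm: "(norm (e + t *\<^sub>R v))\<^sup>2 = 1 + t\<^sup>2 * (v \<bullet> v)" if "e \<bullet> e = 1" "e \<bullet> v = 0" for e v :: 'b
      unfolding power2_norm_eq_inner using that
      by (simp add: inner_add_left inner_add_right inner_commute[of v e] power2_eq_square)
    have nrms: "a\<^sup>2 = 1 + t\<^sup>2 * (u1 \<bullet> u1)" "b\<^sup>2 = 1 + t\<^sup>2 * (u2 \<bullet> u2)"
      "c\<^sup>2 = 1 + t\<^sup>2 * (u3 \<bullet> u3)" "d\<^sup>2 = 1 + t\<^sup>2 * (u4 \<bullet> u4)"
      using u nrm orthonormal by (auto simp: a_def b_def c_def d_def perp_def)
    have nn: "a \<ge> 0" "b \<ge> 0" "c \<ge> 0" "d \<ge> 0" by (simp_all add: a_def b_def c_def d_def)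
    \<comment> \<open>The arithmetic-geometric mean inequality replaces the product of norms by a
      polynomial in \<open>t\<close> with the same second-order term.\<close>
    have "a * b \<le> (a\<^sup>2 + b\<^sup>2) / 2" "c * d \<le> (c\<^sup>2 + d\<^sup>2) / 2"
      using sum_squares_bound[of a b] sum_squares_bound[of c d] by auto
    then have "(a * b) * (c * d) \<le> ((a\<^sup>2 + b\<^sup>2) / 2) * ((c\<^sup>2 + d\<^sup>2) / 2)"
      using nn by (intro mult_mono) auto
    also have "\<dots> \<le> ((a\<^sup>2 + b\<^sup>2 + c\<^sup>2 + d\<^sup>2) / 4)\<^sup>2"
      using sum_squares_bound[of "a\<^sup>2 + b\<^sup>2" "c\<^sup>2 + d\<^sup>2"] by (simp add: power2_eq_square algebra_simps)
    also have "(a\<^sup>2 + b\<^sup>2 + c\<^sup>2 + d\<^sup>2) / 4 = 1 + t\<^sup>2 * N / 4"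
      by (simp add: nrms N_def algebra_simps)
    finally have amgm: "a * b * c * d \<le> (1 + t\<^sup>2 * N / 4)\<^sup>2" by (simp add: mult.assoc)
    have "G (e1 + t *\<^sub>R u1) (e2 + t *\<^sub>R u2) (e3 + t *\<^sub>R u3) (e4 + t *\<^sub>R u4)
        = \<mu> + t\<^sup>2 * Q + t ^ 3 * R + t ^ 4 * S"
      using u
      by (simp add: adds scales Q_def R_def S_def G1 G2 G3 G4 attained perp_def orthonormal
          power2_eq_square power3_eq_cube power4_eq_xxxx algebra_simps)
    moreover have "G (e1 + t *\<^sub>R u1) (e2 + t *\<^sub>R u2) (e3 + t *\<^sub>R u3) (e4 + t *\<^sub>R u4)
        \<le> \<mu> * (1 + t\<^sup>2 * N / 4)\<^sup>2"
      using bound[of "e1 + t *\<^sub>R u1" "e2 + t *\<^sub>R u2" "e3 + t *\<^sub>R u3" "e4 + t *\<^sub>R u4"]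
        mult_left_mono[OF amgm, of \<mu>] pos unfolding a_def b_def c_def d_def by linarith
    ultimately have "\<mu> + t\<^sup>2 * Q + t ^ 3 * R + t ^ 4 * S \<le> \<mu> * (1 + t\<^sup>2 * N / 4)\<^sup>2" by simp
    then have "t\<^sup>2 * (Q - \<mu> / 2 * N + R * t + (S - \<mu> * N\<^sup>2 / 16) * t\<^sup>2) \<le> 0"
      by (simp add: power2_eq_square power3_eq_cube power4_eq_xxxx algebra_simps)
    then show ?thesis using t by (simp add: mult_le_0_iff)
  qed
  \<comment> \<open>Letting \<open>t\<close> tend to zero from above removes the contributions of
    \<open>R\<close> and \<open>S\<close>.\<close>
  have "((\<lambda>t. Q - \<mu> / 2 * N + R * t + (S - \<mu> * N\<^sup>2 / 16) * t\<^sup>2) \<longlongrightarrow>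
      Q - \<mu> / 2 * N + R * 0 + (S - \<mu> * N\<^sup>2 / 16) * 0\<^sup>2) (at_right 0)"
    by (intro tendsto_intros)
  then have "Q - \<mu> / 2 * N + R * 0 + (S - \<mu> * N\<^sup>2 / 16) * 0\<^sup>2 \<le> 0"
    proof (rule tendsto_upperbound)
    show "\<forall>\<^sub>F t in at_right 0. Q - \<mu> / 2 * N + R * t + (S - \<mu> * N\<^sup>2 / 16) * t\<^sup>2 \<le> 0"
      by (rule eventually_at_rightI[of 0 1]) (auto intro: key simp del: times_divide_eq_left)
  qed simp
  then show ?thesis by (simp add: Q_def N_def)
qed

text \<open>The double transpositions are even, so the value of \<open>G\<close> is preserved.
  Together with the identity they put each \<open>e\<close> in the first slot once.\<close>

lemma klein: "comass_point G \<mu> e2 e1 e4 e3" "comass_point G \<mu> e3 e4 e1 e2" "comass_point G \<mu> e4 e3 e2 e1"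
proof -
  have "G e2 e1 e4 e3 = \<mu>" using attained swap12[of e2 e1] swap34[of e1 e2 e4 e3] by simp
  moreover have "G e3 e4 e1 e2 = \<mu>" "G e4 e3 e2 e1 = \<mu>"
    using attained swap12[of e3 e4] swap23[of e4 e3 e1 e2] swap12[of e1 e4] swap34[of e1 e4 e3 e2]
      swap23[of e1 e4 e2 e3] swap34[of e1 e2 e3 e4] swap34[of e4 e3 e1 e2] by simp_all
  ultimately show "comass_point G \<mu> e2 e1 e4 e3" "comass_point G \<mu> e3 e4 e1 e2" "comass_point G \<mu> e4 e3 e2 e1"
    using pos norms bound by unfold_locales auto
qed

text \<open>Paired with one of the \<open>e\<close>s, \<open>A a b x\<close> gives a component of
  \<open>G\<close> with three arguments among the \<open>e\<close>s and \<open>x\<close> as the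
  fourth. It vanishes by the first variation, or by alternation if an \<open>e\<close>
  repeats.\<close>

lemma perp_A:
  assumes "{a, b} \<subseteq> {e1, e2, e3, e4}" "perp x"
  shows "perp (A a b x)"
proof -
  have "G e1 e2 e3 x = 0" "G e1 e2 e4 x = 0" "G e1 e3 e4 x = 0" "G e2 e3 e4 x = 0"
    using assms(2) G1[of x] G2[of x] G3[of x] G4[of x] swap34[of e1 e2 x e4]
      cycle_234[of e1 x e3 e4] swap12[of e2 x e3 e4] cycle_234[of e2 x e3 e4]
    unfolding perp_def by auto
  note zs = vanish_perms[OF this(1)] vanish_perms[OF this(2)] vanish_perms[OF this(3)] vanish_perms[OF this(4)]
  have "G a b x w = 0" if "w \<in> {e1, e2, e3, e4}" for w
    unfolding swap34[of a b x w] using assms(1) that by (auto simp: zs alts)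
  then show ?thesis by (simp add: perp_def A_inner inner_commute[of _ "A a b x"])
qed

section \<open>Traces over the orthogonal complement of the four vectors\<close>

lemma perp_scale: "perp x \<Longrightarrow> perp (c *\<^sub>R x)"
  by (simp add: perp_def)

lemma perp_minus: "perp x \<Longrightarrow> perp (- x)"
  by (simp add: perp_def)

text \<open>An orthonormal basis of the common complement of the \<open>e\<close>s. Orthogonality is
  implied: expanding \<open>b\<close> in \<open>b \<bullet> b = 1\<close> leaves a vanishing sum of
  squares of the \<open>b \<bullet> c\<close> with \<open>c\<close> different from
  \<open>b\<close>.\<close>

definition frame :: "'b set \<Rightarrow> bool" where
  "frame B \<longleftrightarrow> finite B \<and> (\<forall>b\<in>B. perp b \<and> b \<bullet> b = 1) \<and> (\<forall>x. perp x \<longrightarrow> (\<Sum>b\<in>B. (x \<bullet> b) *\<^sub>R b) = x)"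

text \<open>The Hilbert-Schmidt product is invariant under passing to adjoints: expand in the frame
  and exchange the two sums.\<close>

lemma frame_adjoint_sum:
  assumes B: "frame B"
    and p: "\<And>x. perp x \<Longrightarrow> perp (P x)" "\<And>x. perp x \<Longrightarrow> perp (P' x)"
    and a: "\<And>x y. P x \<bullet> y = x \<bullet> P' y" "\<And>x y. Q x \<bullet> y = x \<bullet> Q' y"
  shows "(\<Sum>b\<in>B. P b \<bullet> Q b) = (\<Sum>b\<in>B. P' b \<bullet> Q' b)"
proof -
  have parseval: "x \<bullet> y = (\<Sum>b\<in>B. (x \<bullet> b) * (y \<bullet> b))" if "perp x" for x y
  proof -
    have "x \<bullet> y = (\<Sum>b\<in>B. (x \<bullet> b) *\<^sub>R b) \<bullet> y" using B that by (simp add: frame_def)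
    then show ?thesis by (simp add: inner_sum_left inner_commute[of y])
  qed
  have "(\<Sum>b\<in>B. P b \<bullet> Q b) = (\<Sum>b\<in>B. \<Sum>c\<in>B. (P b \<bullet> c) * (Q b \<bullet> c))"
    using B by (intro sum.cong refl parseval p) (simp add: frame_def)
  also have "\<dots> = (\<Sum>c\<in>B. \<Sum>b\<in>B. (P' c \<bullet> b) * (Q' c \<bullet> b))"
    unfolding a by (subst sum.swap) (simp add: inner_commute)
  also have "\<dots> = (\<Sum>b\<in>B. P' b \<bullet> Q' b)"
    using B by (intro sum.cong refl parseval[symmetric] p) (simp add: frame_def)
  finally show ?thesis .
qed

text \<open>Passing to adjoints writes the trace both as the Hilbert-Schmidt product of
  \<open>S\<close> with \<open>P Q\<close> and as minus its product with \<open>Q P\<close>. The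
  mean of the two contains the commutator, a multiple of \<open>S\<close>.\<close>

lemma commutator_trace:
  assumes B: "frame B"
    and perp: "\<And>x. perp x \<Longrightarrow> perp (P x)" "\<And>x. perp x \<Longrightarrow> perp (Q x)" "\<And>x. perp x \<Longrightarrow> perp (S x)"
    and skew: "\<And>x y. P x \<bullet> y = - (x \<bullet> P y)" "\<And>x y. Q x \<bullet> y = - (x \<bullet> Q y)"
      "\<And>x y. S x \<bullet> y = - (x \<bullet> S y)"
    and comm: "\<And>x. P (Q x) - Q (P x) = \<nu> *\<^sub>R S x"
  shows "(\<Sum>b\<in>B. S (P b) \<bullet> Q b) = \<nu> / 2 * (\<Sum>b\<in>B. S b \<bullet> S b)"
proof -
  let ?T = "\<Sum>b\<in>B. S (P b) \<bullet> Q b"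
  have "?T = (\<Sum>b\<in>B. P (S b) \<bullet> - Q b)"
    by (rule frame_adjoint_sum[OF B]) (simp_all add: perp skew)
  also have "\<dots> = (\<Sum>b\<in>B. S b \<bullet> P (Q b))" by (simp add: skew(1))
  finally have 1: "?T = (\<Sum>b\<in>B. S b \<bullet> P (Q b))" .
  have "?T = - (\<Sum>b\<in>B. P b \<bullet> S (Q b))" by (simp add: skew(3) sum_negf)
  also have "(\<Sum>b\<in>B. P b \<bullet> S (Q b)) = (\<Sum>b\<in>B. - P b \<bullet> Q (S b))"
    by (rule frame_adjoint_sum[OF B]) (simp_all add: perp perp_minus skew)
  also have "\<dots> = (\<Sum>b\<in>B. S b \<bullet> Q (P b))"
    by (intro sum.cong refl) (simp add: inner_commute[of "P _"] skew(2)[of "S _" "P _"])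
  finally have 2: "?T = - (\<Sum>b\<in>B. S b \<bullet> Q (P b))" .
  have "2 * ?T = (\<Sum>b\<in>B. S b \<bullet> (P (Q b) - Q (P b)))"
    using 1 2 by (simp add: inner_diff_right sum_subtractf)
  also have "\<dots> = \<nu> * (\<Sum>b\<in>B. S b \<bullet> S b)" by (simp add: comm sum_distrib_left)
  finally show ?thesis by simp
qed

end

section \<open>The relations of so(4) and their effect on the second variation\<close>

locale flat_comass_point = comass_point +
  assumes derivation: "G (A x y a) b c d + G a (A x y b) c d + G a b (A x y c) d + G a b c (A x y d) = 0"
begin

text \<open>These express the six quadratic terms of the second variation through endomorphisms;
  only \<open>A e1 e3\<close> enters with a sign.\<close>

lemma A_pair:
  "G e3 e4 x y = G x y e3 e4" "G e4 e2 x y = G x e2 y e4" "G e2 e3 x y = G x e2 e3 y"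
  "G e1 e2 x y = G e1 e2 x y" "G e1 e3 x y = - G e1 x e3 y" "G e1 e4 x y = G e1 x y e4"
  by (rule pair_swap cycle_134 cycle_123 refl swap23 cycle_234)+

text \<open>By the first variation, \<open>A e3 e4\<close>, \<open>A e4 e2\<close> and
  \<open>A e2 e3\<close> act on the four vectors as \<open>\<mu>\<close> times the infinitesimal
  rotations from \<open>e1\<close> towards \<open>e2\<close>, \<open>e3\<close> and
  \<open>e4\<close>.\<close>

lemma A_pair_e:
  "A e3 e4 e1 = \<mu> *\<^sub>R e2" "A e3 e4 e2 = - \<mu> *\<^sub>R e1" "A e3 e4 e3 = 0" "A e3 e4 e4 = 0"
  "A e4 e2 e1 = \<mu> *\<^sub>R e3" "A e4 e2 e3 = - \<mu> *\<^sub>R e1" "A e4 e2 e2 = 0" "A e4 e2 e4 = 0"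
  "A e2 e3 e1 = \<mu> *\<^sub>R e4" "A e2 e3 e4 = - \<mu> *\<^sub>R e1" "A e2 e3 e2 = 0" "A e2 e3 e3 = 0"
proof -
  have "G e3 e4 e1 w = \<mu> * (e2 \<bullet> w)" "G e3 e4 e2 w = - \<mu> * (e1 \<bullet> w)"
    "G e4 e2 e1 w = \<mu> * (e3 \<bullet> w)" "G e4 e2 e3 w = - \<mu> * (e1 \<bullet> w)"
    "G e2 e3 e1 w = \<mu> * (e4 \<bullet> w)" "G e2 e3 e4 w = - \<mu> * (e1 \<bullet> w)" for w
    using G1[of w] G2[of w] G3[of w] G4[of w]
      A_pair(1)[of e1 w] A_pair(1)[of e2 w] A_pair(2)[of e1 w] A_pair(2)[of e3 w]
      A_pair(3)[of e1 w] A_pair(3)[of e4 w]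
      swap12[of e2 w e3 e4] swap13[of e3 e2 w e4] swap14[of e4 e2 e3 w]
    by linarith+
  then show "A e3 e4 e1 = \<mu> *\<^sub>R e2" "A e3 e4 e2 = - \<mu> *\<^sub>R e1" "A e3 e4 e3 = 0" "A e3 e4 e4 = 0"
    "A e4 e2 e1 = \<mu> *\<^sub>R e3" "A e4 e2 e3 = - \<mu> *\<^sub>R e1" "A e4 e2 e2 = 0" "A e4 e2 e4 = 0"
    "A e2 e3 e1 = \<mu> *\<^sub>R e4" "A e2 e3 e4 = - \<mu> *\<^sub>R e1" "A e2 e3 e2 = 0" "A e2 e3 e3 = 0"
    by - (rule inner_ext, simp add: A_inner alts)+
qed

text \<open>Let the first endomorphism act as a derivation on the component of \<open>G\<close>
  representing the second. The two free slots produce the commutator; of the two fixed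
  \<open>e\<close>s one is killed and the other is sent to a multiple of \<open>e1\<close>, which
  gives the right-hand side.\<close>

lemma commutators:
  "A e3 e4 (A e4 e2 x) - A e4 e2 (A e3 e4 x) = \<mu> *\<^sub>R A e1 e4 x"
  "A e3 e4 (A e2 e3 x) - A e2 e3 (A e3 e4 x) = (- \<mu>) *\<^sub>R A e1 e3 x"
  "A e4 e2 (A e2 e3 x) - A e2 e3 (A e4 e2 x) = \<mu> *\<^sub>R A e1 e2 x"
proof -
  have inner: "(A a b x - A c d y) \<bullet> z = G a b x z - G c d y z" "(r *\<^sub>R A a b x) \<bullet> z = r * G a b x z"
    for a b c d x y z r
    by (simp_all add: inner_diff_left A_inner)
  have skew: "G a b c (A x y z) = - G x y (A a b c) z" for a b c x y z
    using A_skew[of x y "A a b c" z] by (simp add: A_inner)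
  show "A e3 e4 (A e4 e2 x) - A e4 e2 (A e3 e4 x) = \<mu> *\<^sub>R A e1 e4 x"
  proof (rule inner_ext)
    fix y
    have "G (A e3 e4 x) e2 y e4 - \<mu> * G x e1 y e4 + G x e2 (A e3 e4 y) e4 = 0"
      using derivation[of e3 e4 x e2 y e4] by (simp add: A_pair_e scales zeros negs)
    then show "(A e3 e4 (A e4 e2 x) - A e4 e2 (A e3 e4 x)) \<bullet> y = (\<mu> *\<^sub>R A e1 e4 x) \<bullet> y"
      unfolding inner using A_pair(2)[of "A e3 e4 x" y] A_pair(2)[of x "A e3 e4 y"]
        A_pair(6)[of x y] swap12[of x e1 y e4] skew[of e4 e2 x e3 e4 y]
      by simp
  qed
  show "A e3 e4 (A e2 e3 x) - A e2 e3 (A e3 e4 x) = (- \<mu>) *\<^sub>R A e1 e3 x"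
  proof (rule inner_ext)
    fix y
    have "G (A e3 e4 x) e2 e3 y - \<mu> * G x e1 e3 y + G x e2 e3 (A e3 e4 y) = 0"
      using derivation[of e3 e4 x e2 e3 y] by (simp add: A_pair_e scales zeros negs)
    then show "(A e3 e4 (A e2 e3 x) - A e2 e3 (A e3 e4 x)) \<bullet> y = ((- \<mu>) *\<^sub>R A e1 e3 x) \<bullet> y"
      unfolding inner using A_pair(3)[of "A e3 e4 x" y] A_pair(3)[of x "A e3 e4 y"]
        A_pair(5)[of x y] swap12[of x e1 e3 y] skew[of e2 e3 x e3 e4 y]
      by simp
  qed
  show "A e4 e2 (A e2 e3 x) - A e2 e3 (A e4 e2 x) = \<mu> *\<^sub>R A e1 e2 x"
  proof (rule inner_ext)
    fix y
    have "G (A e4 e2 x) e2 e3 y - \<mu> * G x e2 e1 y + G x e2 e3 (A e4 e2 y) = 0"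
      using derivation[of e4 e2 x e2 e3 y] by (simp add: A_pair_e scales zeros negs)
    then show "(A e4 e2 (A e2 e3 x) - A e2 e3 (A e4 e2 x)) \<bullet> y = (\<mu> *\<^sub>R A e1 e2 x) \<bullet> y"
      unfolding inner using A_pair(3)[of "A e4 e2 x" y] A_pair(3)[of x "A e4 e2 y"]
        swap13[of x e2 e1 y] swap23[of e1 e2 x y] skew[of e2 e3 x e4 e2 y]
        cycle_123[of e2 x e1 y] swap12[of e2 e1 x y]
      by simp
  qed
qed

text \<open>The second variation in the directions \<open>(s b, C12 b, C13 b, C14 b)\<close>, summed over the frame,
  where \<open>C1j\<close> is the component of \<open>G\<close> in the slots 1 and \<open>j\<close>; by the commutators the cubic terms
  are again sums of squares.\<close>

lemma trace_inequality:
  assumes B: "frame B"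
  shows "2 * s * (N B e3 e4 + N B e4 e2 + N B e2 e3) + \<mu> * (N B e1 e4 + N B e1 e3 + N B e1 e2)
    \<le> \<mu> * (s\<^sup>2 * card B + (N B e3 e4 + N B e4 e2 + N B e2 e3))"
proof -
  have perp: "perp (A a b x)" if "{a, b} \<subseteq> {e1, e2, e3, e4}" "perp x" for a b x
    using perp_A that .
  have skew: "A a b x \<bullet> y = - (x \<bullet> A a b y)" for a b x y by (rule A_skew)
  have t1: "(\<Sum>b\<in>B. A e1 e4 (A e3 e4 b) \<bullet> A e4 e2 b) = \<mu> / 2 * N B e1 e4"
    unfolding N_def
    by (rule commutator_trace[OF B, of "A e3 e4" "A e4 e2" "A e1 e4" "\<mu>"])
      (simp_all only: perp insert_subset insert_iff empty_subsetI simp_thms skew commutators)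
  \<comment> \<open>The sign of this commutator cancels the one with which \<open>A e1 e3\<close>
    enters the second variation, so all three cubic terms contribute positively.\<close>
  have t2: "(\<Sum>b\<in>B. A e1 e3 (A e3 e4 b) \<bullet> A e2 e3 b) = - \<mu> / 2 * N B e1 e3"
    unfolding N_def
    by (rule commutator_trace[OF B, of "A e3 e4" "A e2 e3" "A e1 e3" "- \<mu>"])
      (simp_all only: perp insert_subset insert_iff empty_subsetI simp_thms skew commutators)
  have t3: "(\<Sum>b\<in>B. A e1 e2 (A e4 e2 b) \<bullet> A e2 e3 b) = \<mu> / 2 * N B e1 e2"
    unfolding N_def
    by (rule commutator_trace[OF B, of "A e4 e2" "A e2 e3" "A e1 e2" "\<mu>"])
      (simp_all only: perp insert_subset insert_iff empty_subsetI simp_thms skew commutators)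
  have "(\<Sum>b\<in>B. s * (A e3 e4 b \<bullet> A e3 e4 b + A e4 e2 b \<bullet> A e4 e2 b + A e2 e3 b \<bullet> A e2 e3 b)
      + A e1 e4 (A e3 e4 b) \<bullet> A e4 e2 b - A e1 e3 (A e3 e4 b) \<bullet> A e2 e3 b + A e1 e2 (A e4 e2 b) \<bullet> A e2 e3 b)
    \<le> (\<Sum>b\<in>B. \<mu> / 2 * (s\<^sup>2 + (A e3 e4 b \<bullet> A e3 e4 b + A e4 e2 b \<bullet> A e4 e2 b + A e2 e3 b \<bullet> A e2 e3 b)))"
    (is "sum ?l B \<le> sum ?r B")
  proof (rule sum_mono)
    fix b assume "b \<in> B"
    then have b: "perp b" "b \<bullet> b = 1" using B by (auto simp: frame_def)
    have "G (s *\<^sub>R b) u e3 e4 = s * (A e3 e4 b \<bullet> u)" "G (s *\<^sub>R b) e2 u e4 = s * (A e4 e2 b \<bullet> u)"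
      "G (s *\<^sub>R b) e2 e3 u = s * (A e2 e3 b \<bullet> u)" "G e1 u v e4 = A e1 e4 u \<bullet> v"
      "G e1 u e3 v = - (A e1 e3 u \<bullet> v)" "G e1 e2 u v = A e1 e2 u \<bullet> v" for u v
      using A_pair(1)[of b u] A_pair(2)[of b u] A_pair(3)[of b u] A_pair(5)[of u v] A_pair(6)[of u v]
      by (simp_all add: A_inner scales)
    note this [simp]
    have "perp (s *\<^sub>R b)" "perp (A e3 e4 b)" "perp (A e4 e2 b)" "perp (A e2 e3 b)"
      using b by (auto intro: perp perp_scale)
    from second_order[OF this] show "?l b \<le> ?r b"
      using b by (simp add: power2_eq_square algebra_simps)
  qed
  also have "sum ?r B = \<mu> / 2 * (s\<^sup>2 * card B + (N B e3 e4 + N B e4 e2 + N B e2 e3))"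
    unfolding N_def sum_distrib_left[symmetric] sum.distrib by simp
  also have "sum ?l B = s * (N B e3 e4 + N B e4 e2 + N B e2 e3) + \<mu> / 2 * (N B e1 e4 + N B e1 e3 + N B e1 e2)"
    unfolding sum.distrib sum_subtractf t1 t2 t3 sum_distrib_left[symmetric]
    by (simp add: N_def distrib_left)
  finally show ?thesis by (simp add: field_simps)
qed

lemma flat_klein: "flat_comass_point G \<mu> e2 e1 e4 e3" "flat_comass_point G \<mu> e3 e4 e1 e2"
  "flat_comass_point G \<mu> e4 e3 e2 e1"
  using klein derivation by (simp_all add: flat_comass_point_def flat_comass_point_axioms_def)

lemma frame_klein:
  assumes "frame B"
  shows "comass_point.frame e2 e1 e4 e3 B" "comass_point.frame e3 e4 e1 e2 B"
    "comass_point.frame e4 e3 e2 e1 B"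
  using assms klein unfolding frame_def
  by (auto simp: comass_point.frame_def comass_point.perp_def perp_def)

text \<open>Adding the trace inequality for the four choices of the first vector cancels the terms
  with \<open>\<mu> * T\<close>. What is left bounds \<open>T\<close> by a multiple of
  \<open>s\<close> for every positive \<open>s\<close>, so \<open>T\<close>, a sum of squares, is
  zero.\<close>

lemma frame_vanish:
  assumes B: "frame B" and e: "{a, b} \<subseteq> {e1, e2, e3, e4}" and x: "perp x"
  shows "A a b x = 0"
proof -
  define T where "T = N B e1 e2 + N B e1 e3 + N B e1 e4 + N B e2 e3 + N B e2 e4 + N B e3 e4"
  have bound: "s * T \<le> s * (\<mu> * s * card B)" for s :: real
    using trace_inequality[OF B, of s]
      flat_comass_point.trace_inequality[OF flat_klein(1) frame_klein(1)[OF B], of s]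
      flat_comass_point.trace_inequality[OF flat_klein(2) frame_klein(2)[OF B], of s]
      flat_comass_point.trace_inequality[OF flat_klein(3) frame_klein(3)[OF B], of s]
    by (simp add: T_def N_swap[of B e2 e1] N_swap[of B e3 e1] N_swap[of B e4 e1] N_swap[of B e3 e2]
        N_swap[of B e4 e2] N_swap[of B e4 e3] power2_eq_square algebra_simps)
  have "T \<le> 0"
  proof (rule ccontr)
    assume "\<not> T \<le> 0"
    \<comment> \<open>For this \<open>s\<close> the number \<open>\<mu> * s * card B\<close> is
      strictly below \<open>T\<close>; the added 1 covers an empty frame.\<close>
    then have s: "T / (\<mu> * (card B + 1)) > 0" using pos by (simp add: add_nonneg_pos)
    have "T \<le> \<mu> * (T / (\<mu> * (card B + 1))) * card B"
      using bound[of "T / (\<mu> * (card B + 1))"] mult_left_le_imp_le[OF _ s] by blast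
    also have "\<dots> = T * (card B / (card B + 1))" using pos by simp
    also have "\<dots> < T * 1" using \<open>\<not> T \<le> 0\<close> by (intro mult_strict_left_mono) auto
    finally show False by simp
  qed
  then have "N B e1 e2 = 0" "N B e1 e3 = 0" "N B e1 e4 = 0" "N B e2 e3 = 0" "N B e2 e4 = 0" "N B e3 e4 = 0"
    using N_nonneg[of B e1 e2] N_nonneg[of B e1 e3] N_nonneg[of B e1 e4] N_nonneg[of B e2 e3]
      N_nonneg[of B e2 e4] N_nonneg[of B e3 e4] unfolding T_def by linarith+
  moreover have "N B c c = 0" for c by (simp add: N_def A_def alts)
  ultimately have "N B a b = 0" using e by (auto simp: N_swap[of B e2 e1] N_swap[of B e3 e1]
      N_swap[of B e4 e1] N_swap[of B e3 e2] N_swap[of B e4 e2] N_swap[of B e4 e3])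
  then have *: "A a b c = 0" if "c \<in> B" for c
    using B that unfolding N_def frame_def by (subst (asm) sum_nonneg_eq_0_iff) auto
  have "G a b x w = 0" for w
  proof -
    have "G a b x w = G a b (\<Sum>c\<in>B. (x \<bullet> c) *\<^sub>R c) w" using B x by (simp add: frame_def)
    also have "\<dots> = (\<Sum>c\<in>B. (x \<bullet> c) * (A a b c \<bullet> w))" by (simp add: linear_sum[OF lin3] scales A_inner)
    also have "\<dots> = 0" by (simp add: *)
    finally show ?thesis .
  qed
  then show ?thesis by - (rule inner_ext, simp add: A_inner)
qed

end

text \<open>The result in terms of orthonormal vectors alone: a maximiser supplies the four vectors,
  and an orthonormal basis of their complement supplies \<open>B\<close>, on which
  \<open>frame_vanish\<close> applies.\<close>

theorem ex_orthonormal_splitting: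
  fixes G :: "'b::euclidean_space \<Rightarrow> 'b \<Rightarrow> 'b \<Rightarrow> 'b \<Rightarrow> real"
  assumes G: "alternating_quadrilinear G"
    and D: "\<And>x y z w. D x y z \<bullet> w = G x y z w"
    and derivation: "\<And>x y a b c d.
      G (D x y a) b c d + G a (D x y b) c d + G a b (D x y c) d + G a b c (D x y d) = 0"
    and nz: "G v1 v2 v3 v4 \<noteq> 0"
  obtains e1 e2 e3 e4 B where "distinct [e1, e2, e3, e4]" "{e1, e2, e3, e4} \<inter> B = {}"
    "finite B" "card B + 4 = DIM('b)"
    "\<forall>x\<in>{e1, e2, e3, e4} \<union> B. \<forall>y\<in>{e1, e2, e3, e4} \<union> B. x \<bullet> y = (if x = y then 1 else 0)"
    "span ({e1, e2, e3, e4} \<union> B) = UNIV"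
    "G e1 e2 e3 e4 \<noteq> 0"
    "\<forall>a\<in>{e1, e2, e3, e4}. \<forall>b\<in>{e1, e2, e3, e4}. \<forall>c\<in>B. \<forall>w. G a b c w = 0"
proof -
  interpret alternating_quadrilinear G by (rule G)
  have D_eq: "D x y z = A x y z" for x y z
    by (rule inner_ext) (simp add: D A_inner)
  obtain \<mu> e1 e2 e3 e4 where e: "\<mu> > 0" "norm e1 = 1" "norm e2 = 1" "norm e3 = 1" "norm e4 = 1"
    "G e1 e2 e3 e4 = \<mu>" "\<forall>a b c d. G a b c d \<le> \<mu> * (norm a * norm b * norm c * norm d)"
    using ex_maximum[OF nz] by blast
  interpret flat_comass_point G \<mu> e1 e2 e3 e4
    by unfold_locales (use e derivation in \<open>simp_all only: D_eq\<close>)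
  let ?E = "{e1, e2, e3, e4}"
  have sub: "subspace {x. perp x}"
    by (auto simp: subspace_def perp_def inner_add_right)
  obtain B where B: "B \<subseteq> {x. perp x}" "pairwise orthogonal B" "\<And>x. x \<in> B \<Longrightarrow> norm x = 1"
    "independent B" "card B = dim {x. perp x}" "span B = {x. perp x}"
    using orthonormal_basis_subspace[OF sub] by metis
  have finB: "finite B" using B(4) independent_imp_finite by blast
  have B1: "b \<bullet> b = 1" if "b \<in> B" for b using B(3)[OF that] by (simp add: norm_eq_1)
  have B0: "b \<bullet> c = 0" if "b \<in> B" "c \<in> B" "b \<noteq> c" for b c
    using B(2) that by (auto simp: pairwise_def orthogonal_def)
  have perpB: "perp b" if "b \<in> B" for b using B(1) that by auto
  have frame: "frame B"
    unfolding frame_def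
  proof (intro conjI allI impI ballI)
    fix x assume "perp x"
    then have x: "x \<in> span B" by (simp add: B(6))
    \<comment> \<open>The defect of the expansion is orthogonal to the span of \<open>B\<close> and
      lies in it, hence is orthogonal to itself.\<close>
    have "(x - (\<Sum>b\<in>B. (x \<bullet> b) *\<^sub>R b)) \<bullet> y = 0" if "y \<in> span B" for y
      using that
    proof (induction rule: span_induct_alt)
      case (step c b z)
      have "(\<Sum>a\<in>B. (x \<bullet> a) *\<^sub>R a) \<bullet> b = (\<Sum>a\<in>B. if a = b then x \<bullet> b else 0)"
        unfolding inner_sum_left using B0 B1 step(1) by (intro sum.cong) auto
      then show ?case using step finB by (simp add: inner_add_right inner_diff_left)
    qed simp
    moreover have "x - (\<Sum>b\<in>B. (x \<bullet> b) *\<^sub>R b) \<in> span B"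
      by (intro span_diff x span_sum span_scale) (rule span_base)
    ultimately have "(x - (\<Sum>b\<in>B. (x \<bullet> b) *\<^sub>R b)) \<bullet> (x - (\<Sum>b\<in>B. (x \<bullet> b) *\<^sub>R b)) = 0" .
    then have "x - (\<Sum>b\<in>B. (x \<bullet> b) *\<^sub>R b) = 0" by (simp only: inner_eq_zero_iff)
    then show "(\<Sum>b\<in>B. (x \<bullet> b) *\<^sub>R b) = x" by simp
  qed (use finB perpB B1 in auto)
  have dist: "distinct [e1, e2, e3, e4]" using orthonormal by auto
  have disj: "?E \<inter> B = {}" using perpB orthonormal by (auto simp: perp_def)
  have eB: "e1 \<bullet> b = 0 \<and> e2 \<bullet> b = 0 \<and> e3 \<bullet> b = 0 \<and> e4 \<bullet> b = 0 \<and>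
      b \<bullet> e1 = 0 \<and> b \<bullet> e2 = 0 \<and> b \<bullet> e3 = 0 \<and> b \<bullet> e4 = 0" if "b \<in> B" for b
    using perpB[OF that] by (simp add: perp_def inner_commute[of b])
  have ortho: "x \<bullet> y = (if x = y then 1 else 0)" if "x \<in> ?E \<union> B" "y \<in> ?E \<union> B" for x y
    using that orthonormal orthonormal(5-10)[THEN trans[OF inner_commute]] B0 B1 eB by auto
  have span: "span (?E \<union> B) = UNIV"
  proof -
    have "x \<in> span (?E \<union> B)" for x
    proof -
      define y where "y = (x \<bullet> e1) *\<^sub>R e1 + (x \<bullet> e2) *\<^sub>R e2 + (x \<bullet> e3) *\<^sub>R e3 + (x \<bullet> e4) *\<^sub>R e4"
      have "perp (x - y)"
        using orthonormal by (simp add: y_def perp_def inner_diff_right inner_add_right inner_commute)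
      then have "x - y \<in> span (?E \<union> B)" using B(6) span_mono[of B "?E \<union> B"] by blast
      moreover have "y \<in> span (?E \<union> B)"
        unfolding y_def by (intro span_add span_scale span_base) auto
      ultimately show ?thesis using span_add by fastforce
    qed
    then show ?thesis by auto
  qed
  have "independent (?E \<union> B)"
  proof (rule pairwise_orthogonal_independent)
    show "pairwise orthogonal (?E \<union> B)" using ortho by (simp add: pairwise_def orthogonal_def)
    show "0 \<notin> ?E \<union> B" using ortho[of 0 0] by auto
  qed
  then have "card (?E \<union> B) = DIM('b)"
    using span dim_eq_card[of "?E \<union> B" UNIV] by simp
  then have "card B + 4 = DIM('b)"
    using dist disj finB by (subst (asm) card_Un_disjoint) auto
  moreover have "G a b c w = 0" if "a \<in> ?E" "b \<in> ?E" "c \<in> B" for a b c w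
    using frame_vanish[OF frame, of a b c] that perpB by (simp add: A_inner[symmetric])
  moreover have "G e1 e2 e3 e4 \<noteq> 0" using pos attained by simp
  ultimately show thesis
    by (intro that[of e1 e2 e3 e4 B] dist disj finB ortho span ballI allI)
qed

section \<open>Alternating forms\<close>

lemma alternating_form_length: "alternating_form p \<omega> \<Longrightarrow> length vs \<noteq> p \<Longrightarrow> \<omega> vs = 0"
  by (simp add: alternating_form_def)

lemma alternating_form_linear:
  "alternating_form p \<omega> \<Longrightarrow> length vs = p \<Longrightarrow> i < p \<Longrightarrow> linear (\<lambda>x. \<omega> (vs[i := x]))"
  by (simp add: alternating_form_def)

lemma alternating_form_repeat:
  "alternating_form p \<omega> \<Longrightarrow> \<not> distinct vs \<Longrightarrow> \<omega> vs = 0"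
  unfolding alternating_form_def distinct_conv_nth by (metis linorder_neqE_nat)

lemma not_distinctI: "i < j \<Longrightarrow> j < length vs \<Longrightarrow> vs ! i = vs ! j \<Longrightarrow> \<not> distinct vs"
  using nth_eq_iff_index_eq[of vs i j] by auto

lemma alternating_form_add:
  assumes "alternating_form p \<omega>" "alternating_form p \<eta>"
  shows "alternating_form p (\<lambda>vs. \<omega> vs + \<eta> vs)"
  using assms by (auto simp: alternating_form_def intro: linear_compose_add)

lemma alternating_form_scale:
  assumes "alternating_form p \<omega>"
  shows "alternating_form p (\<lambda>vs. c * \<omega> vs)"
  using assms by (auto simp: alternating_form_def linear_iff algebra_simps)

lemma alternating_form_diff:
  assumes "alternating_form p \<omega>" "alternating_form p \<eta>"
  shows "alternating_form p (\<lambda>vs. \<omega> vs - \<eta> vs)"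
  using alternating_form_add[OF assms(1) alternating_form_scale[OF assms(2), of "-1"]] by simp

lemma alternating_form_interior_product:
  assumes \<omega>: "alternating_form (Suc p) \<omega>"
  shows "alternating_form p (interior_product v \<omega>)"
  unfolding alternating_form_def interior_product_def
proof (intro conjI allI impI)
  fix vs :: "'a list" and i assume "length vs = p \<and> i < p"
  then show "linear (\<lambda>x. \<omega> (v # vs[i := x]))"
    using alternating_form_linear[OF \<omega>, of "v # vs" "Suc i"] by simp
next
  fix vs :: "'a list" and i j assume "length vs = p \<and> i < j \<and> j < p \<and> vs ! i = vs ! j"
  then show "\<omega> (v # vs) = 0"
    by (intro alternating_form_repeat[OF \<omega>]) (auto dest: not_distinctI)
qed (use \<omega> in \<open>simp add: alternating_form_length\<close>)

lemma alternating_form_swap_first: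
  assumes \<omega>: "alternating_form p \<omega>"
  shows "\<omega> (y # x # vs) = - \<omega> (x # y # vs)"
proof (cases "Suc (Suc (length vs)) = p")
  case True
  have l1: "linear (\<lambda>x. \<omega> (x # z # vs))" for z using alternating_form_linear_first[OF \<omega>] .
  have l2: "linear (\<lambda>x. \<omega> (z # x # vs))" for z
    using alternating_form_linear[OF \<omega>, of "z # z # vs" 1] True by simp
  have rep: "\<omega> (z # z # vs) = 0" for z using alternating_form_repeat[OF \<omega>, of "z # z # vs"] by simp
  show ?thesis
    using rep[of "x + y"] rep[of x] rep[of y] by (simp add: linear_add[OF l1] linear_add[OF l2])
qed (use \<omega> in \<open>simp add: alternating_form_length\<close>)

lemma alternating_form_move_front:
  assumes "alternating_form p \<omega>"
  shows "\<omega> (us @ x # vs) = (- 1) ^ length us * \<omega> (x # us @ vs)"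
  using assms
proof (induction us arbitrary: p \<omega>)
  case (Cons u us)
  show ?case
  proof (cases p)
    case 0
    then show ?thesis using Cons.prems by (simp add: alternating_form_length)
  next
    case (Suc q)
    show ?thesis
      using Cons.IH[OF alternating_form_interior_product, of q \<omega> u] Cons.prems Suc
        alternating_form_swap_first[OF Cons.prems, of u x "us @ vs"]
      by (simp add: interior_product_def)
  qed
qed simp

text \<open>The sign and deletion in \<open>wedge\<close> amount to substitution at the deleted
  place. This turns the action of a two-form into a derivation.\<close>

lemma alternating_form_omit:
  assumes "alternating_form p \<omega>" "i < length vs"
  shows "(- 1) ^ i * \<omega> (x # omit i vs) = \<omega> (vs[i := x])"
  using alternating_form_move_front[OF assms(1), of "take i vs" x "drop (Suc i) vs"] assms(2)
  by (simp add: upd_conv_take_nth_drop omit_def)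

text \<open>Moving entries to the front changes a form only by signs. Absolute values suffice where
  one only decides whether a value is zero.\<close>

lemma alternating_form_perm:
  assumes "alternating_form p \<omega>" "mset xs = mset ys"
  shows "\<bar>\<omega> xs\<bar> = \<bar>\<omega> ys\<bar>"
  using assms
proof (induction xs arbitrary: p \<omega> ys)
  case (Cons x xs)
  then have "x \<in> set ys" by (metis list.set_intros(1) set_mset_mset)
  then obtain us vs where ys: "ys = us @ x # vs" by (meson split_list)
  then have m: "mset xs = mset (us @ vs)" using Cons.prems by simp
  have "\<bar>\<omega> ys\<bar> = \<bar>\<omega> (x # us @ vs)\<bar>"
    unfolding ys alternating_form_move_front[OF Cons.prems(1)] by (simp add: abs_mult power_abs)
  also have "\<dots> = \<bar>\<omega> (x # xs)\<bar>"
  proof (cases p)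
    case 0
    then show ?thesis using Cons.prems by (simp add: alternating_form_length)
  next
    case (Suc q)
    then show ?thesis
      using Cons.IH[OF alternating_form_interior_product m, of q \<omega> x] Cons.prems
      by (simp add: interior_product_def)
  qed
  finally show ?case by simp
qed simp

text \<open>Expand one argument at a time in the spanning set, passing to the contraction with each
  vector of that set; lists with a repetition give zero anyway.\<close>

lemma alternating_form_eq_0:
  assumes "alternating_form p \<omega>" "span B = UNIV"
    and "\<And>vs. length vs = p \<Longrightarrow> set vs \<subseteq> B \<Longrightarrow> distinct vs \<Longrightarrow> \<omega> vs = 0"
  shows "\<omega> = (\<lambda>_. 0)"
proof -
  \<comment> \<open>The induction is over all forms and without distinctness, since it passes to
    contractions and does not retain the earlier arguments.\<close>
  have "\<omega> vs = 0" if "alternating_form p \<omega>"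
    "\<And>vs. length vs = p \<Longrightarrow> set vs \<subseteq> B \<Longrightarrow> \<omega> vs = 0" for p \<omega> vs
    using that
  proof (induction vs arbitrary: p \<omega>)
    case Nil
    then show ?case by (cases "p = 0") (auto simp: alternating_form_length)
  next
    case (Cons v vs)
    show ?case
    proof (cases p)
      case 0
      then show ?thesis using Cons.prems by (simp add: alternating_form_length)
    next
      case (Suc q)
      have "\<omega> (b # vs) = 0" if "b \<in> B" for b
        using Cons.IH[OF alternating_form_interior_product, of q \<omega> b] Cons.prems that Suc
        by (simp add: interior_product_def)
      moreover have "v \<in> span B" using assms(2) by simp
      ultimately show ?thesis
        using linear_eq_0_on_span[OF alternating_form_linear_first[OF Cons.prems(1)], of B vs v] by simp
    qed
  qed
  then show ?thesis
    using assms alternating_form_repeat[OF assms(1)] by blast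
qed

text \<open>Repetitions beyond the first slot are handled by the contraction with the first entry. A
  repetition of the first entry is moved into the second slot within that contraction, up to
  sign.\<close>

lemma alternating_form_SucI:
  assumes "\<omega> [] = 0" "\<And>v. alternating_form p (interior_product v \<omega>)"
    "\<And>vs. linear (\<lambda>x. \<omega> (x # vs))" "\<And>v vs. \<omega> (v # v # vs) = 0"
  shows "alternating_form (Suc p) \<omega>"
  unfolding alternating_form_def
proof (intro conjI allI impI)
  fix vs :: "'a list"
  have tail: "\<omega> (w # ws) = 0" if "length ws \<noteq> p \<or> \<not> distinct ws" for w ws
    using alternating_form_length[OF assms(2)[of w], of ws] alternating_form_repeat[OF assms(2)[of w], of ws] that
    by (auto simp: interior_product_def)
  {
    assume "length vs \<noteq> Suc p"
    then show "\<omega> vs = 0" using assms(1) tail by (cases vs) auto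
  next
    fix i assume "length vs = Suc p \<and> i < Suc p"
    then show "linear (\<lambda>x. \<omega> (vs[i := x]))"
      using assms(3) alternating_form_linear[OF assms(2)]
      by (cases vs; cases i) (auto simp: interior_product_def)
  next
    fix i j assume ij: "length vs = Suc p \<and> i < j \<and> j < Suc p \<and> vs ! i = vs ! j"
    then obtain v ws where vs: "vs = v # ws" by (cases vs) auto
    show "\<omega> vs = 0"
    proof (cases i)
      case 0
      then obtain k where k: "j = Suc k" "k < length ws" "ws ! k = v" using ij vs by (cases j) auto
      then have ws: "ws = take k ws @ v # drop (Suc k) ws" by (metis id_take_nth_drop)
      have "\<omega> (v # ws) = (- 1) ^ k * \<omega> (v # v # take k ws @ drop (Suc k) ws)"
        using alternating_form_move_front[OF assms(2)[of v], of "take k ws" v "drop (Suc k) ws"] ws k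
        by (simp add: interior_product_def)
      then show ?thesis by (simp add: vs assms(4))
    next
      case (Suc k)
      then have "\<not> distinct ws" using ij vs by (cases j) (auto dest: not_distinctI)
      then show ?thesis by (simp add: vs tail)
    qed
  }
qed

text \<open>Induction on the degree through the contraction formula
  \<open>interior_product_wedge\<close>; in degree zero the contraction of \<open>\<omega>\<close>
  is zero.\<close>

lemma alternating_form_wedge:
  assumes "linear \<alpha>" "alternating_form p \<omega>"
  shows "alternating_form (Suc p) (wedge \<alpha> \<omega>)"
  using assms(2)
proof (induction p arbitrary: \<omega>)
  case 0
  then have "interior_product v \<omega> = (\<lambda>_. 0)" for v
    by (auto simp: interior_product_def alternating_form_length)
  moreover have "alternating_form 0 (\<lambda>vs. \<alpha> v * \<omega> vs)" for v
    using 0 by (rule alternating_form_scale)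
  ultimately show ?case
    by (intro alternating_form_SucI)
      (auto simp: wedge_Cons interior_product_wedge wedge_zero linear_iff linear_add[OF assms(1)]
        linear_scale[OF assms(1)] algebra_simps interior_product_def alternating_form_length[OF 0])
next
  case (Suc p)
  have lin: "linear (\<lambda>x. \<omega> (x # vs))" for vs using alternating_form_linear_first[OF Suc.prems] .
  show ?case
  proof (rule alternating_form_SucI)
    show "alternating_form (Suc p) (interior_product v (wedge \<alpha> \<omega>))" for v
      unfolding interior_product_wedge
      by (intro alternating_form_diff alternating_form_scale Suc.prems Suc.IH
          alternating_form_interior_product)
    show "linear (\<lambda>x. wedge \<alpha> \<omega> (x # vs))" for vs
    proof -
      have "linear (\<lambda>x. wedge \<alpha> (interior_product x \<omega>) vs)"
        by (rule linearI) (simp_all add: wedge_def interior_product_def linear_add[OF lin]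
            linear_scale[OF lin] sum.distrib sum_distrib_left algebra_simps)
      moreover have "linear (\<lambda>x. \<alpha> x * \<omega> vs)"
        using linear_compose_scale_right[OF assms(1), of "\<omega> vs"] by (simp add: mult.commute)
      ultimately show ?thesis unfolding wedge_Cons by (rule linear_compose_sub[rotated])
    qed
    show "wedge \<alpha> \<omega> (v # v # vs) = 0" for v vs
    proof -
      have "interior_product v (interior_product v \<omega>) = (\<lambda>_. 0)"
        by (auto simp: interior_product_def alternating_form_repeat[OF Suc.prems])
      then show ?thesis by (simp add: wedge_Cons wedge_zero) (simp add: interior_product_def)
    qed
  qed simp
qed

lemma alternating_form_wedge_list:
  assumes "\<forall>\<alpha>\<in>set \<alpha>s. linear \<alpha>"
  shows "alternating_form (length \<alpha>s) (wedge_list \<alpha>s)"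
  using assms
proof (induction \<alpha>s)
  case Nil
  then show ?case by (simp add: alternating_form_def unit_form_def)
qed (simp add: alternating_form_wedge)

section \<open>Values of wedge products on special arguments\<close>

lemma interior_product_wedge_list_eq_0:
  assumes "\<forall>\<alpha>\<in>set \<alpha>s. \<alpha> v = 0"
  shows "wedge_list \<alpha>s (v # vs) = 0"
proof -
  obtain c where "\<forall>v. wedge_list \<alpha>s (v # vs) = (\<Sum>j<length \<alpha>s. c j * (\<alpha>s ! j) v)"
    using interior_product_wedge_list_span[of \<alpha>s vs] by blast
  then show ?thesis using assms by (auto intro!: sum.neutral)
qed

lemma wedge_list_eq_0:
  assumes "\<alpha> \<in> set \<alpha>s" "\<forall>v\<in>set vs. \<alpha> v = 0"
  shows "wedge_list \<alpha>s vs = 0"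
  using assms
proof (induction \<alpha>s arbitrary: vs)
  case (Cons \<beta> \<alpha>s)
  show ?case
  proof (cases "\<alpha> = \<beta>")
    case False
    have "set (omit i vs) \<subseteq> set vs" for i
      by (auto simp: omit_def dest: in_set_takeD in_set_dropD)
    then have "wedge_list \<alpha>s (omit i vs) = 0" for i using Cons False by (metis set_ConsD subsetD)
    then show ?thesis by (simp add: wedge_def)
  qed (use Cons.prems in \<open>auto simp: wedge_def\<close>)
qed simp

text \<open>The determinant of the identity matrix, expanded in the first argument, on which the
  later factors vanish.\<close>

lemma wedge_list_dual:
  assumes "length \<alpha>s = length vs"
    "\<And>i j. i < length vs \<Longrightarrow> j < length vs \<Longrightarrow> (\<alpha>s ! i) (vs ! j) = (if i = j then 1 else 0)"
  shows "wedge_list \<alpha>s vs = 1"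
  using assms
proof (induction \<alpha>s vs rule: list_induct2)
  case Nil
  show ?case by (simp add: unit_form_def)
next
  case (Cons \<alpha> \<alpha>s v vs)
  have 0: "\<beta> v = 0" if "\<beta> \<in> set \<alpha>s" for \<beta>
    using that Cons.hyps Cons.prems[of "Suc _" 0] by (auto simp: in_set_conv_nth)
  have "wedge \<alpha> (interior_product v (wedge_list \<alpha>s)) vs = 0"
    using interior_product_wedge_list_eq_0[of \<alpha>s v] 0 by (simp add: wedge_def interior_product_def)
  moreover have "wedge_list \<alpha>s vs = 1"
    using Cons.IH Cons.prems[of "Suc _" "Suc _"] by simp
  ultimately show ?case using Cons.prems[of 0 0] by (simp add: wedge_Cons)
qed

section \<open>Derivations, and sums of orthogonal simple forms\<close>

text \<open>The inner product turns \<open>\<omega>\<close> into an endomorphism, and the bracket is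
  this endomorphism acting as a derivation on the arguments of \<open>\<Omega>\<close>.\<close>

lemma bracket_two_form:
  fixes g :: "'a::real_vector \<Rightarrow> 'a \<Rightarrow> real"
  assumes fd: "dim (UNIV :: 'a set) > 0" and g: "inner_product g"
    and \<Omega>: "alternating_form p \<Omega>" and \<omega>: "alternating_form 2 \<omega>"
  shows "bracket g \<omega> \<Omega> vs = (\<Sum>i<length vs. \<Omega> (vs[i := sharp g (\<lambda>w. \<omega> [vs ! i, w])]))"
proof -
  have bl: "bilinear g" using g by (simp add: inner_product_def)
  have lin: "linear (\<lambda>x. \<Omega> (vs[i := x]))" if "i < length vs" for i
  proof (cases "length vs = p")
    case False
    then show ?thesis using alternating_form_length[OF \<Omega>] by (simp add: linear_iff)
  qed (use that alternating_form_linear[OF \<Omega>] in auto)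
  obtain D where D: "two_form_decomp \<omega> D" using two_form_decomp_exists[OF fd \<omega>] by blast
  then have linD: "\<forall>(\<alpha>, \<beta>)\<in>set D. linear \<alpha> \<and> linear \<beta>"
    and \<omega>_eq: "\<omega> = (\<lambda>vs. \<Sum>(\<alpha>, \<beta>)\<leftarrow>D. wedge_list [\<alpha>, \<beta>] vs)"
    by (auto simp: two_form_decomp_def)
  let ?A = "\<lambda>E v. \<Sum>(\<alpha>, \<beta>)\<leftarrow>E. \<alpha> v *\<^sub>R sharp g \<beta> - \<beta> v *\<^sub>R sharp g \<alpha>"
  have A: "sharp g (\<lambda>w. \<omega> [v, w]) = ?A D v" for v
  proof (rule sharp_eqI[OF g])
    fix w
    have "\<omega> [v, w] = (\<Sum>(\<alpha>, \<beta>)\<leftarrow>D. \<alpha> v * \<beta> w - \<alpha> w * \<beta> v)"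
      unfolding \<omega>_eq wedge_list_pair by simp
    also have "\<dots> = g (?A D v) w"
      using linD
      by (induction D) (auto simp: bilinear_lzero[OF bl] bilinear_ladd[OF bl] bilinear_lsub[OF bl]
          bilinear_lmul[OF bl] sharp_works[OF fd g])
    finally show "g (?A D v) w = \<omega> [v, w]" by simp
  qed
  have simple: "simple_bracket g \<alpha> \<beta> \<Omega> vs
      = (\<Sum>i<length vs. \<Omega> (vs[i := \<alpha> (vs ! i) *\<^sub>R sharp g \<beta> - \<beta> (vs ! i) *\<^sub>R sharp g \<alpha>]))" for \<alpha> \<beta>
  proof -
    have "wedge \<gamma> (interior_product X \<Omega>) vs = (\<Sum>i<length vs. \<gamma> (vs ! i) * \<Omega> (vs[i := X]))" for \<gamma> X
      unfolding wedge_def interior_product_def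
      by (intro sum.cong refl) (simp flip: alternating_form_omit[OF \<Omega>])
    then show ?thesis
      by (simp add: simple_bracket_def linear_diff[OF lin] linear_scale[OF lin] flip: sum_subtractf)
  qed
  have "(\<Sum>(\<alpha>, \<beta>)\<leftarrow>E. simple_bracket g \<alpha> \<beta> \<Omega> vs) = (\<Sum>i<length vs. \<Omega> (vs[i := ?A E (vs ! i)]))" for E
    by (induction E) (auto simp: linear_0[OF lin] linear_add[OF lin] simple sum.distrib)
  then show ?thesis unfolding bracket_eq[OF fd g \<Omega> D] A by simp
qed

lemma contract_vector_wedge_alternating:
  assumes "alternating_form (p + 3) F" "length Xs = 3"
  shows "contract 3 (vector_wedge Xs) F = (\<lambda>vs. F (Xs @ vs))" "alternating_form p (\<lambda>vs. F (Xs @ vs))"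
proof -
  show "contract 3 (vector_wedge Xs) F = (\<lambda>vs. F (Xs @ vs))"
    using contract_vector_wedge[OF assms(1), of Xs] assms(2) by auto
  obtain X Y Z where Xs: "Xs = [X, Y, Z]"
    using assms(2) by (auto simp: numeral_3_eq_3 length_Suc_conv)
  have "alternating_form (Suc (Suc (Suc p))) F" using assms(1) by (simp add: numeral_3_eq_3)
  from alternating_form_interior_product[OF alternating_form_interior_product[OF
      alternating_form_interior_product[OF this, of X], of Y], of Z]
  show "alternating_form p (\<lambda>vs. F (Xs @ vs))" by (simp add: Xs interior_product_def[abs_def])
qed

lemma bracket_contract_vector_wedge:
  fixes g :: "'a::real_vector \<Rightarrow> 'a \<Rightarrow> real"
  assumes fd: "dim (UNIV :: 'a set) > 0" and g: "inner_product g"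
    and F: "alternating_form 5 F"
  shows "bracket g (contract 3 (vector_wedge [X, Y, Z]) F) F vs
    = (\<Sum>i<length vs. F (vs[i := sharp g (\<lambda>w. F [X, Y, Z, vs ! i, w])]))"
  using contract_vector_wedge_alternating[of 2 F "[X, Y, Z]"] F
  by (simp add: bracket_two_form[OF fd g F])

text \<open>Linear combinations of products of \<open>q\<close> one-forms from \<open>S\<close>.
  Keeping track of \<open>S\<close> shows that contractions of a simple form involve only its own
  factors.\<close>

inductive wedge_combination :: "('a \<Rightarrow> real) set \<Rightarrow> nat \<Rightarrow> ('a list \<Rightarrow> real) \<Rightarrow> bool" for S q where
  zero: "wedge_combination S q (\<lambda>_. 0)"
| add: "set \<delta>s \<subseteq> S \<Longrightarrow> length \<delta>s = q \<Longrightarrow> wedge_combination S q \<omega> \<Longrightarrow>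
    wedge_combination S q (\<lambda>vs. c * wedge_list \<delta>s vs + \<omega> vs)"

lemma wedge_combination_wedge_list:
  "set \<delta>s \<subseteq> S \<Longrightarrow> wedge_combination S (length \<delta>s) (wedge_list \<delta>s)"
  using wedge_combination.add[OF _ refl wedge_combination.zero, of \<delta>s S 1] by simp

lemma wedge_combination_add:
  assumes "wedge_combination S q \<omega>" "wedge_combination S q \<eta>"
  shows "wedge_combination S q (\<lambda>vs. \<omega> vs + \<eta> vs)"
  using assms(1)
proof induction
  case (add \<delta>s \<omega> c)
  show ?case using wedge_combination.add[OF add(1,2,4), of c] by (simp add: add.assoc)
qed (use assms in simp)

lemma wedge_combination_scale:
  assumes "wedge_combination S q \<omega>"
  shows "wedge_combination S q (\<lambda>vs. k * \<omega> vs)"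
  using assms
proof induction
  case (add \<delta>s \<omega> c)
  show ?case using wedge_combination.add[OF add(1,2,4), of "k * c"] by (simp add: algebra_simps)
qed (simp add: wedge_combination.zero)

lemma wedge_combination_wedge:
  assumes "wedge_combination S q \<omega>" "\<alpha> \<in> S"
  shows "wedge_combination S (Suc q) (wedge \<alpha> \<omega>)"
  using assms(1)
proof induction
  case zero
  then show ?case by (simp add: wedge_zero wedge_combination.zero)
next
  case (add \<delta>s \<omega> c)
  have "wedge \<alpha> (\<lambda>vs. c * wedge_list \<delta>s vs + \<omega> vs) = (\<lambda>vs. c * wedge_list (\<alpha> # \<delta>s) vs + wedge \<alpha> \<omega> vs)"
    by (rule ext) (simp add: wedge_def algebra_simps sum.distrib sum_distrib_left)
  then show ?case
    using wedge_combination.add[of "\<alpha> # \<delta>s" S "Suc q", OF _ _ add(4), of c] add(1,2) assms(2) by simp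
qed

lemma wedge_combination_interior_product_wedge_list:
  "set \<delta>s \<subseteq> S \<Longrightarrow> length \<delta>s = Suc q \<Longrightarrow> wedge_combination S q (interior_product v (wedge_list \<delta>s))"
proof (induction \<delta>s arbitrary: q)
  case (Cons \<alpha> \<delta>s)
  have "wedge_combination S q (wedge \<alpha> (interior_product v (wedge_list \<delta>s)))"
  proof (cases q)
    case 0
    then have "interior_product v (wedge_list \<delta>s) = (\<lambda>_. 0)"
      using Cons.prems by (auto simp: interior_product_def unit_form_def)
    then show ?thesis by (simp add: wedge_zero wedge_combination.zero)
  next
    case (Suc r)
    then show ?thesis using Cons by (auto intro!: wedge_combination_wedge)
  qed
  then have "wedge_combination S q (\<lambda>vs. - 1 * wedge \<alpha> (interior_product v (wedge_list \<delta>s)) vs)"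
    by (rule wedge_combination_scale)
  moreover have "wedge_combination S q (\<lambda>vs. \<alpha> v * wedge_list \<delta>s vs)"
    using wedge_combination_wedge_list[of \<delta>s S] Cons.prems by (auto intro: wedge_combination_scale)
  ultimately show ?case
    using wedge_combination_add by (fastforce simp: interior_product_wedge)
qed simp

lemma wedge_combination_interior_product:
  assumes "wedge_combination S (Suc q) \<omega>"
  shows "wedge_combination S q (interior_product v \<omega>)"
  using assms
proof induction
  case (add \<delta>s \<omega> c)
  show ?case
    using wedge_combination_add[OF wedge_combination_scale[OF
        wedge_combination_interior_product_wedge_list[OF add(1,2), of v], of c] add(4)]
    by (simp add: interior_product_def[abs_def])
qed (simp add: interior_product_def[abs_def] wedge_combination.zero)

text \<open>The coefficient of each product is absorbed into its first factor, since
  \<open>two_form_decomp\<close> admits only sums of plain products.\<close>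

lemma wedge_combination_two_form_decomp:
  assumes "wedge_combination S 2 \<omega>" "\<forall>\<alpha>\<in>S. linear \<alpha>"
  shows "\<exists>D. two_form_decomp \<omega> D \<and>
    (\<forall>(\<alpha>, \<beta>)\<in>set D. \<exists>c. \<exists>\<alpha>'\<in>S. \<alpha> = (\<lambda>v. c * \<alpha>' v) \<and> \<beta> \<in> S)"
  using assms(1)
proof induction
  case zero
  then show ?case by (intro exI[of _ "[]"]) (simp add: two_form_decomp_def)
next
  case (add \<delta>s \<omega> c)
  then obtain D where D: "two_form_decomp \<omega> D"
    "\<forall>(\<alpha>, \<beta>)\<in>set D. \<exists>c. \<exists>\<alpha>'\<in>S. \<alpha> = (\<lambda>v. c * \<alpha>' v) \<and> \<beta> \<in> S" by blast
  obtain \<alpha> \<beta> where \<delta>s: "\<delta>s = [\<alpha>, \<beta>]"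
    using add(2) by (auto simp: numeral_2_eq_2 length_Suc_conv)
  have S: "\<alpha> \<in> S" "\<beta> \<in> S" using add(1) by (auto simp: \<delta>s)
  then have "linear (\<lambda>v. c * \<alpha> v)"
    using assms(2) linear_compose_scale_right[of \<alpha> c] by simp
  then have "two_form_decomp (\<lambda>vs. c * wedge_list \<delta>s vs + \<omega> vs) (((\<lambda>v. c * \<alpha> v), \<beta>) # D)"
    using D(1) assms(2) S
    by (auto simp: two_form_decomp_def \<delta>s wedge_list_pair algebra_simps simp del: wedge_list_Cons)
  moreover have "\<forall>(\<alpha>, \<beta>)\<in>set (((\<lambda>v. c * \<alpha> v), \<beta>) # D). \<exists>c. \<exists>\<alpha>'\<in>S. \<alpha> = (\<lambda>v. c * \<alpha>' v) \<and> \<beta> \<in> S"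
    using D(2) S by auto
  ultimately show ?case by blast
qed

section \<open>Orthogonal simple summands have vanishing brackets\<close>

lemma orthogonal_simple_factors:
  fixes g :: "'a::real_vector \<Rightarrow> 'a \<Rightarrow> real"
  assumes fd: "dim (UNIV :: 'a set) > 0" and g: "inner_product g" and p: "p > 0"
    and F: "simple_form p F\<^sub>1" "simple_form p F\<^sub>2" "orthogonal_simple g p F\<^sub>1 F\<^sub>2"
  obtains \<alpha>s \<gamma>s where "length \<alpha>s = p" "\<forall>\<alpha>\<in>set \<alpha>s. linear \<alpha>" "F\<^sub>1 = wedge_list \<alpha>s"
    "length \<gamma>s = p" "\<forall>\<gamma>\<in>set \<gamma>s. linear \<gamma>" "F\<^sub>2 = wedge_list \<gamma>s"
    "\<forall>\<alpha>\<in>set \<alpha>s. \<forall>\<gamma>\<in>set \<gamma>s. g (sharp g \<alpha>) (sharp g \<gamma>) = 0"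
proof -
  have bl: "bilinear g" using g by (simp add: inner_product_def)
  \<comment> \<open>The zero form has factorisations without any orthogonality, so a zero summand is
    rewritten with zero one-forms. Positivity of \<open>p\<close> excludes the empty product, which
    is nonzero.\<close>
  let ?Z = "replicate p (\<lambda>_. 0) :: ('a \<Rightarrow> real) list"
  have Z: "wedge_list ?Z = (\<lambda>_. 0)" using p by (cases p) (auto simp: wedge_def)
  have lZ: "\<forall>\<alpha>\<in>set ?Z. linear \<alpha>" by (simp add: linear_iff)
  have sZ: "sharp g (\<lambda>_. 0) = 0" by (rule sharp_eqI[OF g]) (simp add: bilinear_lzero[OF bl])
  obtain \<alpha>s where \<alpha>s: "length \<alpha>s = p" "\<forall>\<alpha>\<in>set \<alpha>s. linear \<alpha>" "F\<^sub>1 = wedge_list \<alpha>s"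
    using F(1) by (auto simp: simple_form_def)
  obtain \<gamma>s where \<gamma>s: "length \<gamma>s = p" "\<forall>\<gamma>\<in>set \<gamma>s. linear \<gamma>" "F\<^sub>2 = wedge_list \<gamma>s"
    using F(2) by (auto simp: simple_form_def)
  show thesis
  proof (cases "F\<^sub>1 = (\<lambda>_. 0) \<or> F\<^sub>2 = (\<lambda>_. 0)")
    case True
    then show thesis
    proof
      assume "F\<^sub>1 = (\<lambda>_. 0)"
      then show thesis using that[of ?Z \<gamma>s] Z lZ \<gamma>s by (simp add: sZ bilinear_lzero[OF bl])
    next
      assume "F\<^sub>2 = (\<lambda>_. 0)"
      then show thesis using that[of \<alpha>s ?Z] Z lZ \<alpha>s by (simp add: sZ bilinear_rzero[OF bl])
    qed
  next
    case False
    then have "plane g p F\<^sub>1 = span (sharp g ` set \<alpha>s)" "plane g p F\<^sub>2 = span (sharp g ` set \<gamma>s)"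
      using plane_wedge_list[OF fd g \<alpha>s(2)] plane_wedge_list[OF fd g \<gamma>s(2)]
      by (simp_all flip: \<alpha>s(3) \<gamma>s(3) add: \<alpha>s(1) \<gamma>s(1))
    then have "\<forall>\<alpha>\<in>set \<alpha>s. \<forall>\<gamma>\<in>set \<gamma>s. g (sharp g \<alpha>) (sharp g \<gamma>) = 0"
      using F(3) False by (simp add: orthogonal_simple_def span_base)
    then show thesis using that \<alpha>s \<gamma>s by blast
  qed
qed

text \<open>Contraction with the dual of \<open>\<beta>\<close> kills the other summand. Wedging
  back with the factor \<open>\<alpha>\<close> gives the product of \<open>\<alpha>s\<close> times
  the inner product of \<open>\<alpha>\<close> and \<open>\<beta>\<close>; this is symmetric, so the
  two terms of the bracket cancel.\<close>

lemma simple_bracket_factors: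
  fixes g :: "'a::real_vector \<Rightarrow> 'a \<Rightarrow> real"
  assumes fd: "dim (UNIV :: 'a set) > 0" and g: "inner_product g"
    and lin: "\<forall>\<alpha>\<in>set \<alpha>s. linear \<alpha>" "\<forall>\<gamma>\<in>set \<gamma>s. linear \<gamma>"
    and F: "alternating_form p F" "F = (\<lambda>vs. wedge_list \<alpha>s vs + wedge_list \<gamma>s vs)"
    and orth: "\<forall>\<alpha>\<in>set \<alpha>s. \<forall>\<gamma>\<in>set \<gamma>s. g (sharp g \<alpha>) (sharp g \<gamma>) = 0"
    and mem: "\<alpha> \<in> set \<alpha>s" "\<beta> \<in> set \<alpha>s"
  shows "simple_bracket g (\<lambda>v. c * \<alpha> v) \<beta> F vs = 0"
proof -
  have bl: "bilinear g" and sym: "\<And>x y. g x y = g y x" using g by (auto simp: inner_product_def)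
  have key: "wedge \<alpha> (interior_product (sharp g \<beta>) F) vs = g (sharp g \<alpha>) (sharp g \<beta>) * wedge_list \<alpha>s vs"
    if "\<alpha> \<in> set \<alpha>s" "\<beta> \<in> set \<alpha>s" for \<alpha> \<beta>
  proof -
    have "\<gamma> (sharp g \<beta>) = 0" if "\<gamma> \<in> set \<gamma>s" for \<gamma>
      using orth that \<open>\<beta> \<in> set \<alpha>s\<close> sharp_works[OF fd g, of \<gamma> "sharp g \<beta>"] lin by (simp add: sym)
    then have "interior_product (sharp g \<beta>) F = interior_product (sharp g \<beta>) (wedge_list \<alpha>s)"
      by (rule_tac ext) (simp add: interior_product_def F(2) interior_product_wedge_list_eq_0)
    moreover have "wedge \<alpha> (wedge_list \<alpha>s) (sharp g \<beta> # vs) = 0"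
      using wedge_wedge_list_mem[OF that(1)] by simp
    ultimately show ?thesis
      using lin that by (simp add: wedge_Cons sharp_works[OF fd g])
  qed
  have "sharp g (\<lambda>v. c * \<alpha> v) = c *\<^sub>R sharp g \<alpha>"
    using lin mem by (intro sharp_eqI[OF g]) (simp add: bilinear_lmul[OF bl] sharp_works[OF fd g])
  moreover have "wedge (\<lambda>v. c * \<alpha> v) \<omega> vs = c * wedge \<alpha> \<omega> vs" for \<omega>
    by (simp add: wedge_def sum_distrib_left algebra_simps)
  moreover have "interior_product (c *\<^sub>R x) F = (\<lambda>us. c * interior_product x F us)" for x
    by (rule ext) (simp add: interior_product_def linear_scale[OF alternating_form_linear_first[OF F(1)]])
  ultimately show ?thesis
    using key[OF mem] key[OF mem(2,1)] sym by (simp add: simple_bracket_def wedge_scale)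
qed

text \<open>The contracted form is a sum of products whose two factors come from the same summand.
  The bracket may be computed from this decomposition, and each term vanishes.\<close>

lemma bracket_contract_eq_0_of_orthogonal_simple:
  fixes g :: "'a::real_vector \<Rightarrow> 'a \<Rightarrow> real"
  assumes fd: "dim (UNIV :: 'a set) > 0" and g: "inner_product g"
    and F: "alternating_form 5 F" "F = (\<lambda>vs. F\<^sub>1 vs + F\<^sub>2 vs)"
    and simple: "simple_form 5 F\<^sub>1" "simple_form 5 F\<^sub>2" "orthogonal_simple g 5 F\<^sub>1 F\<^sub>2"
    and \<Xi>: "\<Xi> \<in> multivectors 3"
  shows "bracket g (contract 3 \<Xi> F) F = (\<lambda>_. 0)"
proof -
  have sym: "\<And>x y. g x y = g y x" using g by (auto simp: inner_product_def)
  obtain \<alpha>s \<gamma>s where \<alpha>s: "length \<alpha>s = 5" "\<forall>\<alpha>\<in>set \<alpha>s. linear \<alpha>" "F\<^sub>1 = wedge_list \<alpha>s"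
    and \<gamma>s: "length \<gamma>s = 5" "\<forall>\<gamma>\<in>set \<gamma>s. linear \<gamma>" "F\<^sub>2 = wedge_list \<gamma>s"
    and orth: "\<forall>\<alpha>\<in>set \<alpha>s. \<forall>\<gamma>\<in>set \<gamma>s. g (sharp g \<alpha>) (sharp g \<gamma>) = 0"
    using orthogonal_simple_factors[OF fd g _ simple] by auto
  obtain D where D: "\<forall>(c, Xs)\<in>set D. length Xs = 3"
    and \<Xi>_eq: "\<Xi> = (\<lambda>\<omega>. \<Sum>(c, Xs)\<leftarrow>D. c * vector_wedge Xs \<omega>)"
    using \<Xi> by (auto simp: multivectors_def)
  have comb: "wedge_combination (set \<delta>s) 2 (\<lambda>vs. \<Sum>(c, Xs)\<leftarrow>D. c * wedge_list \<delta>s (Xs @ vs))"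
    if "length \<delta>s = 5" for \<delta>s :: "('a \<Rightarrow> real) list"
    using D
  proof (induction D)
    case (Cons d D)
    obtain c X Y Z where d: "d = (c, [X, Y, Z])"
      using Cons.prems by (cases d) (auto simp: numeral_3_eq_3 length_Suc_conv)
    have "wedge_combination (set \<delta>s) (Suc (Suc (Suc 2))) (wedge_list \<delta>s)"
      using wedge_combination_wedge_list[of \<delta>s "set \<delta>s"] that by simp
    from wedge_combination_interior_product[OF wedge_combination_interior_product[OF
        wedge_combination_interior_product[OF this, of X], of Y], of Z]
    have "wedge_combination (set \<delta>s) 2 (\<lambda>vs. wedge_list \<delta>s ([X, Y, Z] @ vs))"
      by (simp add: interior_product_def[abs_def])
    from wedge_combination_add[OF wedge_combination_scale[OF this, of c] Cons.IH] Cons.prems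
    show ?case by (simp add: d)
  qed (simp add: wedge_combination.zero)
  obtain D1 where D1: "two_form_decomp (\<lambda>vs. \<Sum>(c, Xs)\<leftarrow>D. c * wedge_list \<alpha>s (Xs @ vs)) D1"
    "\<forall>(\<alpha>, \<beta>)\<in>set D1. \<exists>c. \<exists>\<alpha>'\<in>set \<alpha>s. \<alpha> = (\<lambda>v. c * \<alpha>' v) \<and> \<beta> \<in> set \<alpha>s"
    using wedge_combination_two_form_decomp[OF comb[OF \<alpha>s(1)] \<alpha>s(2)] by blast
  obtain D2 where D2: "two_form_decomp (\<lambda>vs. \<Sum>(c, Xs)\<leftarrow>D. c * wedge_list \<gamma>s (Xs @ vs)) D2"
    "\<forall>(\<alpha>, \<beta>)\<in>set D2. \<exists>c. \<exists>\<alpha>'\<in>set \<gamma>s. \<alpha> = (\<lambda>v. c * \<alpha>' v) \<and> \<beta> \<in> set \<gamma>s"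
    using wedge_combination_two_form_decomp[OF comb[OF \<gamma>s(1)] \<gamma>s(2)] by blast
  have contract: "contract 3 \<Xi> F vs = (\<Sum>(c, Xs)\<leftarrow>D. c * F (Xs @ vs))" for vs
  proof -
    have "contract 3 \<Xi> F vs = (\<Sum>(c, Xs)\<leftarrow>D. c * contract 3 (vector_wedge Xs) F vs)"
      by (simp add: contract_def \<Xi>_eq)
    also have "\<dots> = (\<Sum>(c, Xs)\<leftarrow>D. c * F (Xs @ vs))"
      using D by (intro arg_cong[where f = sum_list] map_cong refl) (fastforce simp: contract_vector_wedge[OF F(1), symmetric])
    finally show ?thesis .
  qed
  have "contract 3 \<Xi> F vs = (\<Sum>(c, Xs)\<leftarrow>D. c * wedge_list \<alpha>s (Xs @ vs))
      + (\<Sum>(c, Xs)\<leftarrow>D. c * wedge_list \<gamma>s (Xs @ vs))" for vs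
    unfolding contract unfolding F(2) \<alpha>s(3) \<gamma>s(3) by (induction D) (auto simp: algebra_simps)
  then have "two_form_decomp (contract 3 \<Xi> F) (D1 @ D2)"
    using D1(1) D2(1) unfolding two_form_decomp_def fun_eq_iff by auto
  note * = bracket_eq[OF fd g F(1) this]
  have F_alt: "F = (\<lambda>vs. wedge_list \<alpha>s vs + wedge_list \<gamma>s vs)" "F = (\<lambda>vs. wedge_list \<gamma>s vs + wedge_list \<alpha>s vs)"
    using F(2) \<alpha>s(3) \<gamma>s(3) by (auto simp: add.commute)
  have orth': "\<forall>\<alpha>\<in>set \<gamma>s. \<forall>\<gamma>\<in>set \<alpha>s. g (sharp g \<alpha>) (sharp g \<gamma>) = 0"
    using orth sym by metis
  have "simple_bracket g \<alpha> \<beta> F vs = 0" if "(\<alpha>, \<beta>) \<in> set (D1 @ D2)" for \<alpha> \<beta> vs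
    using that D1(2) D2(2)
      simple_bracket_factors[OF fd g \<alpha>s(2) \<gamma>s(2) F(1) F_alt(1) orth]
      simple_bracket_factors[OF fd g \<gamma>s(2) \<alpha>s(2) F(1) F_alt(2) orth'] by fastforce
  then have "map (\<lambda>(\<alpha>, \<beta>). simple_bracket g \<alpha> \<beta> F vs) (D1 @ D2) = map (\<lambda>_. 0) (D1 @ D2)" for vs
    by (intro map_cong refl) auto
  then show ?thesis unfolding * by (simp only: sum_list_triv mult_zero_right)
qed

section \<open>Splitting a five-form\<close>

lemma alternating_form_killed:
  assumes "alternating_form p \<omega>" "\<And>us. \<omega> (k # us) = 0" "k \<in> set vs"
  shows "\<omega> vs = 0"
proof -
  obtain us ws where "vs = us @ k # ws" using assms(3) by (meson split_list)
  then show ?thesis using alternating_form_move_front[OF assms(1), of us k ws] assms(2) by simp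
qed

text \<open>A form whose degree is one less than the dimension has a kernel vector (\<open>n\<close> below), so it
  descends to a top-degree form on the quotient by \<open>n\<close>.\<close>

lemma simple_form_of_small_support:
  fixes \<Phi> :: "'a::real_vector list \<Rightarrow> real"
  assumes \<Phi>: "alternating_form (Suc q) \<Phi>" and span: "span (K \<union> U) = UNIV"
    and U: "finite U" "card U = Suc (Suc q)" and K: "\<And>k us. k \<in> K \<Longrightarrow> \<Phi> (k # us) = 0"
  obtains \<gamma>s where "length \<gamma>s = Suc q" "\<forall>\<gamma>\<in>set \<gamma>s. linear \<gamma>"
    "\<And>v. (\<And>us. \<Phi> (v # us) = 0) \<Longrightarrow> \<forall>\<gamma>\<in>set \<gamma>s. \<gamma> v = 0" "\<Phi> = wedge_list \<gamma>s"
proof (cases "\<Phi> = (\<lambda>_. 0)")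
  case True
  let ?Z = "replicate (Suc q) (\<lambda>_. 0) :: ('a \<Rightarrow> real) list"
  have "wedge_list ?Z = (\<lambda>_. 0)" by (auto simp: wedge_def)
  then show thesis using that[of ?Z] True by (simp add: linear_iff)
next
  case False
  then obtain xs where xs: "length xs = Suc q" "set xs \<subseteq> K \<union> U" "distinct xs" "\<Phi> xs \<noteq> 0"
    using alternating_form_eq_0[OF \<Phi> span] by blast
  have "K \<inter> set xs = {}" using alternating_form_killed[OF \<Phi> K] xs(4) by blast
  then have xsU: "set xs \<subseteq> U" using xs(2) by blast
  have "card (U - set xs) = 1"
    using xsU xs U by (simp add: card_Diff_subset distinct_card)
  then obtain y where y: "U - set xs = {y}" by (meson card_1_singletonE)
  define c where "c = \<Phi> xs"
  \<comment> \<open>By alternation these forms are the coframe dual to \<open>xs\<close>; they also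
    vanish on every vector that annihilates \<open>\<Phi>\<close>.\<close>
  define \<gamma> where "\<gamma> j v = \<Phi> (xs[j := v]) / c" for j v
  have c: "c \<noteq> 0" using xs by (simp add: c_def)
  have lin: "linear (\<gamma> j)" if "j < Suc q" for j
    using linear_compose_scale_right[OF alternating_form_linear[OF \<Phi> xs(1) that], of "1 / c"]
    by (simp add: \<gamma>_def[abs_def])
  have dual: "\<gamma> i (xs ! j) = (if i = j then 1 else 0)" if "i < Suc q" "j < Suc q" for i j
  proof (cases "i = j")
    case False
    then have "\<not> distinct (xs[i := xs ! j])"
      using that xs(1) nth_eq_iff_index_eq[of "xs[i := xs ! j]" i j] by auto
    then show ?thesis using False alternating_form_repeat[OF \<Phi>] by (simp add: \<gamma>_def)
  qed (use c in \<open>simp add: \<gamma>_def c_def\<close>)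
  have kill: "\<gamma> j v = 0" if "\<And>us. \<Phi> (v # us) = 0" "j < Suc q" for j v
    using alternating_form_killed[OF \<Phi> that(1), of "xs[j := v]"] that(2) xs(1)
    by (simp add: \<gamma>_def set_update_memI)
  \<comment> \<open>The kernel vector: by \<open>\<gamma>n\<close>, \<open>\<Phi>\<close> vanishes
    whenever \<open>n\<close> replaces an entry of \<open>xs\<close>.\<close>
  define n where "n = y - (\<Sum>j<Suc q. \<gamma> j y *\<^sub>R xs ! j)"
  have \<gamma>n: "\<gamma> j n = 0" if "j < Suc q" for j
  proof -
    have "\<gamma> j n = \<gamma> j y - (\<Sum>i<Suc q. \<gamma> i y * \<gamma> j (xs ! i))"
      unfolding n_def using lin[OF that]
      by (simp add: linear_diff linear_sum linear_scale del: sum.lessThan_Suc)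
    also have "(\<Sum>i<Suc q. \<gamma> i y * \<gamma> j (xs ! i)) = (\<Sum>i<Suc q. if i = j then \<gamma> j y else 0)"
      using that by (intro sum.cong) (auto simp: dual)
    also have "\<dots> = \<gamma> j y" using that by (simp del: sum.lessThan_Suc)
    finally show ?thesis by simp
  qed
  define \<Gamma> where "\<Gamma> = map \<gamma> [0..<Suc q]"
  have \<Gamma>: "set \<Gamma> = \<gamma> ` {..<Suc q}" "length \<Gamma> = Suc q"
    by (auto simp: \<Gamma>_def atLeast0LessThan simp del: upt_Suc)
  have \<Gamma>_alt: "alternating_form (Suc q) (wedge_list \<Gamma>)"
    using alternating_form_wedge_list[of \<Gamma>] lin \<Gamma> by simp
  have \<Gamma>_kill: "wedge_list \<Gamma> vs = 0" if "v \<in> set vs" "\<And>j. j < Suc q \<Longrightarrow> \<gamma> j v = 0" for v vs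
    using that by (intro alternating_form_killed[OF \<Gamma>_alt interior_product_wedge_list_eq_0]) (auto simp: \<Gamma>)
  define \<Delta> where "\<Delta> vs = \<Phi> vs - c * wedge_list \<Gamma> vs" for vs
  have \<Delta>_alt: "alternating_form (Suc q) \<Delta>"
    unfolding \<Delta>_def by (intro alternating_form_diff \<Phi> alternating_form_scale \<Gamma>_alt)
  have "span (K \<union> insert n (set xs)) = UNIV"
  proof -
    let ?V = "span (K \<union> insert n (set xs))"
    have "n + (\<Sum>j<Suc q. \<gamma> j y *\<^sub>R xs ! j) \<in> ?V"
      using xs(1) by (intro span_add span_sum span_scale span_base) auto
    then have "y \<in> ?V" by (simp add: n_def)
    moreover have "K \<union> U \<subseteq> insert y (K \<union> insert n (set xs))" using y by blast
    ultimately have "K \<union> U \<subseteq> ?V" by (meson insert_subset order_trans span_superset)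
    then have "span (K \<union> U) \<subseteq> ?V" by (intro span_minimal subspace_span)
    then show ?thesis using span by auto
  qed
  then have "\<Delta> = (\<lambda>_. 0)"
  proof (rule alternating_form_eq_0[OF \<Delta>_alt])
    fix vs assume vs: "length vs = Suc q" "set vs \<subseteq> K \<union> insert n (set xs)" "distinct vs"
    consider k where "k \<in> K" "k \<in> set vs" | "n \<in> set vs" "set vs \<subseteq> insert n (set xs)" | "set vs \<subseteq> set xs"
      using vs(2) by blast
    then show "\<Delta> vs = 0"
    proof cases
      case 1
      then show ?thesis
        using alternating_form_killed[OF \<Phi> K, of k vs] \<Gamma>_kill[of k vs] kill[OF K, of k]
        by (simp add: \<Delta>_def)
    next
      case 2
      \<comment> \<open>A list of this length from \<open>n\<close> and \<open>xs\<close> that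
        contains \<open>n\<close> misses exactly one entry of \<open>xs\<close>, so up to order it
        is \<open>xs\<close> with that entry replaced by \<open>n\<close>.\<close>
      then obtain us ws where split: "vs = us @ n # ws" by (meson split_list)
      have "set (us @ ws) \<subseteq> set xs" "distinct (us @ ws)" "length (us @ ws) = q"
        using 2 vs by (auto simp: split)
      then have "card (set xs - set (us @ ws)) = 1"
        using xs by (subst card_Diff_subset) (simp_all add: distinct_card del: set_append)
      then obtain x where x: "set xs - set (us @ ws) = {x}" by (meson card_1_singletonE)
      then obtain j where j: "j < Suc q" "x = xs ! j" using xs(1) by (metis Diff_iff in_set_conv_nth singletonI)
      have "set (us @ ws) = set (remove1 x xs)"
        using x \<open>set (us @ ws) \<subseteq> set xs\<close> xs(3) by auto
      then have "mset (us @ ws) = mset (remove1 x xs)"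
        using \<open>distinct (us @ ws)\<close> xs(3) by (metis distinct_remove1 set_eq_iff_mset_eq_distinct)
      then have "mset vs = mset (xs[j := n])"
        using j xs(1) by (simp add: split mset_update)
      then have "\<bar>\<Phi> vs\<bar> = \<bar>\<Phi> (xs[j := n])\<bar>" by (rule alternating_form_perm[OF \<Phi>])
      also have "\<Phi> (xs[j := n]) = c * \<gamma> j n" using c by (simp add: \<gamma>_def)
      finally show ?thesis using \<gamma>n j(1) \<Gamma>_kill[OF 2(1)] by (simp add: \<Delta>_def)
    next
      case 3
      then have "set vs = set xs"
        using vs xs by (metis List.finite_set card_subset_eq distinct_card)
      then have "mset vs = mset xs" using vs(3) xs(3) by (simp add: set_eq_iff_mset_eq_distinct)
      then have "\<bar>\<Delta> vs\<bar> = \<bar>\<Delta> xs\<bar>" by (rule alternating_form_perm[OF \<Delta>_alt])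
      moreover have "wedge_list \<Gamma> xs = 1"
        using dual xs(1) by (intro wedge_list_dual) (auto simp: \<Gamma>_def simp del: upt_Suc)
      ultimately show ?thesis by (simp add: \<Delta>_def c_def)
    qed
  qed
  then have \<Phi>_eq: "\<Phi> vs = c * wedge_list \<Gamma> vs" for vs
    by (simp add: \<Delta>_def fun_eq_iff)
  \<comment> \<open>A simple form carries no separate coefficient, so \<open>c\<close> is absorbed
    into the first factor.\<close>
  obtain \<gamma>0 \<Gamma>' where \<Gamma>': "\<Gamma> = \<gamma>0 # \<Gamma>'" using \<Gamma>(2) by (cases \<Gamma>) auto
  define \<gamma>s where "\<gamma>s = (\<lambda>v. c * \<gamma>0 v) # \<Gamma>'"
  have "\<forall>\<gamma>\<in>set \<Gamma>. linear \<gamma>" using lin \<Gamma>(1) by auto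
  then have "\<forall>\<gamma>\<in>set \<gamma>s. linear \<gamma>"
    using linear_compose_scale_right[of \<gamma>0 c] by (simp add: \<gamma>s_def \<Gamma>')
  moreover have "\<forall>\<gamma>\<in>set \<gamma>s. \<gamma> v = 0" if "\<And>us. \<Phi> (v # us) = 0" for v
  proof -
    have "\<forall>\<gamma>\<in>set \<Gamma>. \<gamma> v = 0" using kill[OF that] \<Gamma>(1) by auto
    then show ?thesis by (simp add: \<gamma>s_def \<Gamma>')
  qed
  moreover have "\<Phi> = wedge_list \<gamma>s"
    by (rule ext) (simp add: \<Phi>_eq \<gamma>s_def \<Gamma>' wedge_def sum_distrib_left algebra_simps)
  ultimately show thesis using that[of \<gamma>s] \<Gamma>(2) by (simp add: \<gamma>s_def \<Gamma>')
qed

text \<open>With \<open>F1\<close> the product of \<open>h\<close> and the duals of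
  \<open>E\<close>, the remainder \<open>F2\<close> is annihilated by \<open>E\<close> and by the
  vector \<open>H\<close> dual to \<open>h\<close>. The former makes \<open>F2\<close> simple; both
  together make the planes orthogonal.\<close>

lemma orthogonal_sum_of_splitting:
  fixes g :: "'a::real_vector \<Rightarrow> 'a \<Rightarrow> real"
  assumes fd: "dim (UNIV :: 'a set) > 0" and g: "inner_product g" and F: "alternating_form 5 F"
    and flat: "\<And>X Y Z vs. (\<Sum>i<length vs. F (vs[i := sharp g (\<lambda>w. F [X, Y, Z, vs ! i, w])])) = 0"
    and E: "E = {e1, e2, e3, e4}" "distinct [e1, e2, e3, e4]"
    and U: "finite U" "card U = 6" "u0 \<in> U" "E \<inter> U = {}" "span (E \<union> U) = UNIV"
    and orth: "\<And>e w. e \<in> E \<Longrightarrow> w \<in> E \<union> U \<Longrightarrow> g e w = (if e = w then 1 else 0)"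
    and nz: "F [u0, e1, e2, e3, e4] \<noteq> 0"
    and vanish: "\<And>a b u w. a \<in> E \<Longrightarrow> b \<in> E \<Longrightarrow> u \<in> U \<Longrightarrow> F [u0, a, b, u, w] = 0"
  shows "\<exists>F\<^sub>1 F\<^sub>2. simple_form 5 F\<^sub>1 \<and> simple_form 5 F\<^sub>2 \<and> orthogonal_simple g 5 F\<^sub>1 F\<^sub>2 \<and>
    F = (\<lambda>vs. F\<^sub>1 vs + F\<^sub>2 vs)"
proof -
  have bl: "bilinear g" and sym: "\<And>x y. g x y = g y x" using g by (auto simp: inner_product_def)
  have ling: "linear (g x)" for x using bl by (simp add: bilinear_def)
  have sharp_0: "sharp g (\<lambda>_. 0) = 0"
    by (rule sharp_eqI[OF g]) (simp add: bilinear_lzero[OF bl])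
  have sharp_basis: "sharp g \<alpha> = v" if "linear \<alpha>" "\<And>w. w \<in> E \<union> U \<Longrightarrow> g v w = \<alpha> w" for \<alpha> v
    using linear_eq_on_span[OF ling that(1), of "E \<union> U" v] that(2) U(5) by (intro sharp_eqI[OF g]) simp
  have repeat: "F vs = 0" if "\<not> distinct vs" for vs
    using alternating_form_repeat[OF F that] .
  have F4: "alternating_form 4 (interior_product v F)" for v
    using F by (intro alternating_form_interior_product) simp
  have linF: "linear (\<lambda>w. F [x, y, z, v, w])" for x y z v
    using alternating_form_linear[OF F, of "[x, y, z, v, v]" 4] by simp
  have linF_upd: "F (vs[i := 0]) = 0" if "i < length vs" for vs i
  proof (cases "length vs = 5")
    case True
    then show ?thesis using linear_0[OF alternating_form_linear[OF F True]] that by simp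
  qed (use F in \<open>simp add: alternating_form_length\<close>)
  have swap45: "F [x, y, z, w, v] = - F [x, y, z, v, w]" for x y z v w
    using alternating_form_move_front[OF F, of "[x, y, z]" w "[v]"]
      alternating_form_move_front[OF F, of "[x, y, z, v]" w "[]"] by simp
  text \<open>Contracting with \<open>u0\<close> and two of the \<open>e\<close>'s gives the rotation in the plane of the
    remaining two.\<close>
  have rotate: "F (a # ws) = 0"
    if ab: "a \<in> E" "b \<in> E" "a \<noteq> b" and ws: "length ws = 4" "set ws \<subseteq> (E - {a, b}) \<union> U" for a b ws
  proof -
    have "card (E - {a, b}) = 2" using ab E by (simp add: card_Diff_subset)
    then obtain c d where cd: "E - {a, b} = {c, d}" "c \<noteq> d" by (meson card_2_iff)
    then have E_eq: "E = {c, d, a, b}" using ab by blast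
    have dist: "distinct [c, d, a, b]" using cd ab by auto
    have "set [u0, c, d, a, b] = set [u0, e1, e2, e3, e4]" by (simp flip: E(1) E_eq)
    moreover have "u0 \<notin> {c, d, a, b}" "u0 \<notin> {e1, e2, e3, e4}"
      using U(3,4) by (auto simp flip: E(1) E_eq)
    then have "distinct [u0, c, d, a, b]" "distinct [u0, e1, e2, e3, e4]" using dist E(2) by auto
    ultimately have "mset [u0, c, d, a, b] = mset [u0, e1, e2, e3, e4]"
      using set_eq_iff_mset_eq_distinct by blast
    then have nz': "F [u0, c, d, a, b] \<noteq> 0"
      using alternating_form_perm[OF F, of "[u0, c, d, a, b]" "[u0, e1, e2, e3, e4]"] nz by auto
    let ?A = "\<lambda>x. sharp g (\<lambda>w. F [u0, c, d, x, w])"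
    \<comment> \<open>Of the spanning vectors only \<open>a\<close> can contribute: the other
      members of \<open>E\<close> repeat an argument, and members of \<open>U\<close> are covered by
      \<open>vanish\<close>.\<close>
    have Ab: "?A b = - F [u0, c, d, a, b] *\<^sub>R a"
    proof (rule sharp_basis[OF linF])
      fix w assume w: "w \<in> E \<union> U"
      show "g (- F [u0, c, d, a, b] *\<^sub>R a) w = F [u0, c, d, b, w]"
      proof (cases "w = a")
        case True
        then show ?thesis using orth[of a a] ab swap45[of u0 c d b a] by (simp add: bilinear_lmul[OF bl] bilinear_lneg[OF bl])
      next
        case False
        then have "F [u0, c, d, b, w] = 0"
          using w E_eq repeat[of "[u0, c, d, b, w]"] vanish[of c d w b] swap45[of u0 c d b w] by auto
        then show ?thesis using orth[of a w] ab w False by (simp add: bilinear_lmul[OF bl] bilinear_lneg[OF bl])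
      qed
    qed
    have A0: "?A x = 0" if "x \<in> set ws" for x
    proof -
      have "x \<in> {c, d} \<union> U" using that ws(2) cd by blast
      then have "F [u0, c, d, x, w] = 0" for w
        using repeat[of "[u0, c, d, x, w]"] vanish[of c d x w] E_eq by auto
      then show ?thesis using sharp_0 by simp
    qed
    \<comment> \<open>In the derivation formula on \<open>b # ws\<close> every entry of
      \<open>ws\<close> is sent to zero, so only a multiple of \<open>F (a # ws)\<close>
      remains.\<close>
    have "0 = (\<Sum>i<length (b # ws). F ((b # ws)[i := ?A ((b # ws) ! i)]))" by (rule flat[symmetric])
    also have "\<dots> = F (?A b # ws) + (\<Sum>i<length ws. F ((b # ws)[Suc i := ?A (ws ! i)]))"
      by (simp add: sum.lessThan_Suc_shift del: sum.lessThan_Suc)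
    also have "(\<Sum>i<length ws. F ((b # ws)[Suc i := ?A (ws ! i)])) = 0"
      using linF_upd[of "Suc _" "b # ws"] A0 by (intro sum.neutral) auto
    also have "F (?A b # ws) = - F [u0, c, d, a, b] * F (a # ws)"
      by (simp only: Ab linear_scale[OF alternating_form_linear_first[OF F]] real_scaleR_def)
    finally show ?thesis using nz' by simp
  qed
  \<comment> \<open>A list with some but not all of \<open>E\<close> is killed by the rotation that
    takes a missing \<open>b\<close> to a present \<open>a\<close>.\<close>
  have partial: "F vs = 0" if vs: "length vs = 5" "set vs \<subseteq> E \<union> U" "a \<in> E" "a \<in> set vs" "b \<in> E" "b \<notin> set vs"
    for vs a b
  proof (cases "distinct vs")
    case True
    obtain us ws where split: "vs = us @ a # ws" using vs(4) by (meson split_list)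
    have "F (a # us @ ws) = 0"
      using vs True by (intro rotate[of a b]) (auto simp: split)
    then show ?thesis by (simp add: split alternating_form_move_front[OF F])
  qed (rule repeat)
  \<comment> \<open>On the spanning vectors, the components of \<open>F\<close> that meet
    \<open>E\<close> contain all of it; \<open>h\<close> records them.\<close>
  define h where "h v = F [v, e1, e2, e3, e4]" for v
  have linh: "linear h"
    using alternating_form_linear_first[OF F] by (simp add: h_def[abs_def])
  define \<alpha>s where "\<alpha>s = [h, g e1, g e2, g e3, g e4]"
  have lin\<alpha>: "\<forall>\<alpha>\<in>set \<alpha>s. linear \<alpha>" using linh ling by (simp add: \<alpha>s_def)
  have len: "length \<alpha>s = 5" by (simp add: \<alpha>s_def)
  define F1 where "F1 = wedge_list \<alpha>s"
  have F1_alt: "alternating_form 5 F1"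
    using alternating_form_wedge_list[OF lin\<alpha>] by (simp add: F1_def \<alpha>s_def eval_nat_numeral)
  have F1_0: "F1 vs = 0" if "e \<in> E" "\<And>v. v \<in> set vs \<Longrightarrow> g e v = 0" for e vs
    unfolding F1_def using that by (intro wedge_list_eq_0[of "g e"]) (auto simp: \<alpha>s_def E(1))
  define F2 where "F2 vs = F vs - F1 vs" for vs
  have F2_alt: "alternating_form 5 F2"
    unfolding F2_def by (intro alternating_form_diff F F1_alt)
  have F2_int: "alternating_form 4 (interior_product v F2)" for v
    using F2_alt by (intro alternating_form_interior_product) simp
  have F2_E: "F2 (e # us) = 0" if e: "e \<in> E" for e us
  proof -
    have "interior_product e F2 = (\<lambda>_. 0)"
    proof (rule alternating_form_eq_0[OF F2_int U(5)])
      fix vs assume vs: "length vs = 4" "set vs \<subseteq> E \<union> U" "distinct vs"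
      show "interior_product e F2 vs = 0"
      proof (cases "distinct (e # vs)")
        case False
        then show ?thesis using alternating_form_repeat[OF F2_alt] by (simp add: interior_product_def)
      next
        case dist: True
        \<comment> \<open>If a member of \<open>E\<close> is missing, \<open>F\<close> and
          \<open>F1\<close> both vanish. Otherwise the list consists of \<open>E\<close> and one
          vector of \<open>U\<close>, where \<open>F1\<close> agrees with \<open>F\<close> by the
          choice of \<open>h\<close>.\<close>
        show ?thesis
        proof (cases "E \<subseteq> set (e # vs)")
          case False
          then obtain b where b: "b \<in> E" "b \<notin> set (e # vs)" by blast
          have "F (e # vs) = 0" using partial[of "e # vs" e b] vs e b by simp
          moreover have "F1 (e # vs) = 0" using F1_0[OF b(1)] orth[OF b(1)] b vs e by (metis UnI1 list.set_intros set_ConsD subsetD)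
          ultimately show ?thesis by (simp add: interior_product_def F2_def)
        next
          case True
          have "card E = 4" using E by simp
          then have "card (set (e # vs) - E) = 1"
            using True dist vs by (subst card_Diff_subset) (auto simp: E(1) distinct_card)
          then obtain y where y: "set (e # vs) - E = {y}" by (meson card_1_singletonE)
          then have yU: "y \<in> U" using vs e by auto
          have "set (e # vs) = set [y, e1, e2, e3, e4]" using y True E(1) by auto
          moreover have "distinct [y, e1, e2, e3, e4]" using yU U(4) E by auto
          ultimately have "mset (e # vs) = mset [y, e1, e2, e3, e4]"
            using dist set_eq_iff_mset_eq_distinct by blast
          then have "\<bar>F2 (e # vs)\<bar> = \<bar>F2 [y, e1, e2, e3, e4]\<bar>" by (rule alternating_form_perm[OF F2_alt])
          also have "F1 [y, e1, e2, e3, e4] = h y"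
          proof -
            have "wedge_list [g e1, g e2, g e3, g e4] [e1, e2, e3, e4] = 1"
            proof (rule wedge_list_dual)
              fix i j assume ij: "i < length [e1, e2, e3, e4]" "j < length [e1, e2, e3, e4]"
              then have "[e1, e2, e3, e4] ! i \<in> E" "[e1, e2, e3, e4] ! j \<in> E \<union> U"
                using nth_mem[OF ij(1)] nth_mem[OF ij(2)] unfolding E(1) by auto
              from orth[OF this] show "([g e1, g e2, g e3, g e4] ! i) ([e1, e2, e3, e4] ! j) = (if i = j then 1 else 0)"
                using nth_eq_iff_index_eq[OF E(2) ij] nth_map[OF ij(1), of g] by simp
            qed simp
            moreover have "interior_product y (wedge_list [g e1, g e2, g e3, g e4]) = (\<lambda>_. 0)"
              unfolding interior_product_def
              by (intro ext interior_product_wedge_list_eq_0) (use orth yU E U(4) in auto)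
            ultimately show ?thesis
              unfolding F1_def \<alpha>s_def wedge_list_Cons[of h] wedge_Cons[of h _ y]
              by (simp add: wedge_zero del: wedge_list_Cons)
          qed
          then have "F2 [y, e1, e2, e3, e4] = 0" by (simp add: F2_def h_def)
          finally show ?thesis by (simp add: interior_product_def)
        qed
      qed
    qed
    then show ?thesis by (simp add: interior_product_def fun_eq_iff)
  qed
  \<comment> \<open>\<open>F2\<close> has degree five and lives on the six vectors of
    \<open>U\<close>, one more than its degree, so it is simple.\<close>
  obtain \<gamma>s where \<gamma>s: "length \<gamma>s = 5" "\<forall>\<gamma>\<in>set \<gamma>s. linear \<gamma>"
    "\<And>v. (\<And>us. F2 (v # us) = 0) \<Longrightarrow> \<forall>\<gamma>\<in>set \<gamma>s. \<gamma> v = 0" "F2 = wedge_list \<gamma>s"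
    using simple_form_of_small_support[of 4 F2 E U] F2_alt F2_E U by auto
  define H where "H = sharp g h"
  have gH: "g H w = h w" for w unfolding H_def using sharp_works[OF fd g linh] .
  have h_E: "h e = 0" if "e \<in> E" for e using that repeat by (auto simp: h_def E(1))
  have F2_H: "F2 (H # us) = 0" for us
  proof -
    have "interior_product H F2 = (\<lambda>_. 0)"
    proof (rule alternating_form_eq_0[OF F2_int U(5)])
      fix vs assume vs: "length vs = 4" "set vs \<subseteq> E \<union> U" "distinct vs"
      show "interior_product H F2 vs = 0"
      proof (cases "set vs \<subseteq> U")
        case False
        then obtain e where "e \<in> E" "e \<in> set (H # vs)" using vs by auto
        then show ?thesis
          using alternating_form_killed[OF F2_alt F2_E] by (simp add: interior_product_def)
      next
        case True
        have e1: "e1 \<in> E" and e4: "e4 \<in> E" and "e1 \<noteq> e4" using E by auto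
        \<comment> \<open>The factor \<open>g e1\<close> vanishes on \<open>U\<close> and also on
          \<open>H\<close>, since \<open>g e1 H = h e1\<close> and \<open>h\<close> repeats an
          argument there.\<close>
        have "F1 (H # vs) = 0"
        proof (rule F1_0[OF e1])
          fix v assume "v \<in> set (H # vs)"
          then consider "v = H" | "v \<in> U" "e1 \<noteq> v" using True U(4) e1 by auto
          then show "g e1 v = 0"
            using orth[OF e1, of v] gH[of e1] h_E[OF e1] sym[of e1 H] by cases auto
        qed
        moreover have "F (H # vs) = 0"
        proof -
          \<comment> \<open>Contraction with \<open>e1\<close>, \<open>e2\<close>, \<open>e3\<close>
            sends \<open>e4\<close> to \<open>H\<close> and \<open>U\<close> into the line of
            \<open>e4\<close>. In the derivation formula on \<open>e4 # vs\<close> all terms but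
            \<open>F (H # vs)\<close> repeat \<open>e4\<close>.\<close>
          let ?A = "\<lambda>x. sharp g (\<lambda>w. F [e1, e2, e3, x, w])"
          have "F [e1, e2, e3, e4, w] = h w" for w
            using alternating_form_move_front[OF F, of "[e1, e2, e3, e4]" w "[]"] by (simp add: h_def)
          then have A4: "?A e4 = H" by (simp add: H_def)
          have AU: "?A u = F [e1, e2, e3, u, e4] *\<^sub>R e4" if "u \<in> U" for u
          proof (rule sharp_basis[OF linF])
            fix w assume w: "w \<in> E \<union> U"
            show "g (F [e1, e2, e3, u, e4] *\<^sub>R e4) w = F [e1, e2, e3, u, w]"
            proof (cases "w = e4")
              case True
              then show ?thesis using orth[of e4 e4] e4 by (simp add: bilinear_lmul[OF bl] bilinear_lneg[OF bl])
            next
              case False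
              have "F [e1, e2, e3, u, w] = 0"
              proof (cases "w \<in> E")
                case True
                then show ?thesis using False repeat[of "[e1, e2, e3, u, w]"] E by auto
              next
                case wE: False
                show ?thesis
                  using partial[of "[e1, e2, e3, u, w]" e1 e4] E w that False U(4) by auto
              qed
              then show ?thesis using orth[OF e4 w] False by (simp add: bilinear_lmul[OF bl] bilinear_lneg[OF bl])
            qed
          qed
          have "0 = (\<Sum>i<length (e4 # vs). F ((e4 # vs)[i := ?A ((e4 # vs) ! i)]))" by (rule flat[symmetric])
          also have "\<dots> = F (?A e4 # vs) + (\<Sum>i<length vs. F ((e4 # vs)[Suc i := ?A (vs ! i)]))"
            by (simp add: sum.lessThan_Suc_shift del: sum.lessThan_Suc)
          also have "(\<Sum>i<length vs. F ((e4 # vs)[Suc i := ?A (vs ! i)])) = 0"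
          proof (rule sum.neutral, rule ballI)
            fix i assume "i \<in> {..<length vs}"
            then have i: "i < length vs" "vs ! i \<in> U" using True by auto
            have "F ((e4 # vs)[Suc i := c *\<^sub>R e4]) = c * F ((e4 # vs)[Suc i := e4])" for c
              using linear_scale[OF alternating_form_linear[OF F, of "e4 # vs" "Suc i"]] vs i by simp
            moreover have "F ((e4 # vs)[Suc i := e4]) = 0"
              using i by (intro repeat) (simp add: set_update_memI)
            ultimately show "F ((e4 # vs)[Suc i := ?A (vs ! i)]) = 0" unfolding AU[OF i(2)] by simp
          qed
          finally show ?thesis by (simp add: A4)
        qed
        ultimately show ?thesis by (simp add: interior_product_def F2_def)
      qed
    qed
    then show ?thesis by (simp add: interior_product_def fun_eq_iff)
  qed
  have sharp_ge: "sharp g (g e) = e" for e by (rule sharp_eqI[OF g]) simp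
  have gens: "g x y = 0" if xy: "x \<in> sharp g ` set \<alpha>s" "y \<in> sharp g ` set \<gamma>s" for x y
  proof -
    obtain \<gamma> where \<gamma>: "\<gamma> \<in> set \<gamma>s" "y = sharp g \<gamma>" using xy(2) by blast
    have "x = H \<or> x \<in> E" using xy(1) by (auto simp: \<alpha>s_def sharp_ge H_def E(1))
    \<comment> \<open>The factors of \<open>F2\<close> vanish on every vector that annihilates
      \<open>F2\<close>; the value of a factor at \<open>x\<close> is the inner product of
      \<open>x\<close> with its dual.\<close>
    then have "\<gamma> x = 0" using \<gamma>s(3)[of x] F2_H F2_E \<gamma>(1) by blast
    then show ?thesis using sharp_works[OF fd g, of \<gamma> x] \<gamma>s(2) \<gamma> sym by simp
  qed
  have "orthogonal_simple g 5 F1 F2"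
  proof (cases "F1 = (\<lambda>_. 0) \<or> F2 = (\<lambda>_. 0)")
    case False
    then have "plane g 5 F1 = span (sharp g ` set \<alpha>s)" "plane g 5 F2 = span (sharp g ` set \<gamma>s)"
      using plane_wedge_list[OF fd g lin\<alpha>] plane_wedge_list[OF fd g \<gamma>s(2)]
      unfolding len \<gamma>s(1) F1_def \<gamma>s(4) by blast+
    moreover have "g x y = 0" if x: "x \<in> span (sharp g ` set \<alpha>s)" and y: "y \<in> span (sharp g ` set \<gamma>s)" for x y
    proof -
      have "g z y = 0" if "z \<in> sharp g ` set \<alpha>s" for z
        using linear_eq_0_on_span[OF ling _ y] gens that by blast
      then have "g y z = 0" if "z \<in> sharp g ` set \<alpha>s" for z using sym that by metis
      then show ?thesis using linear_eq_0_on_span[OF ling _ x] sym by metis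
    qed
    ultimately show ?thesis by (simp add: orthogonal_simple_def)
  qed (auto simp: orthogonal_simple_def)
  moreover have "simple_form 5 F1" unfolding simple_form_def F1_def
    using lin\<alpha> by (intro exI[of _ \<alpha>s]) (simp add: \<alpha>s_def)
  moreover have "simple_form 5 F2" unfolding simple_form_def using \<gamma>s by blast
  moreover have "F = (\<lambda>vs. F1 vs + F2 vs)" by (simp add: F2_def)
  ultimately show ?thesis by blast
qed

section \<open>Orthonormal bases\<close>

text \<open>One notion for both signatures: \<open>\<epsilon>\<close> is the sign of the vector with
  index 0, and the vectors of positive index always span a positive definite space.\<close>

definition pseudo_orthonormal_basis :: "('a::real_vector \<Rightarrow> 'a \<Rightarrow> real) \<Rightarrow> nat \<Rightarrow> real \<Rightarrow> (nat \<Rightarrow> 'a) \<Rightarrow> bool" where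
  "pseudo_orthonormal_basis g n \<epsilon> e \<longleftrightarrow> \<epsilon>\<^sup>2 = 1 \<and> span (e ` {..<n}) = UNIV \<and>
     (\<forall>i<n. \<forall>j<n. g (e i) (e j) = (if i = j then if i = 0 then \<epsilon> else 1 else 0))"

text \<open>Gram-Schmidt: the component \<open>w\<close> of a vector outside the current span is
  nonzero, and positivity of \<open>g\<close> allows it to be normalised.\<close>

lemma euclidean_orthonormal_list:
  fixes g :: "'a::real_vector \<Rightarrow> 'a \<Rightarrow> real"
  assumes g: "inner_product g" "euclidean_product g" and k: "k \<le> dim (UNIV :: 'a set)"
  shows "\<exists>e :: nat \<Rightarrow> 'a. \<forall>i<k. \<forall>j<k. g (e i) (e j) = (if i = j then 1 else 0)"
  using k
proof (induction k)
  case (Suc k)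
  have bl: "bilinear g" and sym: "\<And>x y. g x y = g y x" using g by (auto simp: inner_product_def)
  have linl: "linear (\<lambda>x. g x y)" for y using bl by (simp add: bilinear_def)
  obtain e :: "nat \<Rightarrow> 'a" where e: "\<And>i j. i < k \<Longrightarrow> j < k \<Longrightarrow> g (e i) (e j) = (if i = j then 1 else 0)"
    using Suc by auto
  have "\<not> UNIV \<subseteq> span (e ` {..<k})"
  proof
    assume "UNIV \<subseteq> span (e ` {..<k})"
    then have "dim (UNIV :: 'a set) \<le> card (e ` {..<k})" by (intro dim_le_card) auto
    also have "\<dots> \<le> k" using card_image_le[of "{..<k}" e] by simp
    finally show False using Suc.prems by simp
  qed
  then obtain v where v: "v \<notin> span (e ` {..<k})" by auto
  define w where "w = v - (\<Sum>i<k. g v (e i) *\<^sub>R e i)"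
  have "w \<noteq> 0"
  proof
    assume "w = 0"
    then have "v = (\<Sum>i<k. g v (e i) *\<^sub>R e i)" by (simp add: w_def)
    moreover have "(\<Sum>i<k. g v (e i) *\<^sub>R e i) \<in> span (e ` {..<k})"
      by (intro span_sum span_scale span_base) auto
    ultimately show False using v by simp
  qed
  then have pos: "g w w > 0" using g(2) by (simp add: euclidean_product_def)
  have we: "g w (e j) = 0" if "j < k" for j
  proof -
    have "g w (e j) = g v (e j) - (\<Sum>i<k. g v (e i) * g (e i) (e j))"
      by (simp add: w_def linear_diff[OF linl] linear_sum[OF linl] linear_scale[OF linl])
    also have "(\<Sum>i<k. g v (e i) * g (e i) (e j)) = (\<Sum>i<k. if i = j then g v (e j) else 0)"
      using that by (intro sum.cong) (auto simp: e)
    finally show ?thesis using that by simp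
  qed
  define u where "u = (1 / sqrt (g w w)) *\<^sub>R w"
  have "g u u = 1"
    using pos by (simp add: u_def bilinear_lmul[OF bl] bilinear_rmul[OF bl])
  moreover have "g u (e j) = 0" "g (e j) u = 0" if "j < k" for j
    using we[OF that] sym[of "e j"] by (simp_all add: u_def bilinear_lmul[OF bl])
  ultimately show ?case
    using e by (intro exI[of _ "e(k := u)"]) (auto simp: less_Suc_eq)
qed auto

lemma orthogonal_independent:
  fixes g :: "'a::real_vector \<Rightarrow> 'a \<Rightarrow> real" and e :: "nat \<Rightarrow> 'a"
  assumes bl: "bilinear g"
    and "\<And>i. i < n \<Longrightarrow> g (e i) (e i) \<noteq> 0" "\<And>i j. i < n \<Longrightarrow> j < n \<Longrightarrow> i \<noteq> j \<Longrightarrow> g (e i) (e j) = 0"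
  shows "independent (e ` {..<n})" "inj_on e {..<n}"
proof -
  have linl: "linear (\<lambda>x. g x y)" for y using bl by (simp add: bilinear_def)
  show inj: "inj_on e {..<n}" using assms by (metis inj_onI lessThan_iff)
  show "independent (e ` {..<n})"
  proof
    assume "dependent (e ` {..<n})"
    then obtain u v where v: "v \<in> e ` {..<n}" "u v \<noteq> 0" and 0: "(\<Sum>v\<in>e ` {..<n}. u v *\<^sub>R v) = 0"
      using dependent_finite[OF finite_imageI[OF finite_lessThan], of e n] by blast
    obtain j where j: "j < n" "v = e j" using v by auto
    have "0 = g (\<Sum>i<n. u (e i) *\<^sub>R e i) (e j)"
      using 0 inj by (simp add: sum.reindex bilinear_lzero[OF bl])
    also have "\<dots> = (\<Sum>i<n. u (e i) * g (e i) (e j))"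
      by (simp add: linear_sum[OF linl] linear_scale[OF linl])
    also have "\<dots> = (\<Sum>i<n. if i = j then u (e j) * g (e j) (e j) else 0)"
      using j assms(3) by (intro sum.cong) auto
    finally show False using j v assms(2) by simp
  qed
qed

lemma ex_pseudo_orthonormal_basis:
  fixes g :: "'a::real_vector \<Rightarrow> 'a \<Rightarrow> real"
  assumes dim: "dim (UNIV :: 'a set) = n" "n > 0" and g: "inner_product g"
    and sig: "euclidean_product g \<or> lorentzian_product g"
  shows "\<exists>\<epsilon> e. pseudo_orthonormal_basis g n \<epsilon> e"
  using sig
proof
  have bl: "bilinear g" using g by (auto simp: inner_product_def)
  assume "euclidean_product g"
  then obtain e :: "nat \<Rightarrow> 'a" where e: "\<forall>i<n. \<forall>j<n. g (e i) (e j) = (if i = j then 1 else 0)"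
    using euclidean_orthonormal_list[OF g, of n] dim by auto
  then have ind: "independent (e ` {..<n})" "inj_on e {..<n}"
    using orthogonal_independent[OF bl, of n e] by auto
  obtain B :: "'a set" where B: "finite B" "independent B" "span B = UNIV"
    using finite_basis_ex[where 'a = 'a] dim by auto
  interpret V: finite_dimensional_vector_space "scaleR :: real \<Rightarrow> 'a \<Rightarrow> 'a" B
    by unfold_locales (use B in \<open>auto simp: dependent_raw_def span_raw_def\<close>)
  have "card (e ` {..<n}) = n" using ind(2) by (simp add: card_image)
  then have "UNIV \<subseteq> span (e ` {..<n})"
    using V.card_ge_dim_independent[of "e ` {..<n}" UNIV] ind dim
    by (simp add: dependent_raw_def span_raw_def dim_raw_def)
  then show ?thesis
    using e by (intro exI[of _ 1] exI[of _ e]) (auto simp: pseudo_orthonormal_basis_def)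
next
  assume "lorentzian_product g"
  then obtain T S where TS: "finite T" "finite S" "T \<inter> S = {}" "card T = 1" "card S = n - 1"
    "span (T \<union> S) = UNIV" "\<forall>x\<in>T \<union> S. \<forall>y\<in>T \<union> S. x \<noteq> y \<longrightarrow> g x y = 0"
    "\<forall>x\<in>T. g x x = -1" "\<forall>x\<in>S. g x x = 1"
    by (auto simp: lorentzian_product_def has_signature_def dim)
  obtain t where t: "T = {t}" using TS(4) by (meson card_1_singletonE)
  obtain f where f: "bij_betw f {0..<n - 1} S" using ex_bij_betw_nat_finite[OF TS(2)] TS(5) by auto
  \<comment> \<open>The timelike vector takes index 0.\<close>
  define e where "e = case_nat t f"
  have "{..<n} = insert 0 (Suc ` {0..<n - 1})" using dim(2) by (cases n) (simp_all add: lessThan_Suc_eq_insert_0 atLeast0LessThan)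
  then have "e ` {..<n} = insert t (f ` {0..<n - 1})"
    by (simp only: image_insert image_image e_def nat.case)
  then have "e ` {..<n} = T \<union> S" using f by (simp add: t bij_betw_def)
  moreover have "g (e i) (e j) = (if i = j then if i = 0 then -1 else 1 else 0)" if ij: "i < n" "j < n" for i j
  proof (cases i; cases j)
    fix k l assume kl: "i = Suc k" "j = Suc l"
    then have "f k \<in> S" "f l \<in> S" "f k = f l \<longleftrightarrow> k = l"
      using ij f by (auto simp: bij_betw_def inj_on_eq_iff)
    then show ?thesis using TS(7,9) kl by (auto simp: e_def)
  next
    fix k assume k: "i = 0" "j = Suc k"
    then have "f k \<in> S" using ij f by (auto simp: bij_betw_def)
    then show ?thesis using TS(3,7) k by (auto simp: e_def t)
  next
    fix k assume k: "i = Suc k" "j = 0"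
    then have "f k \<in> S" using ij f by (auto simp: bij_betw_def)
    then show ?thesis using TS(3,7) k by (auto simp: e_def t)
  qed (use TS(8) in \<open>simp add: e_def t\<close>)
  ultimately show ?thesis
    using TS(6) by (intro exI[of _ "-1"] exI[of _ e]) (auto simp: pseudo_orthonormal_basis_def)
qed

text \<open>Rotate or boost the basis, according to the signature, so that its first vector does not
  annihilate the form.\<close>

lemma ex_pseudo_orthonormal_basis_nonvanishing:
  fixes g :: "'a::real_vector \<Rightarrow> 'a \<Rightarrow> real"
  assumes g: "inner_product g" and e: "pseudo_orthonormal_basis g n \<epsilon> e" and n: "n > 0"
    and F: "alternating_form (Suc p) F" "F \<noteq> (\<lambda>_. 0)"
  shows "\<exists>e us. pseudo_orthonormal_basis g n \<epsilon> e \<and> F (e 0 # us) \<noteq> 0"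
proof (cases "\<exists>us. F (e 0 # us) \<noteq> 0")
  case False
  have bl: "bilinear g" using g by (auto simp: inner_product_def)
  have \<epsilon>: "\<epsilon>\<^sup>2 = 1" "\<epsilon> * \<epsilon> = 1" and span: "span (e ` {..<n}) = UNIV"
    and ee: "\<And>i j. i < n \<Longrightarrow> j < n \<Longrightarrow> g (e i) (e j) = (if i = j then if i = 0 then \<epsilon> else 1 else 0)"
    using e by (auto simp: pseudo_orthonormal_basis_def power2_eq_square)
  obtain vs where vs: "length vs = Suc p" "set vs \<subseteq> e ` {..<n}" "F vs \<noteq> 0"
    using alternating_form_eq_0[OF F(1) span] F(2) by blast
  then obtain k us where k: "k < n" "F (e k # us) \<noteq> 0"
    by (cases vs) auto
  have "k \<noteq> 0" using False k(2) by metis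
  \<comment> \<open>Rational values of cosine and sine, or of their hyperbolic analogues;
    \<open>c \<noteq> 0\<close> lets the new first vector detect \<open>F\<close>.\<close>
  obtain a c :: real where ac: "a\<^sup>2 + \<epsilon> * c\<^sup>2 = 1" "c \<noteq> 0"
  proof (cases "\<epsilon> = 1")
    case True
    then show thesis using that[of "3/5" "4/5"] by (simp add: power2_eq_square)
  next
    case False
    then have "\<epsilon> = -1" using \<epsilon> by (simp add: power2_eq_1_iff)
    then show thesis using that[of "5/4" "3/4"] by (simp add: power2_eq_square)
  qed
  \<comment> \<open>The coefficients at \<open>k\<close> make the new vector orthogonal to the new
    first one and of square 1, in both signatures at once.\<close>
  define e' where "e' = e(0 := a *\<^sub>R e 0 + c *\<^sub>R e k, k := (- \<epsilon> * c) *\<^sub>R e 0 + a *\<^sub>R e k)"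
  have e'0: "e' 0 = a *\<^sub>R e 0 + c *\<^sub>R e k" and e'k: "e' k = (- \<epsilon> * c) *\<^sub>R e 0 + a *\<^sub>R e k"
    and e'i: "\<And>i. i \<noteq> 0 \<Longrightarrow> i \<noteq> k \<Longrightarrow> e' i = e i"
    using \<open>k \<noteq> 0\<close> by (auto simp: e'_def)
  note bls = bilinear_ladd[OF bl] bilinear_radd[OF bl] bilinear_lmul[OF bl] bilinear_rmul[OF bl]
    bilinear_lneg[OF bl] bilinear_rneg[OF bl] bilinear_lsub[OF bl] bilinear_rsub[OF bl]
  have e'0_i: "g (e' 0) (e i) = (if i = 0 then a * \<epsilon> else if i = k then c else 0)"
    "g (e i) (e' 0) = (if i = 0 then a * \<epsilon> else if i = k then c else 0)"
    "g (e' k) (e i) = (if i = 0 then - c else if i = k then a else 0)"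
    "g (e i) (e' k) = (if i = 0 then - c else if i = k then a else 0)" if "i < n" for i
    using that k(1) n \<open>k \<noteq> 0\<close> \<epsilon> by (auto simp: e'0 e'k bls ee mult.assoc mult.left_commute)
  have expand: "g x (e' 0) = a * g x (e 0) + c * g x (e k)"
    "g x (e' k) = - \<epsilon> * c * g x (e 0) + a * g x (e k)" for x
    by (simp_all add: e'0 e'k bls)
  have "g (e' 0) (e' 0) = \<epsilon> * (a\<^sup>2 + \<epsilon> * c\<^sup>2)"
    unfolding expand using k(1) n \<open>k \<noteq> 0\<close> \<epsilon>(2)
    by (simp add: e'0_i power2_eq_square algebra_simps)
  then have 00: "g (e' 0) (e' 0) = \<epsilon>" by (simp add: ac)
  have "g (e' k) (e' k) = a\<^sup>2 + \<epsilon> * c\<^sup>2" "g (e' k) (e' 0) = 0" "g (e' 0) (e' k) = (1 - \<epsilon> * \<epsilon>) * (a * c)"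
    unfolding expand using k(1) n \<open>k \<noteq> 0\<close>
    by (simp_all add: e'0_i power2_eq_square algebra_simps)
  then have kk: "g (e' k) (e' k) = 1" "g (e' k) (e' 0) = 0" "g (e' 0) (e' k) = 0"
    by (simp_all add: ac \<epsilon>(2))
  have "g (e' i) (e' j) = (if i = j then if i = 0 then \<epsilon> else 1 else 0)" if "i < n" "j < n" for i j
  proof -
    consider "i = 0" | "i = k" | "i \<noteq> 0" "i \<noteq> k" by blast
    then show ?thesis
    proof cases
      case 1
      then show ?thesis using that(2) \<open>k \<noteq> 0\<close> 00 kk e'i[of j] e'0_i(1)[of j] by (cases "j = 0"; cases "j = k") auto
    next
      case 2
      then show ?thesis using that(2) \<open>k \<noteq> 0\<close> 00 kk e'i[of j] e'0_i(3)[of j] by (cases "j = 0"; cases "j = k") auto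
    next
      case 3
      then show ?thesis
        using that k(1) \<open>k \<noteq> 0\<close> e'i[of i] e'i[of j] e'0_i(2,4)[of i] ee[of i j] by (cases "j = 0"; cases "j = k") auto
    qed
  qed
  moreover have "span (e' ` {..<n}) = UNIV"
  proof -
    have mem: "e' i \<in> span (e' ` {..<n})" if "i < n" for i using that by (auto intro: span_base)
    have "a *\<^sub>R e' 0 - c *\<^sub>R e' k = (a\<^sup>2 + \<epsilon> * c\<^sup>2) *\<^sub>R e 0"
      by (simp add: e'0 e'k algebra_simps power2_eq_square)
    then have "e 0 \<in> span (e' ` {..<n})"
      using span_diff[OF span_scale[OF mem[OF n], of a] span_scale[OF mem[OF k(1)], of c]] ac by simp
    moreover have "(\<epsilon> * c) *\<^sub>R e' 0 + a *\<^sub>R e' k = (a\<^sup>2 + \<epsilon> * c\<^sup>2) *\<^sub>R e k"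
      by (simp add: e'0 e'k algebra_simps power2_eq_square)
    then have "e k \<in> span (e' ` {..<n})"
      using span_add[OF span_scale[OF mem[OF n], of "\<epsilon> * c"] span_scale[OF mem[OF k(1)], of a]] ac by simp
    ultimately have "e ` {..<n} \<subseteq> span (e' ` {..<n})"
      using mem e'i by (metis image_subsetI lessThan_iff)
    then show ?thesis using span span_minimal[OF _ subspace_span] by blast
  qed
  moreover have "F (e' 0 # us) \<noteq> 0"
    using False k(2) ac(2)
    by (simp add: e'0 linear_add[OF alternating_form_linear_first[OF F(1)]]
        linear_scale[OF alternating_form_linear_first[OF F(1)]])
  ultimately show ?thesis
    using \<epsilon> by (intro exI[of _ e'] exI[of _ us]) (simp add: pseudo_orthonormal_basis_def)
qed (use e in blast)

section \<open>The classification\<close>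

text \<open>The complement of \<open>e 0\<close> is identified isometrically with
  \<open>real ^ 9\<close>, where \<open>ex_orthonormal_splitting\<close> applies to the contraction
  of \<open>F\<close> with \<open>e 0\<close>; the resulting vectors are carried back by
  \<open>\<phi>\<close>.\<close>

lemma orthogonal_sum_of_flat:
  fixes g :: "'a::real_vector \<Rightarrow> 'a \<Rightarrow> real"
  assumes dim: "dim (UNIV :: 'a set) = 10" and g: "inner_product g"
    and sig: "euclidean_product g \<or> lorentzian_product g"
    and F: "alternating_form 5 F" "F \<noteq> (\<lambda>_. 0)"
    and flat: "\<And>X Y Z vs. (\<Sum>i<length vs. F (vs[i := sharp g (\<lambda>w. F [X, Y, Z, vs ! i, w])])) = 0"
  shows "\<exists>F\<^sub>1 F\<^sub>2. simple_form 5 F\<^sub>1 \<and> simple_form 5 F\<^sub>2 \<and> orthogonal_simple g 5 F\<^sub>1 F\<^sub>2 \<and>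
    F = (\<lambda>vs. F\<^sub>1 vs + F\<^sub>2 vs)"
proof -
  have bl: "bilinear g" and sym: "\<And>x y. g x y = g y x" using g by (auto simp: inner_product_def)
  have ling: "linear (g x)" "linear (\<lambda>x. g x y)" for x y using bl by (simp_all add: bilinear_def)
  have F': "alternating_form (Suc 4) F" using F(1) by simp
  have repeat: "F vs = 0" if "\<not> distinct vs" for vs
    using alternating_form_repeat[OF F(1) that] .
  obtain \<epsilon> e0 where e0: "pseudo_orthonormal_basis g 10 \<epsilon> e0"
    using ex_pseudo_orthonormal_basis[OF dim _ g sig] by auto
  obtain e us where e: "pseudo_orthonormal_basis g 10 \<epsilon> e" and us: "F (e 0 # us) \<noteq> 0"
    using ex_pseudo_orthonormal_basis_nonvanishing[OF g e0 _ F' F(2)] by auto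
  have \<epsilon>: "\<epsilon> \<noteq> 0" and span: "span (e ` {..<10}) = UNIV"
    and ee: "\<And>i j. i < 10 \<Longrightarrow> j < 10 \<Longrightarrow> g (e i) (e j) = (if i = j then if i = 0 then \<epsilon> else 1 else 0)"
    using e by (auto simp: pseudo_orthonormal_basis_def)
  obtain h :: "9 \<Rightarrow> nat" where h: "bij_betw h UNIV {1..<10}"
    using finite_same_card_bij[of "UNIV :: 9 set" "{1..<10::nat}"] by auto
  then have h_less [simp]: "h i \<noteq> 0" "h i < 10" for i
    using bij_betwE[OF h] by (auto simp: Suc_le_eq)
  have h_inj: "h i = h j \<longleftrightarrow> i = j" for i j using h by (auto simp: bij_betw_def inj_on_def)
  define \<phi> :: "real ^ 9 \<Rightarrow> 'a" where "\<phi> x = (\<Sum>i\<in>UNIV. (x $ i) *\<^sub>R e (h i))" for x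
  have lin\<phi>: "linear \<phi>"
    by (rule linearI) (simp_all add: \<phi>_def scaleR_add_left sum.distrib scaleR_sum_right)
  have \<phi>_axis: "\<phi> (axis i 1) = e (h i)" for i
  proof -
    have "\<phi> (axis i 1) = (\<Sum>j\<in>UNIV. if j = i then e (h j) else 0)"
      unfolding \<phi>_def by (intro sum.cong) (auto simp: axis_def)
    then show ?thesis by simp
  qed
  have e_range: "e j \<in> range \<phi>" if "0 < j" "j < 10" for j
  proof -
    have "j \<in> h ` UNIV" using h that by (auto simp: bij_betw_def)
    then show ?thesis using \<phi>_axis by (metis imageE rangeI)
  qed
  have basis: "v \<in> insert (e 0) (range \<phi>)" if "v \<in> e ` {..<10}" for v
    using that e_range by (metis (no_types, lifting) imageE insertCI lessThan_iff not_gr_zero)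
  have g_e0: "g (\<phi> x) (e 0) = 0" "g (e 0) (\<phi> x) = 0" for x
    by (simp_all add: \<phi>_def linear_sum[OF ling(2)] linear_sum[OF ling(1)]
        linear_scale[OF ling(2)] linear_scale[OF ling(1)] ee)
  have g\<phi>: "g (\<phi> x) (\<phi> y) = x \<bullet> y" for x y
  proof -
    have "g (\<phi> x) (\<phi> y) = (\<Sum>i\<in>UNIV. \<Sum>j\<in>UNIV. if j = i then x $ i * y $ i else 0)"
      unfolding \<phi>_def linear_sum[OF ling(2)] linear_sum[OF ling(1)] linear_scale[OF ling(2)]
        linear_scale[OF ling(1)] real_scaleR_def sum_distrib_left
      by (intro sum.cong refl) (auto simp: ee h_inj)
    then show ?thesis by (simp add: inner_vec_def)
  qed
  have eq_on_basis: "\<alpha> = \<beta>" if lin: "linear \<alpha>" "linear \<beta>" and eq: "\<alpha> (e 0) = \<beta> (e 0)" "\<And>x. \<alpha> (\<phi> x) = \<beta> (\<phi> x)"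
    for \<alpha> \<beta> :: "'a \<Rightarrow> real"
  proof
    fix v
    have "\<alpha> w = \<beta> w" if "w \<in> e ` {..<10}" for w using basis[OF that] eq by auto
    moreover have "v \<in> span (e ` {..<10})" unfolding span by (rule UNIV_I)
    ultimately show "\<alpha> v = \<beta> v" by (rule linear_eq_on_span[OF lin])
  qed
  define G where "G a b c d = F [e 0, \<phi> a, \<phi> b, \<phi> c, \<phi> d]" for a b c d
  have linF: "linear (\<lambda>x. F [x, b, c, d, v])" "linear (\<lambda>x. F [v, x, b, c, d])" "linear (\<lambda>x. F [v, b, x, c, d])"
    "linear (\<lambda>x. F [v, b, c, x, d])" "linear (\<lambda>x. F [v, b, c, d, x])" for v b c d
    using alternating_form_linear[OF F(1), of "[v, b, c, d, v]" 0] alternating_form_linear[OF F(1), of "[v, b, b, c, d]" 1]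
      alternating_form_linear[OF F(1), of "[v, b, c, c, d]" 2] alternating_form_linear[OF F(1), of "[v, b, c, c, d]" 3]
      alternating_form_linear[OF F(1), of "[v, b, c, d, d]" 4]
    by simp_all
  have linG1: "linear (\<lambda>x. G x b c d)" for b c d
    using linear_compose[OF lin\<phi> linF(2), of "e 0" "\<phi> b" "\<phi> c" "\<phi> d"] by (simp add: G_def o_def)
  have linG2: "linear (\<lambda>x. G b x c d)" for b c d
    using linear_compose[OF lin\<phi> linF(3), of "e 0" "\<phi> b" "\<phi> c" "\<phi> d"] by (simp add: G_def o_def)
  have linG3: "linear (\<lambda>x. G b c x d)" for b c d
    using linear_compose[OF lin\<phi> linF(4), of "e 0" "\<phi> b" "\<phi> c" "\<phi> d"] by (simp add: G_def o_def)
  have linG4: "linear (\<lambda>x. G b c d x)" for b c d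
    using linear_compose[OF lin\<phi> linF(5), of "e 0" "\<phi> b" "\<phi> c" "\<phi> d"] by (simp add: G_def o_def)
  have G: "alternating_quadrilinear G"
    by (rule alternating_quadrilinear.intro) (rule linG1 linG2 linG3 linG4 | simp add: G_def repeat)+
  define A where "A = alternating_quadrilinear.A G"
  have A: "A x y z \<bullet> w = G x y z w" for x y z w
    unfolding A_def by (rule alternating_quadrilinear.A_inner[OF G])
  \<comment> \<open>The dual vector has no component along \<open>e 0\<close>, because a second
    \<open>e 0\<close> makes \<open>F\<close> vanish; it therefore lies in the image of
    \<open>\<phi>\<close>.\<close>
  have sharp_A: "sharp g (\<lambda>w. F [e 0, \<phi> x, \<phi> y, \<phi> z, w]) = \<phi> (A x y z)" for x y z
  proof (rule sharp_eqI[OF g])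
    have "g (\<phi> (A x y z)) = (\<lambda>w. F [e 0, \<phi> x, \<phi> y, \<phi> z, w])"
      by (intro eq_on_basis ling linF) (simp_all add: g_e0 repeat g\<phi> A G_def)
    then show "g (\<phi> (A x y z)) w = F [e 0, \<phi> x, \<phi> y, \<phi> z, w]" for w by metis
  qed
  have sharp_0: "sharp g (\<lambda>w. F [e 0, \<phi> x, \<phi> y, e 0, w]) = 0" for x y
    by (rule sharp_eqI[OF g]) (simp add: repeat bilinear_lzero[OF bl])
  have derivation: "G (A x y a) b c d + G a (A x y b) c d + G a b (A x y c) d + G a b c (A x y d) = 0"
    for x y a b c d
  proof -
    let ?D = "\<lambda>v. sharp g (\<lambda>w. F [e 0, \<phi> x, \<phi> y, v, w])"
    have "(\<Sum>i<length vs. F (vs[i := ?D (vs ! i)])) = F [?D p, q, r, s, t] + F [p, ?D q, r, s, t]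
        + F [p, q, ?D r, s, t] + F [p, q, r, ?D s, t] + F [p, q, r, s, ?D t]"
      if "vs = [p, q, r, s, t]" for vs p q r s t
      by (simp add: that)
    \<comment> \<open>With \<open>e 0\<close> as first argument, its own term is zero by
      \<open>sharp_0\<close>, and the other four are the terms for \<open>G\<close>.\<close>
    from this[OF refl, of "e 0" "\<phi> a" "\<phi> b" "\<phi> c" "\<phi> d"] show ?thesis
      unfolding flat sharp_A sharp_0 G_def linear_0[OF linF(1)] by linarith
  qed
  have nz: "\<exists>a b c d. G a b c d \<noteq> 0"
  proof (rule ccontr)
    assume no: "\<nexists>a b c d. G a b c d \<noteq> 0"
    then have G0: "G a b c d = 0" for a b c d by blast
    have "interior_product (e 0) F = (\<lambda>_. 0)"
    proof (rule alternating_form_eq_0[OF alternating_form_interior_product[OF F'] span])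
      fix vs assume vs: "length vs = 4" "set vs \<subseteq> e ` {..<10}"
      then obtain p q r s where pqrs: "vs = [p, q, r, s]"
        by (auto simp: eval_nat_numeral length_Suc_conv)
      show "interior_product (e 0) F vs = 0"
      proof (cases "e 0 \<in> set vs")
        case False
        then have "v \<in> range \<phi>" if "v \<in> set vs" for v
          using basis[of v] vs(2) that by auto
        from this[of p] this[of q] this[of r] this[of s]
        obtain a b c d where "p = \<phi> a" "q = \<phi> b" "r = \<phi> c" "s = \<phi> d"
          unfolding pqrs by auto
        then show ?thesis using G0[of a b c d] by (simp add: pqrs interior_product_def G_def)
      qed (simp add: interior_product_def repeat)
    qed
    then show False using us by (simp add: interior_product_def fun_eq_iff)
  qed
  then obtain v1 v2 v3 v4 where nz: "G v1 v2 v3 v4 \<noteq> 0" by blast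
  obtain u1 u2 u3 u4 B where u: "distinct [u1, u2, u3, u4]" "{u1, u2, u3, u4} \<inter> B = {}"
    and B: "finite B" "card B + 4 = DIM(real ^ 9)"
    and orth: "\<forall>x\<in>{u1, u2, u3, u4} \<union> B. \<forall>y\<in>{u1, u2, u3, u4} \<union> B. x \<bullet> y = (if x = y then 1 else 0)"
    and span_u: "span ({u1, u2, u3, u4} \<union> B) = UNIV"
    and Gu: "G u1 u2 u3 u4 \<noteq> 0"
    and van: "\<forall>a\<in>{u1, u2, u3, u4}. \<forall>b\<in>{u1, u2, u3, u4}. \<forall>c\<in>B. \<forall>w. G a b c w = 0"
    by (rule ex_orthonormal_splitting[OF G A derivation nz]) (rule that)
  have inj: "inj \<phi>"
  proof (rule injI)
    fix x y assume "\<phi> x = \<phi> y"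
    then have "\<phi> (x - y) = 0" by (simp add: linear_diff[OF lin\<phi>])
    then have "(x - y) \<bullet> (x - y) = 0" using g\<phi>[of "x - y" "x - y"] by (simp add: bilinear_lzero[OF bl])
    then show "x = y" by simp
  qed
  have e0_range: "e 0 \<notin> range \<phi>"
  proof
    assume "e 0 \<in> range \<phi>"
    then have "g (e 0) (e 0) = 0" using g_e0(1) by (metis imageE)
    then show False using ee[of 0 0] \<epsilon> by simp
  qed
  let ?E = "\<phi> ` {u1, u2, u3, u4}" and ?U = "insert (e 0) (\<phi> ` B)"
  \<comment> \<open>\<open>B\<close> has 9 - 4 = 5 elements, and \<open>e 0\<close> is the
    sixth.\<close>
  have card: "card ?U = 6"
    using B e0_range inj by (auto simp: card_insert_if card_image inj_on_subset)
  have "e ` {..<10} \<subseteq> span (?E \<union> ?U)"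
  proof
    fix v assume "v \<in> e ` {..<10}"
    then have "v = e 0 \<or> v \<in> \<phi> ` span ({u1, u2, u3, u4} \<union> B)" using basis span_u by auto
    moreover have "\<phi> ` span ({u1, u2, u3, u4} \<union> B) \<subseteq> span (?E \<union> ?U)"
      unfolding linear_span_image[OF lin\<phi>, symmetric] by (intro span_mono) auto
    ultimately show "v \<in> span (?E \<union> ?U)" by (auto intro: span_base)
  qed
  then have span_U: "span (?E \<union> ?U) = UNIV"
    using span span_minimal[OF _ subspace_span] by blast
  show ?thesis
  proof (rule orthogonal_sum_of_splitting[OF _ g F(1) flat, of ?E "\<phi> u1" "\<phi> u2" "\<phi> u3" "\<phi> u4" ?U "e 0"])
    show "distinct [\<phi> u1, \<phi> u2, \<phi> u3, \<phi> u4]" using u(1) inj by (simp add: inj_eq)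
    show "?E \<inter> ?U = {}" using u(2) inj e0_range by (auto simp: inj_eq)
    show "F [e 0, \<phi> u1, \<phi> u2, \<phi> u3, \<phi> u4] \<noteq> 0" using Gu by (simp add: G_def)
    show "g a w = (if a = w then 1 else 0)" if a: "a \<in> ?E" and w: "w \<in> ?E \<union> ?U" for a w
    proof (cases "w = e 0")
      case True
      obtain x where "a = \<phi> x" using a by blast
      moreover from this have "a \<noteq> e 0" using e0_range by blast
      ultimately show ?thesis using True g_e0(1) by simp
    next
      case False
      then obtain x y where xy: "a = \<phi> x" "x \<in> {u1, u2, u3, u4}" "w = \<phi> y" "y \<in> {u1, u2, u3, u4} \<union> B"
        using a w by blast
      then have "x \<bullet> y = (if x = y then 1 else 0)" using orth by blast
      then show ?thesis using inj xy(1,3) by (simp add: g\<phi> inj_eq)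
    qed
    show "F [e 0, a, b, v, w] = 0" if ab: "a \<in> ?E" "b \<in> ?E" and v: "v \<in> ?U" for a b v w
    proof (cases "v = e 0")
      case False
      then obtain x y z where xyz: "a = \<phi> x" "x \<in> {u1, u2, u3, u4}" "b = \<phi> y" "y \<in> {u1, u2, u3, u4}"
        "v = \<phi> z" "z \<in> B" using ab v by blast
      \<comment> \<open>The last argument is tested on \<open>e 0\<close>, where an argument
        repeats, and on the image of \<open>\<phi>\<close>, where the vanishing of \<open>G\<close>
        applies.\<close>
      have "(\<lambda>w. F [e 0, a, b, v, w]) = (\<lambda>_. 0)"
      proof (intro eq_on_basis linF)
        show "F [e 0, a, b, v, \<phi> w] = 0" for w
          using van xyz(2,4,6) unfolding xyz(1,3,5) G_def by blast
      qed (simp_all add: repeat linear_iff)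
      then show ?thesis by metis
    qed (simp add: repeat)
  qed (use card B(1) span_U dim in auto)
qed

theorem mainTheorem5:
  fixes g :: "'a::real_vector \<Rightarrow> 'a \<Rightarrow> real" and F :: "'a list \<Rightarrow> real"
  assumes "dim (UNIV :: 'a set) = 10"
    and "inner_product g"
    and "euclidean_product g \<or> lorentzian_product g"
    and "alternating_form 5 F"
  shows "(\<forall>\<Xi>\<in>multivectors 3. bracket g (contract 3 \<Xi> F) F = (\<lambda>_. 0)) \<longleftrightarrow>
    (\<exists>F\<^sub>1 F\<^sub>2. simple_form 5 F\<^sub>1 \<and> simple_form 5 F\<^sub>2 \<and> orthogonal_simple g 5 F\<^sub>1 F\<^sub>2 \<and>
             F = (\<lambda>vs. F\<^sub>1 vs + F\<^sub>2 vs))"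
proof
  have fd: "dim (UNIV :: 'a set) > 0" using assms(1) by simp
  {
    assume flat: "\<forall>\<Xi>\<in>multivectors 3. bracket g (contract 3 \<Xi> F) F = (\<lambda>_. 0)"
    show "\<exists>F\<^sub>1 F\<^sub>2. simple_form 5 F\<^sub>1 \<and> simple_form 5 F\<^sub>2 \<and> orthogonal_simple g 5 F\<^sub>1 F\<^sub>2 \<and>
             F = (\<lambda>vs. F\<^sub>1 vs + F\<^sub>2 vs)"
    proof (cases "F = (\<lambda>_. 0)")
      case True
      \<comment> \<open>The zero form has no nonzero contraction to maximise; it is the sum of two
        zero forms, each a product of five zero factors.\<close>
      have "simple_form 5 (\<lambda>_. 0 :: real)"
        unfolding simple_form_def
        by (intro exI[of _ "replicate 5 (\<lambda>_. 0)"])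
          (auto simp: wedge_def eval_nat_numeral linear_iff)
      then show ?thesis using True by (intro exI[of _ "\<lambda>_. 0"]) (simp add: orthogonal_simple_def)
    next
      case False
      \<comment> \<open>Contractions with decomposable trivectors already give the derivation
        property that the splitting uses.\<close>
      have "vector_wedge [X, Y, Z] \<in> multivectors 3" for X Y Z :: 'a
        unfolding multivectors_def by (intro CollectI exI[of _ "[(1, [X, Y, Z])]"]) auto
      then have "(\<Sum>i<length vs. F (vs[i := sharp g (\<lambda>w. F [X, Y, Z, vs ! i, w])])) = 0" for X Y Z vs
        using flat bracket_contract_vector_wedge[OF fd assms(2,4), of X Y Z vs] by simp
      then show ?thesis by (rule orthogonal_sum_of_flat[OF assms False])
    qed
  next
    assume "\<exists>F\<^sub>1 F\<^sub>2. simple_form 5 F\<^sub>1 \<and> simple_form 5 F\<^sub>2 \<and> orthogonal_simple g 5 F\<^sub>1 F\<^sub>2 \<and>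
             F = (\<lambda>vs. F\<^sub>1 vs + F\<^sub>2 vs)"
    then show "\<forall>\<Xi>\<in>multivectors 3. bracket g (contract 3 \<Xi> F) F = (\<lambda>_. 0)"
      using bracket_contract_eq_0_of_orthogonal_simple[OF fd assms(2,4)] by blast
  }
qed

end
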